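(* Let $n,d\ge 1$, let $\mathcal{G}=\{\mathbf{G}_1,\dots,\mathbf{G}_m\}\subseteq\mathcal{S}_n(\mathbb{R}[X])$ be a finite set, and let $\mathbf{F}\in\mathcal{S}_n(\mathbb{R}[X])$. Assume: (1) $\mathbf{F}\succ\mathbf{0}$ on $\mathbf{K}_{\mathcal{G}}$; (2) $\mathbf{F}$ is bounded on $\mathbf{K}_{\mathcal{G}}$, i.e. there exists $N\in\mathbb{R}_+$ such that $N\cdot\mathbf{I}_n\pm\mathbf{F}\succcurlyeq\mathbf{0}$ on $\mathbf{K}_{\mathcal{G}}$; (3) for every $\mathbf{x}\in\mathbb{R}^n\setminus\{0\}$, $R_\infty(\mathbf{x}^T\mathbf{F}\mathbf{x},\mathbf{K}_{\mathcal{G}})$ is a finite subset of $\mathbb{R}_+$. Then there exist a finite subset $G$ of $\mathbb{R}[X]$ and (i) a matrix $\mathbf{X}_-\in\mathcal{M}_n(\mathbb{R}[X])$ such that $\mathbf{X}_-\mathbf{F}\mathbf{X}_-^T\in(T_G)^n\subseteq\mathcal{T}_{\mathcal{G}}$; (ii) a non-zero polynomial $b\in\mathbb{R}[X]$ such that $b^2\mathbf{F}\in(T_G)^n\subseteq\mathcal{T}_{\mathcal{G}}$.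
   Context: $\mathbb{R}[X]=\mathbb{R}[x_1,\dots,x_d]$; $\mathbb{R}_+$ denotes the set of positive real numbers. For a commutative unital ring $R$, $\mathcal{M}_n(R)$ is the ring of $n\times n$ matrices over $R$, $\mathcal{S}_n(R)$ its subset of symmetric matrices, $\mathbf{I}_n$ the identity matrix. A quadratic module in $\mathcal{M}_n(R)$ is a set $\mathcal{M}\subseteq\mathcal{S}_n(R)$ with $\mathbf{I}_n\in\mathcal{M}$, $\mathcal{M}+\mathcal{M}\subseteq\mathcal{M}$, and $A^T\mathcal{M}A\subseteq\mathcal{M}$ for all $A\in\mathcal{M}_n(R)$. A preordering in $\mathcal{M}_n(R)$ is a quadratic module $\mathcal{T}$ such that $\mathcal{T}\cap(R\cdot\mathbf{I}_n)$ is closed under multiplication. $\mathcal{T}_{\mathcal{G}}$ denotes the smallest preordering in $\mathcal{M}_n(\mathbb{R}[X])$ containing $\mathcal{G}$. For $G\subseteq \mathbb{R}[X]$, $T_G$ denotes the smallest preordering of $\mathbb{R}[X]$ (the smallest subset closed under addition and multiplication and containing all squares) that contains $G$. For a quadratic module $M\subseteq\mathbb{R}[X]$ (in particular $M=T_G$), $M^n$ denotes the set of all finite sums $\sum_i m_iA_i^TA_i$ with $m_i\in M$, $A_i\in\mathcal{M}_n(\mathbb{R}[X])$. $\mathbf{K}_{\mathcal{G}}=\{x\in\mathbb{R}^d : \mathbf{G}(x)\succcurlyeq\mathbf{0}\ \forall\,\mathbf{G}\in\mathcal{G}\}$. "$\succ\mathbf{0}$ (resp. $\succcurlyeq\mathbf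 0$) on a set" means positive definite (resp. positive semidefinite) at each point of the set. For $f\in\mathbb{R}[X]$ and $S\subseteq\mathbb{R}^d$, $R_\infty(f,S)$ is the set of asymptotic values of $f$ on $S$: all $y\in\mathbb{R}$ for which there is a sequence $(x_k)_{k\in\mathbb{N}}$ in $S$ with $\lim_{k\to\infty}\|x_k\|=\infty$ and $\lim_{k\to\infty}f(x_k)=y$. For constant $\mathbf{x}\in\mathbb{R}^n$, $\mathbf{x}^T\mathbf{F}\mathbf{x}$ is regarded as a polynomial in $\mathbb{R}[X]$. *)

theory Defs
  imports "HOL-Analysis.Analysis" "HOL-Library.Poly_Mapping"
begin

text \<open>
  The polynomial ring \<open>\<real>[x_i : i \<in> 'd]\<close> in \<open>CARD('d)\<close> variables is the monoid algebra of the
  free commutative monoid \<open>'d \<Rightarrow>\<^sub>0 nat\<close> of monomials.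
\<close>

type_synonym 'd rpoly = "('d \<Rightarrow>\<^sub>0 nat) \<Rightarrow>\<^sub>0 real"

definition const_poly :: "real \<Rightarrow> 'd rpoly" where
  "const_poly c = Poly_Mapping.single 0 c"

definition poly_eval :: "'d::finite rpoly \<Rightarrow> real ^ 'd \<Rightarrow> real" where
  "poly_eval p x =
     (\<Sum>m\<in>Poly_Mapping.keys p.
        Poly_Mapping.lookup p m * (\<Prod>i\<in>UNIV. (x $ i) ^ Poly_Mapping.lookup m i))"

definition mat_eval :: "'d::finite rpoly ^ 'n ^ 'n \<Rightarrow> real ^ 'd \<Rightarrow> real ^ 'n ^ 'n" where
  "mat_eval A x = map_matrix (\<lambda>p. poly_eval p x) A"

definition sym_mats :: "('a ^ 'n ^ 'n) set" where
  "sym_mats = {A. transpose A = A}"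

definition pos_semidef :: "real ^ 'n ^ 'n \<Rightarrow> bool" where
  "pos_semidef A \<longleftrightarrow> A \<in> sym_mats \<and> (\<forall>v. 0 \<le> v \<bullet> (A *v v))"

definition pos_def :: "real ^ 'n ^ 'n \<Rightarrow> bool" where
  "pos_def A \<longleftrightarrow> A \<in> sym_mats \<and> (\<forall>v. v \<noteq> 0 \<longrightarrow> 0 < v \<bullet> (A *v v))"

definition nonneg_set :: "('d::finite rpoly ^ 'n ^ 'n) set \<Rightarrow> (real ^ 'd) set" where
  "nonneg_set \<G> = {x. \<forall>A\<in>\<G>. pos_semidef (mat_eval A x)}"

definition preordering :: "'a::comm_ring_1 set \<Rightarrow> bool" where
  "preordering T \<longleftrightarrow>
     (\<forall>a\<in>T. \<forall>b\<in>T. a + b \<in> T) \<and> (\<forall>a\<in>T. \<forall>b\<in>T. a * b \<in> T) \<and> (\<forall>a. a ^ 2 \<in> T)"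

definition mat_quadratic_module :: "('a::comm_ring_1 ^ 'n ^ 'n) set \<Rightarrow> bool" where
  "mat_quadratic_module M \<longleftrightarrow>
     M \<subseteq> sym_mats \<and> mat 1 \<in> M \<and> (\<forall>B\<in>M. \<forall>C\<in>M. B + C \<in> M) \<and>
     (\<forall>A. \<forall>B\<in>M. transpose A ** B ** A \<in> M)"

text \<open>Since \<open>mat a\<close> is the scalar matrix \<open>a \<cdot> I\<close>, the set \<open>R \<cdot> I\<close> is \<open>range mat\<close>.\<close>

definition mat_preordering :: "('a::comm_ring_1 ^ 'n ^ 'n) set \<Rightarrow> bool" where
  "mat_preordering T \<longleftrightarrow>
     mat_quadratic_module T \<and>
     (\<forall>B\<in>T \<inter> range mat. \<forall>C\<in>T \<inter> range mat. B ** C \<in> T \<inter> range mat)"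

definition generated_preordering :: "'a::comm_ring_1 set \<Rightarrow> 'a set" where
  "generated_preordering G = preordering hull G"

definition generated_mat_preordering ::
    "('a::comm_ring_1 ^ 'n ^ 'n) set \<Rightarrow> ('a ^ 'n ^ 'n) set" where
  "generated_mat_preordering \<G> = mat_preordering hull \<G>"

text \<open>The set \<open>M^n\<close> for a quadratic module \<open>M\<close> of scalars, where \<open>n = CARD('n)\<close>.\<close>

definition weighted_squares :: "'a::comm_ring_1 set \<Rightarrow> ('a ^ 'n ^ 'n) set" where
  "weighted_squares M =
     {\<Sum>i<k. mat (m i) ** (transpose (A i) ** A i) |
        (k :: nat) m (A :: nat \<Rightarrow> 'a ^ 'n ^ 'n). \<forall>i<k. m i \<in> M}"

definition asymptotic_values :: "'d::finite rpoly \<Rightarrow> (real ^ 'd) set \<Rightarrow> real set" where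
  "asymptotic_values f S =
     {y. \<exists>X :: nat \<Rightarrow> real ^ 'd. (\<forall>k. X k \<in> S) \<and>
           filterlim (\<lambda>k. norm (X k)) at_top sequentially \<and>
           (\<lambda>k. poly_eval f (X k)) \<longlonglongrightarrow> y}"

definition quadratic_form :: "'d rpoly ^ 'n ^ 'n \<Rightarrow> real ^ 'n \<Rightarrow> 'd rpoly" where
  "quadratic_form F v =
     (\<Sum>i\<in>UNIV. \<Sum>j\<in>UNIV. const_poly (v $ i) * F $ i $ j * const_poly (v $ j))"

text \<open>
  The hulls above are indeed the smallest preorderings containing the generators; in the matrix
  case this uses that the generators are symmetric, so that some preordering contains them.
\<close>

lemma preordering_generated: "preordering (generated_preordering G)"
  unfolding generated_preordering_def
proof (rule hull_in)
  show "preordering (\<Inter>T)" if "Ball T preordering" for T :: "'a set set"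
    using that by (simp add: preordering_def)
qed

lemma mat_mult_mat: "mat a ** mat b = (mat (a * b) :: 'a::comm_ring_1 ^ 'n ^ 'n)"
  by (simp add: matrix_matrix_mult_def mat_def vec_eq_iff if_distrib[where f = "\<lambda>x. x * _"]
      if_distrib[where f = "\<lambda>x. _ * x"] sum.delta sum.delta' cong: if_cong)

lemma mat_preordering_sym_mats: "mat_preordering (sym_mats :: ('a::comm_ring_1 ^ 'n ^ 'n) set)"
proof -
  have add: "transpose (B + C) = transpose B + transpose C" for B C :: "'a ^ 'n ^ 'n"
    by (simp add: transpose_def vec_eq_iff)
  have "B ** C \<in> sym_mats \<inter> range mat"
    if "B \<in> range mat" "C \<in> range mat" for B C :: "'a ^ 'n ^ 'n"
    using that by (elim imageE) (simp add: mat_mult_mat sym_mats_def transpose_mat)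
  moreover have "transpose A ** B ** A \<in> sym_mats" if "B \<in> sym_mats" for A B :: "'a ^ 'n ^ 'n"
    using that by (simp add: sym_mats_def matrix_transpose_mul matrix_mul_assoc)
  ultimately show ?thesis
    unfolding mat_preordering_def mat_quadratic_module_def
    by (simp add: sym_mats_def add transpose_mat)
qed

lemma mat_preordering_generated:
  fixes \<G> :: "('a::comm_ring_1 ^ 'n ^ 'n) set"
  assumes "\<G> \<subseteq> sym_mats"
  shows "mat_preordering (generated_mat_preordering \<G>)"
proof -
  define \<T> where "\<T> = {T. mat_preordering T \<and> \<G> \<subseteq> T}"
  have "sym_mats \<in> \<T>"
    using assms mat_preordering_sym_mats by (simp add: \<T>_def)
  then have "\<Inter>\<T> \<subseteq> sym_mats"
    by (rule Inter_lower)
  moreover have "B ** C \<in> range mat" if "B \<in> range mat" "C \<in> range mat" for B C :: "'a ^ 'n ^ 'n"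
    using that by (elim imageE) (simp add: mat_mult_mat)
  ultimately have "mat_preordering (\<Inter>\<T>)"
    by (simp add: mat_preordering_def mat_quadratic_module_def \<T>_def)
  then show ?thesis
    by (simp add: generated_mat_preordering_def hull_def \<T>_def)
qed

end

theory Submission
  imports Defs "HOL-Algebra.Algebraic_Closure_Type"
begin

hide_const (open) Polynomials.degree Polynomials.lead_coeff module.smult up_ring.coeff up_ring.monom
  Coset.order
no_notation Polynomials.var (\<open>X\<index>\<close>)
no_notation fps_nth (infixl \<open>$\<close> 75)

text \<open>
  By Lagrange's reduction, every symmetric matrix over the polynomial ring is, up to a nonzero square
  factor, a combination of rank one squares whose weights are values of its own quadratic form.
  For \<open>G\<close> we take the weights of the members of \<open>\<G>\<close>, which as scalar matrices lie in the generated
  preordering. If a weight \<open>f\<close> of \<open>F\<close> had no multiple \<open>c\<^sup>2 f\<close>, \<open>c \<noteq> 0\<close>, in \<open>T\<^sub>G\<close>, some ordering of the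
  polynomial ring would make \<open>f\<close> negative and \<open>G\<close> nonnegative. By the Artin-Lang theorem these signs
  occur at a point, which then lies in the nonnegativity set of \<open>\<G>\<close> although \<open>F\<close> is not positive
  semidefinite there.

  The Artin-Lang theorem is proved one variable at a time: the ordered polynomial ring is embedded in
  a real closed field, and Hoermander's form of quantifier elimination transfers sign conditions from
  this field to the real numbers. For the statement about \<open>X F X\<^sup>T\<close> the zero matrix suffices.
\<close>

section \<open>Real closed fields\<close>

text \<open>Three obstacles shape the proof. An identity expressing \<open>b\<^sup>2 * A\<close>
  through weights controls the sign of \<open>A\<close> only where \<open>b\<close> does not vanish,
  so the point supplied by Artin-Lang must also avoid the zeros of the finitely many multipliers;
  their squares are added to the sign conditions. Next, an ordering arises inside a proof by Zorn's
  lemma, while fraction fields and real closures are type constructors that read the order from a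
  class instance; hence the order of the type is fixed once, as a worst case. Finally, with one
  variable split off, the coefficients are themselves polynomials, and comparing the real closed
  field with the reals requires a real parameter point at which coefficients have the signs given by
  the ordering. For families closed under derivatives and pseudo-remainders the leading coefficients
  suffice, and for these the induction over the variables supplies the point.\<close>

class rcf = linordered_field +
  assumes sum_IVT: "a < b \<Longrightarrow> (\<Sum>k\<le>n. f k * a ^ k) < 0 \<Longrightarrow> 0 < (\<Sum>k\<le>n. f k * b ^ k) \<Longrightarrow>
    \<exists>x. a < x \<and> x < b \<and> (\<Sum>k\<le>n. f k * x ^ k) = 0"

text \<open>The class axiom speaks of coefficient sums because \<open>poly\<close> carries a sort
  constraint that the type variable does not yet satisfy inside the class specification.\<close>

lemma rcf_IVT_pos:
  fixes p :: "'a::rcf poly"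
  assumes "a < b" "poly p a < 0" "0 < poly p b"
  obtains x where "a < x" "x < b" "poly p x = 0"
  using sum_IVT[of a b "coeff p" "degree p"] assms by (auto simp: poly_altdef)

lemma rcf_IVT:
  fixes p :: "'a::rcf poly"
  assumes "a < b" "poly p a * poly p b < 0"
  obtains x where "a < x" "x < b" "poly p x = 0"
  using rcf_IVT_pos[of a b p] rcf_IVT_pos[of a b "- p"] assms
  by (auto simp: mult_less_0_iff)

text \<open>Without compactness no maximum is available, so the argument is algebraic. After
  \<open>b\<close> is replaced by the first root \<open>b'\<close> beyond \<open>a\<close>, the
  roots at both ends are factored out. The cofactor \<open>q\<close> then has no root on the closed
  interval and keeps its sign, which makes the cofactor \<open>h\<close> of the derivative change
  sign.\<close>

lemma rcf_rolle:
  fixes p :: "'a::rcf poly"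
  assumes "a < b" "poly p a = 0" "poly p b = 0"
  obtains c where "a < c" "c < b" "poly (pderiv p) c = 0"
proof (cases "p = 0")
  case True
  then show ?thesis using that dense[OF \<open>a < b\<close>] by auto
next
  case False
  \<comment> \<open>The interval is closed at \<open>b\<close>, so that the set is nonempty.\<close>
  define R where "R = {x. poly p x = 0 \<and> a < x \<and> x \<le> b}"
  have "finite R" unfolding R_def using poly_roots_finite[OF False] by simp
  moreover have "b \<in> R" using assms by (simp add: R_def)
  ultimately have mem: "Min R \<in> R" and le: "\<And>x. x \<in> R \<Longrightarrow> Min R \<le> x"
    using Min_in by (auto intro: Min_le)
  define b' where "b' = Min R"
  have b': "poly p b' = 0" "a < b'" "b' \<le> b" using mem by (auto simp: R_def b'_def)
  have nr: "poly p x \<noteq> 0" if "a < x" "x < b'" for x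
    using le[of x] that b' by (auto simp: R_def b'_def)
  obtain r where r: "p = [:- a, 1:] ^ order a p * r" "\<not> [:- a, 1:] dvd r"
    using order_decomp[OF False] by blast
  have ra: "poly r a \<noteq> 0" using r(2) by (simp add: poly_eq_0_iff_dvd)
  have "r \<noteq> 0" using False r by auto
  have rb: "poly r b' = 0"
    using b' arg_cong[OF r(1), of "\<lambda>p. poly p b'"] by auto
  obtain q where q: "r = [:- b', 1:] ^ order b' r * q" "\<not> [:- b', 1:] dvd q"
    using order_decomp[OF \<open>r \<noteq> 0\<close>] by blast
  have qb: "poly q b' \<noteq> 0" using q(2) by (simp add: poly_eq_0_iff_dvd)
  have qa: "poly q a \<noteq> 0" using ra arg_cong[OF q(1), of "\<lambda>p. poly p a"] by auto
  obtain m where m: "order a p = Suc m"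
    using assms(2) False order_root[of p a] not0_implies_Suc by auto
  obtain n where n: "order b' r = Suc n"
    using rb \<open>r \<noteq> 0\<close> order_root[of r b'] not0_implies_Suc by auto
  have p: "p = [:- a, 1:] ^ Suc m * ([:- b', 1:] ^ Suc n * q)"
    using r(1) q(1) m n by simp
  \<comment> \<open>The derivative of \<open>p\<close> with the powers of exponents \<open>m\<close>
    and \<open>n\<close> of the two linear factors removed; at each end only one summand
    survives.\<close>
  define h where "h = smult (of_nat (Suc m)) ([:- b', 1:] * q) + smult (of_nat (Suc n)) ([:- a, 1:] * q)
    + [:- a, 1:] * [:- b', 1:] * pderiv q"
  have nq: "poly q x \<noteq> 0" if "a < x" "x < b'" for x
    using nr[OF that] arg_cong[OF p, of "\<lambda>p. poly p x"] by auto
  have q_same: "0 < poly q a * poly q b'"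
  proof (rule ccontr)
    assume "\<not> ?thesis"
    then have "poly q a * poly q b' < 0" using qa qb by (simp add: not_less le_less)
    then show False using rcf_IVT[OF b'(2), of q] nq by blast
  qed
  have ha: "poly h a = - (of_nat (Suc m) * (b' - a) * poly q a)"
    by (simp add: h_def algebra_simps)
  have hb: "poly h b' = of_nat (Suc n) * (b' - a) * poly q b'"
    by (simp add: h_def algebra_simps)
  have "poly h a * poly h b' =
      - ((of_nat (Suc m) * of_nat (Suc n)) * ((b' - a) * (b' - a)) * (poly q a * poly q b'))"
    unfolding ha hb by (simp only: mult_ac minus_mult_left)
  also have "\<dots> < 0"
    using q_same b'(2) by (simp only: neg_less_0_iff_less zero_less_mult_iff of_nat_0_less_iff) auto
  finally obtain c where c: "a < c" "c < b'" "poly h c = 0"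
    using rcf_IVT[OF b'(2)] by blast
  have "poly (pderiv p) c = (c - a) ^ m * (c - b') ^ n * poly h c"
    unfolding p h_def pderiv_mult pderiv_power_Suc
    by (simp add: pderiv_pCons) (simp add: algebra_simps)
  then show ?thesis using c b' that[of c] by auto
qed

lemma rcf_MVT:
  fixes p :: "'a::rcf poly"
  assumes "a < b"
  obtains c where "a < c" "c < b" "poly p b - poly p a = (b - a) * poly (pderiv p) c"
proof -
  define s where "s = (poly p b - poly p a) / (b - a)"
  have s: "s * (b - a) = poly p b - poly p a" using assms by (simp add: s_def)
  define q where "q = p - [:poly p a - a * s, s:]"
  have "poly q a = 0" by (simp add: q_def)
  moreover have "poly q b = 0" using s by (simp add: q_def algebra_simps)
  ultimately obtain c where c: "a < c" "c < b" "poly (pderiv q) c = 0"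
    using rcf_rolle[OF assms] by blast
  from c(3) have "poly (pderiv p) c = s" by (simp add: q_def pderiv_diff pderiv_pCons)
  then show ?thesis using that[OF c(1,2)] s by (simp add: mult.commute)
qed

lemma rcf_pderiv_pos_less:
  fixes p :: "'a::rcf poly"
  assumes "a < b" "\<And>x. a < x \<Longrightarrow> x < b \<Longrightarrow> 0 < poly (pderiv p) x"
  shows "poly p a < poly p b"
proof -
  obtain c where c: "a < c" "c < b" "poly p b - poly p a = (b - a) * poly (pderiv p) c"
    using rcf_MVT[OF assms(1)] by blast
  have "0 < (b - a) * poly (pderiv p) c" using assms c by simp
  with c show ?thesis by simp
qed

text \<open>Stands in for the limit at infinity when a class of points extends beyond every cut
  point.\<close>

lemma poly_unbounded:
  fixes p :: "'a::linordered_field poly"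
  assumes "0 < degree p"
  shows "\<exists>B. \<forall>x. B \<le> \<bar>x\<bar> \<longrightarrow> C \<le> \<bar>poly p x\<bar>"
  using assms
proof (induction p arbitrary: C)
  case 0
  then show ?case by simp
next
  case (pCons a q)
  have q0: "q \<noteq> 0" using pCons.prems by auto
  have "\<exists>B c. 0 < c \<and> (\<forall>x. B \<le> \<bar>x\<bar> \<longrightarrow> c \<le> \<bar>poly q x\<bar>)"
  proof (cases "degree q = 0")
    case True
    then obtain c where "q = [:c:]" by (metis degree_eq_zeroE)
    then show ?thesis using q0 by (intro exI[of _ 0] exI[of _ "\<bar>c\<bar>"]) auto
  next
    case False
    then show ?thesis using pCons.IH[of 1] zero_less_one by blast
  qed
  then obtain B c where c: "0 < c" and B: "\<And>x. B \<le> \<bar>x\<bar> \<Longrightarrow> c \<le> \<bar>poly q x\<bar>" by blast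
  define D where "D = (\<bar>C\<bar> + \<bar>a\<bar>) / c"
  have D: "D * c = \<bar>C\<bar> + \<bar>a\<bar>" "0 \<le> D" using c by (auto simp: D_def)
  show ?case
  proof (intro exI[of _ "max B D"] allI impI)
    fix x :: 'a assume "max B D \<le> \<bar>x\<bar>"
    then have x: "B \<le> \<bar>x\<bar>" "D \<le> \<bar>x\<bar>" by auto
    have "D * c \<le> \<bar>x\<bar> * \<bar>poly q x\<bar>" using x B[OF x(1)] D c by (intro mult_mono) auto
    then have "\<bar>C\<bar> + \<bar>a\<bar> \<le> \<bar>x * poly q x\<bar>" using D by (simp add: abs_mult)
    then have "C \<le> \<bar>a + x * poly q x\<bar>" by linarith
    then show "C \<le> \<bar>poly (pCons a q) x\<bar>" by simp
  qed
qed

section \<open>Sign conditions over two real closed fields\<close>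

text \<open>Integer valued, so that signs taken in two different ordered rings can be
  compared.\<close>

definition sg :: "'a::linordered_idom \<Rightarrow> int" where
  "sg x = (if 0 < x then 1 else if x < 0 then - 1 else 0)"

lemma sg_simps [simp]: "sg 0 = 0" "sg 1 = 1" "sg x = 0 \<longleftrightarrow> x = 0"
  by (auto simp: sg_def)

lemma sg_mult: "sg (x * y) = sg x * sg y"
  by (auto simp: sg_def zero_less_mult_iff mult_less_0_iff)

lemma sg_power: "sg (x ^ n) = sg x ^ n"
  by (induction n) (auto simp: sg_mult)

lemma sg_minus [simp]: "sg (- x) = - sg x"
  by (auto simp: sg_def)

lemma sg_eq_iff:
  assumes "sg x = sg y"
  shows "0 < x \<longleftrightarrow> 0 < y" "x < 0 \<longleftrightarrow> y < 0" "x = 0 \<longleftrightarrow> y = 0"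
  using assms by (auto simp: sg_def split: if_splits)

lemma sg_mono: "x \<le> y \<Longrightarrow> sg x \<le> sg y"
  by (auto simp: sg_def)

locale cring_hom =
  fixes h :: "'a::comm_ring_1 \<Rightarrow> 'b::comm_ring_1"
  assumes hom_add: "h (x + y) = h x + h y"
    and hom_mult: "h (x * y) = h x * h y"
    and hom_1: "h 1 = 1"
begin

lemma hom_0 [simp]: "h 0 = 0"
  using hom_add[of 0 0] by simp

lemma hom_uminus: "h (- x) = - h x"
  using hom_add[of x "- x"] by (simp add: eq_neg_iff_add_eq_0 add.commute)

lemma hom_diff: "h (x - y) = h x - h y"
  using hom_add[of x "- y"] by (simp add: hom_uminus)

lemma hom_of_nat: "h (of_nat n) = of_nat n"
  by (induction n) (auto simp: hom_add hom_1)

lemma hom_power: "h (x ^ n) = h x ^ n"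
  by (induction n) (auto simp: hom_mult hom_1)

lemma hom_sum: "h (sum f S) = (\<Sum>x\<in>S. h (f x))"
  by (induction S rule: infinite_finite_induct) (auto simp: hom_add)

lemma map_poly_add: "map_poly h (p + q) = map_poly h p + map_poly h q"
  by (rule poly_eqI) (simp add: coeff_map_poly hom_add)

lemma map_poly_smult: "map_poly h (smult c p) = smult (h c) (map_poly h p)"
  by (rule poly_eqI) (simp add: coeff_map_poly hom_mult)

lemma map_poly_mult: "map_poly h (p * q) = map_poly h p * map_poly h q"
  by (induction p) (simp_all add: map_poly_add map_poly_smult map_poly_pCons)

end

lemma map_poly_pderiv:
  fixes h :: "'a::idom \<Rightarrow> 'b::idom"
  assumes "cring_hom h"
  shows "map_poly h (pderiv p) = pderiv (map_poly h p)"
proof -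
  interpret cring_hom h by fact
  show ?thesis
    by (rule poly_eqI) (simp add: coeff_map_poly coeff_pderiv hom_mult hom_add hom_of_nat hom_1)
qed

lemma cring_hom_comp:
  assumes "cring_hom f" "cring_hom g"
  shows "cring_hom (\<lambda>x. g (f x))"
  using assms by (simp add: cring_hom_def)

definition ev :: "('a::zero \<Rightarrow> 'b::comm_semiring_0) \<Rightarrow> 'a poly \<Rightarrow> 'b \<Rightarrow> 'b" where
  "ev h f x = poly (map_poly h f) x"

definition same_signs ::
    "('a::zero \<Rightarrow> 'm::linordered_idom) \<Rightarrow> ('a \<Rightarrow> 'r::linordered_idom) \<Rightarrow> 'a poly set \<Rightarrow> 'm \<Rightarrow> 'r \<Rightarrow> bool"
  where "same_signs h k \<Psi> x y \<longleftrightarrow> (\<forall>f\<in>\<Psi>. sg (ev h f x) = sg (ev k f y))"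

lemma same_signs_refl: "same_signs h h \<Psi> x x"
  by (simp add: same_signs_def)

lemma same_signs_sym: "same_signs h k \<Psi> x y \<Longrightarrow> same_signs k h \<Psi> y x"
  by (simp add: same_signs_def)

lemma same_signs_trans:
  "same_signs h k \<Psi> x y \<Longrightarrow> same_signs k l \<Psi> y z \<Longrightarrow> same_signs h l \<Psi> x z"
  by (simp add: same_signs_def)

text \<open>
  The sign conditions realised by \<open>\<Psi>\<close> cut both lines into the same classes, in the same order.
  This replaces the sign tables of Hoermander's quantifier elimination.
\<close>

definition same_diagram ::
    "('a::zero \<Rightarrow> 'm::linordered_idom) \<Rightarrow> ('a \<Rightarrow> 'r::linordered_idom) \<Rightarrow> 'a poly set \<Rightarrow> bool"
  where "same_diagram h k \<Psi> \<longleftrightarrow>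
    (\<forall>x. \<exists>y. same_signs h k \<Psi> x y) \<and> (\<forall>y. \<exists>x. same_signs h k \<Psi> x y) \<and>
    (\<forall>x y x' y'. same_signs h k \<Psi> x y \<longrightarrow> same_signs h k \<Psi> x' y' \<longrightarrow> x < x' \<longrightarrow>
       \<not> same_signs h h \<Psi> x x' \<longrightarrow> y < y')"

text \<open>Totality of the orders turns the one-directional order clause around: equal partners
  would give equal signs, and reversed partners reversed points.\<close>

lemma same_diagram_sym:
  assumes "same_diagram h k \<Psi>"
  shows "same_diagram k h \<Psi>"
proof -
  have "x < x'" if "same_signs k h \<Psi> y x" "same_signs k h \<Psi> y' x'" "y < y'" "\<not> same_signs k k \<Psi> y y'"
    for x x' y y'
  proof (rule ccontr)
    assume "\<not> x < x'"
    then consider "x = x'" | "x' < x" by fastforce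
    then show False
    proof cases
      case 1
      then show ?thesis using that same_signs_trans same_signs_sym by metis
    next
      case 2
      have "\<not> same_signs h h \<Psi> x' x" using that same_signs_trans same_signs_sym by metis
      then have "y' < y"
        using assms 2 same_signs_sym[OF that(1)] same_signs_sym[OF that(2)]
        unfolding same_diagram_def by blast
      then show ?thesis using that by simp
    qed
  qed
  then show ?thesis
    using assms unfolding same_diagram_def by (meson same_signs_sym)
qed

lemma same_diagram_less:
  assumes "same_diagram h k \<Psi>" "same_signs h k \<Psi> x y" "same_signs h k \<Psi> x' y'" "x < x'"
    "\<not> same_signs h h \<Psi> x x'"
  shows "y < y'"
  using assms unfolding same_diagram_def by blast

text \<open>Equal signs allow \<open>x\<close> and \<open>x'\<close> to share one partner
  \<open>y\<close>; a point \<open>t\<close> between them with other signs would need a partner both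
  above and below \<open>y\<close>.\<close>

lemma same_diagram_convex:
  assumes T: "same_diagram h k \<Psi>" and "same_signs h h \<Psi> x x'" "x < t" "t < x'"
  shows "same_signs h h \<Psi> x t"
proof (rule ccontr)
  assume n: "\<not> ?thesis"
  then have n': "\<not> same_signs h h \<Psi> t x'"
    using assms(2) same_signs_trans same_signs_sym by blast
  obtain y where y: "same_signs h k \<Psi> x y" using T unfolding same_diagram_def by blast
  obtain s where s: "same_signs h k \<Psi> t s" using T unfolding same_diagram_def by blast
  have y': "same_signs h k \<Psi> x' y" using y assms(2) same_signs_trans same_signs_sym by blast
  have "y < s" using same_diagram_less[OF T y s \<open>x < t\<close> n] .
  moreover have "s < y" using same_diagram_less[OF T s y' \<open>t < x'\<close> n'] .
  ultimately show False by simp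
qed

text \<open>Constants are left out: each has one sign on the whole line, so every change of signs is
  due to the roots collected here.\<close>

definition cut_points :: "('a::zero \<Rightarrow> 'm::comm_semiring_0) \<Rightarrow> 'a poly set \<Rightarrow> 'm set" where
  "cut_points h \<Psi> = {z. \<exists>g\<in>\<Psi>. 0 < degree g \<and> ev h g z = 0}"

lemma ev_const: "degree g = 0 \<Longrightarrow> ev h g x = h (lead_coeff g)" if "h 0 = 0"
  using that by (elim degree_eq_zeroE) (simp add: ev_def map_poly_pCons)

lemma degree_map_poly_lead:
  assumes "h 0 = 0" "h (lead_coeff g) \<noteq> 0"
  shows "degree (map_poly h g) = degree g"
  using assms by (intro antisym degree_le le_degree) (auto simp: coeff_map_poly coeff_eq_0)

lemma finite_cut_points:
  fixes h :: "'a::zero \<Rightarrow> 'm::{comm_ring_1,ring_no_zero_divisors}"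
  assumes "finite \<Psi>" "\<And>g. g \<in> \<Psi> \<Longrightarrow> h (lead_coeff g) \<noteq> 0" "h 0 = 0"
  shows "finite (cut_points h \<Psi>)"
proof -
  have "cut_points h \<Psi> \<subseteq> (\<Union>g\<in>\<Psi>. {z. poly (map_poly h g) z = 0})"
    by (auto simp: cut_points_def ev_def)
  moreover have "finite {z. poly (map_poly h g) z = 0}" if "g \<in> \<Psi>" for g
  proof (rule poly_roots_finite)
    have "coeff (map_poly h g) (degree g) \<noteq> 0"
      using assms(2)[OF that] assms(3) by (simp add: coeff_map_poly)
    then show "map_poly h g \<noteq> 0" by auto
  qed
  ultimately show ?thesis using assms(1) finite_subset by blast
qed

lemma cut_point_between:
  fixes h :: "'a::zero \<Rightarrow> 'm::rcf"
  assumes h: "h 0 = 0" and "x < y" "\<not> same_signs h h \<Psi> x y"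
  shows "\<exists>z\<in>cut_points h \<Psi>. x \<le> z \<and> z \<le> y"
proof -
  obtain g where g: "g \<in> \<Psi>" "sg (ev h g x) \<noteq> sg (ev h g y)"
    using assms by (auto simp: same_signs_def)
  have "0 < degree g"
    using g(2) ev_const[of h g, OF h] by (cases "degree g = 0") auto
  moreover have "\<exists>z. x \<le> z \<and> z \<le> y \<and> ev h g z = 0"
  proof (cases "ev h g x = 0 \<or> ev h g y = 0")
    case True
    then show ?thesis using \<open>x < y\<close> less_imp_le by blast
  next
    case False
    then have "poly (map_poly h g) x * poly (map_poly h g) y < 0"
      using g(2) by (auto simp: ev_def sg_def mult_less_0_iff split: if_splits)
    then show ?thesis using rcf_IVT[OF \<open>x < y\<close>] unfolding ev_def by (metis less_imp_le)
  qed
  ultimately show ?thesis using g(1) unfolding cut_points_def by blast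
qed

lemma cut_points_same_signs:
  assumes "same_signs h k \<Psi> x y"
  shows "x \<in> cut_points h \<Psi> \<longleftrightarrow> y \<in> cut_points k \<Psi>"
proof -
  have "ev h g x = 0 \<longleftrightarrow> ev k g y = 0" if "g \<in> \<Psi>" for g
    using assms that sg_eq_iff(3) unfolding same_signs_def
    by (metis sg_simps(3))
  then show ?thesis by (auto simp: cut_points_def)
qed

text \<open>The correspondence preserves the order of classes but does not pair points uniquely: a
  partner \<open>w0\<close> of \<open>z\<close> is just some cut point above \<open>y\<close>. If
  the nearest cut point \<open>w\<close> above \<open>y\<close> differed in signs from
  \<open>z\<close>, its partner would lie beyond \<open>z\<close>, and order preservation would put
  \<open>w0\<close> below \<open>w\<close>.\<close>

lemma next_cut_point:
  fixes h :: "'a::zero \<Rightarrow> 'm::rcf" and k :: "'a \<Rightarrow> 'r::rcf"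
  assumes T: "same_diagram h k \<Psi>" and fin: "finite (cut_points k \<Psi>)"
    and xy: "same_signs h k \<Psi> x y" and x: "x \<notin> cut_points h \<Psi>"
    and z: "z \<in> cut_points h \<Psi>" "x < z" "\<And>z'. z' \<in> cut_points h \<Psi> \<Longrightarrow> x < z' \<Longrightarrow> z \<le> z'"
  obtains w where "w \<in> cut_points k \<Psi>" "y < w"
    "\<And>w'. w' \<in> cut_points k \<Psi> \<Longrightarrow> y < w' \<Longrightarrow> w \<le> w'" "same_signs h k \<Psi> z w"
proof -
  note T' = same_diagram_sym[OF T]
  have yc: "y \<notin> cut_points k \<Psi>" using cut_points_same_signs[OF xy] x by blast
  obtain w0 where w0: "same_signs h k \<Psi> z w0" using T unfolding same_diagram_def by blast
  have w0c: "w0 \<in> cut_points k \<Psi>" using cut_points_same_signs[OF w0] z(1) by blast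
  have "\<not> same_signs h h \<Psi> x z" using cut_points_same_signs x z(1) by blast
  then have "y < w0" using same_diagram_less[OF T xy w0 z(2)] by blast
  define W where "W = {w \<in> cut_points k \<Psi>. y < w}"
  have W: "finite W" "w0 \<in> W" using fin w0c \<open>y < w0\<close> by (auto simp: W_def)
  define w where "w = Min W"
  have "w \<in> W" unfolding w_def using W by (intro Min_in) auto
  have wle: "w \<le> w'" if "w' \<in> cut_points k \<Psi>" "y < w'" for w'
    unfolding w_def using W that by (intro Min_le) (auto simp: W_def)
  obtain z1 where z1: "same_signs h k \<Psi> z1 w" using T unfolding same_diagram_def by blast
  have z1c: "z1 \<in> cut_points h \<Psi>" using cut_points_same_signs[OF z1] \<open>w \<in> W\<close> by (auto simp: W_def)
  have "\<not> same_signs k k \<Psi> y w" using cut_points_same_signs[of k k \<Psi> y w] yc \<open>w \<in> W\<close>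
    by (auto simp: W_def)
  then have "x < z1"
    using same_diagram_less[OF T' same_signs_sym[OF xy] same_signs_sym[OF z1]] \<open>w \<in> W\<close>
    by (auto simp: W_def)
  then have "z \<le> z1" using z(3) z1c by blast
  have "same_signs h h \<Psi> z z1"
  proof (rule ccontr)
    assume n: "\<not> ?thesis"
    then have "z < z1" using \<open>z \<le> z1\<close> same_signs_refl by (metis le_less)
    then have "w0 < w" using same_diagram_less[OF T w0 z1] n by blast
    then show False using wle[OF w0c \<open>y < w0\<close>] by simp
  qed
  then have "same_signs h k \<Psi> z w" using z1 same_signs_trans by blast
  then show ?thesis using that \<open>w \<in> W\<close> wle by (auto simp: W_def)
qed

text \<open>Mirror image of \<open>next_cut_point\<close>, for the argument run from right to
  left.\<close>

lemma prev_cut_point: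
  fixes h :: "'a::zero \<Rightarrow> 'm::rcf" and k :: "'a \<Rightarrow> 'r::rcf"
  assumes T: "same_diagram h k \<Psi>" and fin: "finite (cut_points k \<Psi>)"
    and xy: "same_signs h k \<Psi> x y" and x: "x \<notin> cut_points h \<Psi>"
    and z: "z \<in> cut_points h \<Psi>" "z < x" "\<And>z'. z' \<in> cut_points h \<Psi> \<Longrightarrow> z' < x \<Longrightarrow> z' \<le> z"
  obtains w where "w \<in> cut_points k \<Psi>" "w < y"
    "\<And>w'. w' \<in> cut_points k \<Psi> \<Longrightarrow> w' < y \<Longrightarrow> w' \<le> w" "same_signs h k \<Psi> z w"
proof -
  note T' = same_diagram_sym[OF T]
  have yc: "y \<notin> cut_points k \<Psi>" using cut_points_same_signs[OF xy] x by blast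
  obtain w0 where w0: "same_signs h k \<Psi> z w0" using T unfolding same_diagram_def by blast
  have w0c: "w0 \<in> cut_points k \<Psi>" using cut_points_same_signs[OF w0] z(1) by blast
  have "\<not> same_signs h h \<Psi> z x" using cut_points_same_signs x z(1) by blast
  then have "w0 < y" using same_diagram_less[OF T w0 xy z(2)] by blast
  define W where "W = {w \<in> cut_points k \<Psi>. w < y}"
  have W: "finite W" "w0 \<in> W" using fin w0c \<open>w0 < y\<close> by (auto simp: W_def)
  define w where "w = Max W"
  have "w \<in> W" unfolding w_def using W by (intro Max_in) auto
  have wle: "w' \<le> w" if "w' \<in> cut_points k \<Psi>" "w' < y" for w'
    unfolding w_def using W that by (intro Max_ge) (auto simp: W_def)
  obtain z1 where z1: "same_signs h k \<Psi> z1 w" using T unfolding same_diagram_def by blast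
  have z1c: "z1 \<in> cut_points h \<Psi>" using cut_points_same_signs[OF z1] \<open>w \<in> W\<close> by (auto simp: W_def)
  have "\<not> same_signs k k \<Psi> w y" using cut_points_same_signs[of k k \<Psi> w y] yc \<open>w \<in> W\<close>
    by (auto simp: W_def)
  then have "z1 < x"
    using same_diagram_less[OF T' same_signs_sym[OF z1] same_signs_sym[OF xy]] \<open>w \<in> W\<close>
    by (auto simp: W_def)
  then have "z1 \<le> z" using z(3) z1c by blast
  have "same_signs h h \<Psi> z1 z"
  proof (rule ccontr)
    assume n: "\<not> ?thesis"
    then have "z1 < z" using \<open>z1 \<le> z\<close> same_signs_refl by (metis le_less)
    then have "w < w0" using same_diagram_less[OF T z1 w0] n by blast
    then show False using wle[OF w0c \<open>w0 < y\<close>] by simp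
  qed
  then have "same_signs h k \<Psi> z w" using z1 same_signs_trans same_signs_sym by blast
  then show ?thesis using that \<open>w \<in> W\<close> wle by (auto simp: W_def)
qed

text \<open>
  One-sided core of the step: \<open>A\<close> and \<open>B\<close> are corresponding classes, on which \<open>F\<close> and \<open>G\<close>
  increase; either there is a next cut point on both sides or on neither.
\<close>

lemma positive_value_transfer:
  fixes F :: "'m::rcf poly" and G :: "'r::rcf poly"
  assumes Zr: "y \<notin> Zr" and finm: "finite Zm"
    and y: "y \<in> B" and Fx: "0 < poly F x"
    and degG: "0 < degree G"
    and cutm: "\<And>t. x < t \<Longrightarrow> t \<notin> A \<Longrightarrow> \<exists>z\<in>Zm. x < z \<and> z \<le> t"
    and cutr: "\<And>t. y < t \<Longrightarrow> t \<notin> B \<Longrightarrow> \<exists>w\<in>Zr. y < w \<and> w \<le> t"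
    and nxt: "\<And>z. z \<in> Zm \<Longrightarrow> x < z \<Longrightarrow> (\<And>z'. z' \<in> Zm \<Longrightarrow> x < z' \<Longrightarrow> z \<le> z') \<Longrightarrow> 0 < poly F z \<Longrightarrow>
      \<exists>w\<in>Zr. y < w \<and> (\<forall>w'\<in>Zr. y < w' \<longrightarrow> w \<le> w') \<and> 0 < poly G w"
    and none: "(\<And>z. z \<in> Zm \<Longrightarrow> z \<le> x) \<Longrightarrow> \<forall>w\<in>Zr. w \<le> y"
    and dF: "\<And>t. t \<in> A \<Longrightarrow> 0 < poly (pderiv F) t"
    and dG: "\<And>t. t \<in> B \<Longrightarrow> 0 < poly (pderiv G) t"
  shows "\<exists>s\<in>B. 0 < poly G s"
proof (cases "\<exists>z\<in>Zm. x < z")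
  case False
  \<comment> \<open>No cut point lies beyond \<open>x\<close>, hence none beyond \<open>y\<close>:
    \<open>B\<close> contains the whole ray from \<open>y\<close> on, where the increasing
    \<open>G\<close> is unbounded.\<close>
  then have w: "\<forall>w\<in>Zr. w \<le> y" using none by (meson not_less)
  have inB: "t \<in> B" if "y \<le> t" for t
    using cutr[of t] w y that by (cases "t = y") (auto simp: not_less[symmetric])
  obtain C where C: "\<And>t. C \<le> \<bar>t\<bar> \<Longrightarrow> \<bar>poly G y\<bar> + 1 \<le> \<bar>poly G t\<bar>"
    using poly_unbounded[OF degG] by blast
  define t where "t = \<bar>y\<bar> + \<bar>C\<bar> + 1"
  have t: "y < t" "C \<le> \<bar>t\<bar>" by (auto simp: t_def)
  have "poly G y < poly G t"
    using t(1) by (intro rcf_pderiv_pos_less dG inB) auto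
  with C[OF t(2)] have "0 < poly G t" by (auto simp: abs_if split: if_splits)
  then show ?thesis using inB t(1) less_imp_le by blast
next
  case True
  define z where "z = Min {z\<in>Zm. x < z}"
  have "z \<in> {z\<in>Zm. x < z}" unfolding z_def using True finm by (intro Min_in) auto
  then have z: "z \<in> Zm" "x < z" by auto
  have zle: "z \<le> z'" if "z' \<in> Zm" "x < z'" for z'
    unfolding z_def using finm that by (intro Min_le) auto
  have "poly F x < poly F z"
  proof (rule rcf_pderiv_pos_less[OF z(2)])
    fix t assume t: "x < t" "t < z"
    have "t \<in> A" using cutm[OF t(1)] zle t(2) by fastforce
    then show "0 < poly (pderiv F) t" by (rule dF)
  qed
  then have "0 < poly F z" using Fx by simp
  then obtain w where w: "w \<in> Zr" "y < w" "\<And>w'. w' \<in> Zr \<Longrightarrow> y < w' \<Longrightarrow> w \<le> w'" "0 < poly G w"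
    using nxt[OF z zle] by blast
  have inB: "t \<in> B" if "y \<le> t" "t < w" for t
    using cutr[of t] w(3) y that by (cases "t = y") force+
  show ?thesis
  proof (rule ccontr)
    assume n: "\<not> ?thesis"
    \<comment> \<open>The value at \<open>w\<close> is positive, but \<open>w\<close> need not lie
      in \<open>B\<close>. A point \<open>c\<close> of \<open>B\<close> left of \<open>w\<close>
      with nonnegative value is enough, since \<open>G\<close> grows strictly from there on up to
      \<open>w\<close>.\<close>
    have "\<exists>c. y \<le> c \<and> c < w \<and> 0 \<le> poly G c"
    proof (cases "poly G y < 0")
      case True
      then obtain c where "y < c" "c < w" "poly G c = 0" using rcf_IVT_pos[OF w(2) _ w(4)] by blast
      then show ?thesis by (metis order.refl less_imp_le)
    next
      case False
      then show ?thesis using w(2) by (intro exI[of _ y]) auto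
    qed
    then obtain c where c: "y \<le> c" "c < w" "0 \<le> poly G c" by blast
    obtain s where s: "c < s" "s < w" using dense c(2) by blast
    have "poly G c < poly G s"
      using s c by (intro rcf_pderiv_pos_less dG inB) auto
    moreover have "s \<in> B" using inB s c by auto
    ultimately show False using n c(3) by fastforce
  qed
qed

text \<open>At a root of \<open>g\<close> the pseudo-division identity reduces to
  \<open>lead_coeff g ^ e * f = r\<close>, so the sign of the new \<open>f\<close> can be read off
  from the remainder, which is zero or already belongs to \<Psi>. This is the purpose of closing
  under remainders.\<close>

lemma sg_at_cut_point:
  fixes h :: "'a::idom \<Rightarrow> 'm::linordered_idom" and k :: "'a \<Rightarrow> 'r::linordered_idom"
  assumes hk: "cring_hom h" "cring_hom k"
    and lead: "\<And>g. g \<in> \<Psi> \<Longrightarrow> h (lead_coeff g) \<noteq> 0 \<and> sg (h (lead_coeff g)) = sg (k (lead_coeff g))"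
    and rem: "\<And>g. g \<in> \<Psi> \<Longrightarrow> 0 < degree g \<Longrightarrow>
      \<exists>e q r. smult (lead_coeff g ^ e) f = g * q + r \<and> (r = 0 \<or> r \<in> \<Psi>)"
    and xy: "same_signs h k \<Psi> x y" and x: "x \<in> cut_points h \<Psi>"
  shows "sg (ev h f x) = sg (ev k f y)"
proof -
  interpret h: cring_hom h by fact
  interpret k: cring_hom k by fact
  obtain g where g: "g \<in> \<Psi>" "0 < degree g" "ev h g x = 0"
    using x by (auto simp: cut_points_def)
  have gy: "ev k g y = 0"
    using g xy sg_eq_iff(3) unfolding same_signs_def by blast
  obtain e q r where r: "smult (lead_coeff g ^ e) f = g * q + r" "r = 0 \<or> r \<in> \<Psi>"
    using rem[OF g(1,2)] by blast
  have hx: "h (lead_coeff g) ^ e * ev h f x = ev h r x"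
    using arg_cong[OF r(1), of "\<lambda>p. ev h p x"] g(3)
    by (simp add: ev_def h.map_poly_add h.map_poly_mult h.map_poly_smult h.hom_power)
  have ky: "k (lead_coeff g) ^ e * ev k f y = ev k r y"
    using arg_cong[OF r(1), of "\<lambda>p. ev k p y"] gy
    by (simp add: ev_def k.map_poly_add k.map_poly_mult k.map_poly_smult k.hom_power)
  have "sg (ev h r x) = sg (ev k r y)"
    using r(2) xy by (auto simp: same_signs_def ev_def)
  then have "sg (h (lead_coeff g)) ^ e * sg (ev h f x) = sg (h (lead_coeff g)) ^ e * sg (ev k f y)"
    unfolding hx[symmetric] ky[symmetric] sg_mult sg_power using lead[OF g(1)] by simp
  moreover have "sg (h (lead_coeff g)) \<noteq> 0" using lead[OF g(1)] sg_simps(3) by blast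
  ultimately show ?thesis by simp
qed

section \<open>Signs of the new polynomial on a class without cut points\<close>

context
  fixes h :: "'a::zero \<Rightarrow> 'm::rcf" and k :: "'a \<Rightarrow> 'r::rcf" and \<Psi> and F G
  assumes T: "same_diagram h k \<Psi>" and h0: "h 0 = 0" and k0: "k 0 = 0"
    and fin: "finite (cut_points h \<Psi>)" "finite (cut_points k \<Psi>)"
    and cutFG: "\<And>z w. same_signs h k \<Psi> z w \<Longrightarrow> z \<in> cut_points h \<Psi> \<Longrightarrow> sg (poly F z) = sg (poly G w)"
    and degG: "0 < degree G"
begin

lemma positive_value_in_class:
  assumes x: "x \<notin> cut_points h \<Psi>" and xy: "same_signs h k \<Psi> x y"
    and dF: "\<And>t. same_signs h h \<Psi> x t \<Longrightarrow> 0 < poly (pderiv F) t"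
    and dG: "\<And>t. same_signs h k \<Psi> x t \<Longrightarrow> 0 < poly (pderiv G) t"
    and F: "0 < poly F x"
  shows "\<exists>s. same_signs h k \<Psi> x s \<and> 0 < poly G s"
proof -
  have y: "y \<notin> cut_points k \<Psi>" using cut_points_same_signs[OF xy] x by blast
  have "\<exists>s\<in>{s. same_signs h k \<Psi> x s}. 0 < poly G s"
  proof (rule positive_value_transfer[where Zm = "cut_points h \<Psi>" and Zr = "cut_points k \<Psi>"
        and y = y and x = x and F = F and A = "{t. same_signs h h \<Psi> x t}"])
    show "\<exists>z\<in>cut_points h \<Psi>. x < z \<and> z \<le> t" if "x < t" "t \<notin> {t. same_signs h h \<Psi> x t}" for t
      using cut_point_between[of h, OF h0 that(1)] that(2) x by (metis le_less mem_Collect_eq)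
    show "\<exists>z\<in>cut_points k \<Psi>. y < z \<and> z \<le> t" if t: "y < t" "t \<notin> {t. same_signs h k \<Psi> x t}" for t
    proof -
      have "\<not> same_signs k k \<Psi> y t" using t xy same_signs_trans by blast
      then show ?thesis using cut_point_between[of k, OF k0 t(1)] y by (metis le_less)
    qed
    show "\<exists>w\<in>cut_points k \<Psi>. y < w \<and> (\<forall>w'\<in>cut_points k \<Psi>. y < w' \<longrightarrow> w \<le> w') \<and> 0 < poly G w"
      if z: "z \<in> cut_points h \<Psi>" "x < z" "\<And>z'. z' \<in> cut_points h \<Psi> \<Longrightarrow> x < z' \<Longrightarrow> z \<le> z'"
        "0 < poly F z" for z
    proof -
      obtain w where "w \<in> cut_points k \<Psi>" "y < w"
        "\<And>w'. w' \<in> cut_points k \<Psi> \<Longrightarrow> y < w' \<Longrightarrow> w \<le> w'" "same_signs h k \<Psi> z w"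
        using next_cut_point[OF T fin(2) xy x z(1,2,3)] by blast
      then show ?thesis using cutFG z sg_eq_iff(1) by blast
    qed
    show "\<forall>w\<in>cut_points k \<Psi>. w \<le> y" if z: "\<And>z. z \<in> cut_points h \<Psi> \<Longrightarrow> z \<le> x"
    proof (rule ballI, rule ccontr)
      fix w assume w: "w \<in> cut_points k \<Psi>" "\<not> w \<le> y"
      obtain v where v: "same_signs h k \<Psi> v w" using T unfolding same_diagram_def by blast
      have "\<not> same_signs k k \<Psi> y w" using cut_points_same_signs y w by blast
      then have "x < v"
        using same_diagram_less[OF same_diagram_sym[OF T] same_signs_sym[OF xy] same_signs_sym[OF v]] w
        by simp
      moreover have "v \<in> cut_points h \<Psi>" using cut_points_same_signs[OF v] w by blast
      ultimately show False using z by fastforce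
    qed
  qed (use assms y fin degG in auto)
  then show ?thesis by blast
qed

text \<open>The reflection \<open>- (F \<circ>\<^sub>p [:0, - 1:])\<close> is again increasing and
  exchanges negative and positive values, while previous cut points become next ones.\<close>

lemma negative_value_in_class:
  assumes x: "x \<notin> cut_points h \<Psi>" and xy: "same_signs h k \<Psi> x y"
    and dF: "\<And>t. same_signs h h \<Psi> x t \<Longrightarrow> 0 < poly (pderiv F) t"
    and dG: "\<And>t. same_signs h k \<Psi> x t \<Longrightarrow> 0 < poly (pderiv G) t"
    and F: "poly F x < 0"
  shows "\<exists>s. same_signs h k \<Psi> x s \<and> poly G s < 0"
proof -
  have y: "y \<notin> cut_points k \<Psi>" using cut_points_same_signs[OF xy] x by blast
  have "\<exists>s\<in>{s. same_signs h k \<Psi> x (- s)}. 0 < poly (- (G \<circ>\<^sub>p [:0, - 1:])) s"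
  proof (rule positive_value_transfer[where Zm = "uminus ` cut_points h \<Psi>"
        and Zr = "uminus ` cut_points k \<Psi>" and y = "- y" and x = "- x"
        and F = "- (F \<circ>\<^sub>p [:0, - 1:])" and A = "{t. same_signs h h \<Psi> x (- t)}"])
    show "\<exists>z\<in>uminus ` cut_points h \<Psi>. - x < z \<and> z \<le> t"
      if t: "- x < t" "t \<notin> {t. same_signs h h \<Psi> x (- t)}" for t
    proof -
      have "\<not> same_signs h h \<Psi> (- t) x" using t same_signs_sym by blast
      then obtain z where "z \<in> cut_points h \<Psi>" "- t \<le> z" "z \<le> x"
        using cut_point_between[of h "- t" x, OF h0] t by (auto simp: minus_less_iff)
      then show ?thesis using x by (intro bexI[of _ "- z"]) (auto simp: minus_le_iff le_less)
    qed
    show "\<exists>z\<in>uminus ` cut_points k \<Psi>. - y < z \<and> z \<le> t"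
      if t: "- y < t" "t \<notin> {t. same_signs h k \<Psi> x (- t)}" for t
    proof -
      have "\<not> same_signs k k \<Psi> (- t) y" using t xy same_signs_trans same_signs_sym by blast
      then obtain z where "z \<in> cut_points k \<Psi>" "- t \<le> z" "z \<le> y"
        using cut_point_between[of k "- t" y, OF k0] t by (auto simp: minus_less_iff)
      then show ?thesis using y by (intro bexI[of _ "- z"]) (auto simp: minus_le_iff le_less)
    qed
    show "\<exists>w\<in>uminus ` cut_points k \<Psi>. - y < w \<and>
        (\<forall>w'\<in>uminus ` cut_points k \<Psi>. - y < w' \<longrightarrow> w \<le> w') \<and> 0 < poly (- (G \<circ>\<^sub>p [:0, - 1:])) w"
      if z: "z \<in> uminus ` cut_points h \<Psi>" "- x < z"
        "\<And>z'. z' \<in> uminus ` cut_points h \<Psi> \<Longrightarrow> - x < z' \<Longrightarrow> z \<le> z'"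
        "0 < poly (- (F \<circ>\<^sub>p [:0, - 1:])) z" for z
    proof -
      have z': "- z \<in> cut_points h \<Psi>" "- z < x" using z(1,2) by (auto simp: minus_less_iff)
      have "z' \<le> - z" if "z' \<in> cut_points h \<Psi>" "z' < x" for z'
        using z(3)[of "- z'"] that by (simp add: le_minus_iff)
      then obtain w where w: "w \<in> cut_points k \<Psi>" "w < y"
        "\<And>w'. w' \<in> cut_points k \<Psi> \<Longrightarrow> w' < y \<Longrightarrow> w' \<le> w" "same_signs h k \<Psi> (- z) w"
        using prev_cut_point[OF T fin(2) xy x z'] by blast
      have "poly G w < 0"
        using cutFG[OF w(4) z'(1)] sg_eq_iff(2) z(4) by (auto simp: poly_pcompose)
      then show ?thesis using w by (intro bexI[of _ "- w"]) (auto simp: poly_pcompose)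
    qed
    show "\<forall>w\<in>uminus ` cut_points k \<Psi>. w \<le> - y"
      if z: "\<And>z. z \<in> uminus ` cut_points h \<Psi> \<Longrightarrow> z \<le> - x"
    proof (rule ballI, rule ccontr)
      fix w' assume "w' \<in> uminus ` cut_points k \<Psi>" "\<not> w' \<le> - y"
      then obtain w where w: "w \<in> cut_points k \<Psi>" "w < y" by auto
      obtain v where v: "same_signs h k \<Psi> v w" using T unfolding same_diagram_def by blast
      have "\<not> same_signs k k \<Psi> w y" using cut_points_same_signs y w by blast
      then have "v < x"
        using same_diagram_less[OF same_diagram_sym[OF T] same_signs_sym[OF v] same_signs_sym[OF xy]] w
        by simp
      moreover have "v \<in> cut_points h \<Psi>" using cut_points_same_signs[OF v] w by blast
      ultimately show False using z[of "- v"] by simp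
    qed
    show "0 < poly (pderiv (- (F \<circ>\<^sub>p [:0, - 1:]))) t" if "t \<in> {t. same_signs h h \<Psi> x (- t)}" for t
      using dF[of "- t"] that by (simp add: pderiv_minus pderiv_pcompose pderiv_pCons poly_pcompose)
    show "0 < poly (pderiv (- (G \<circ>\<^sub>p [:0, - 1:]))) t" if "t \<in> {t. same_signs h k \<Psi> x (- t)}" for t
      using dG[of "- t"] that by (simp add: pderiv_minus pderiv_pcompose pderiv_pCons poly_pcompose)
  qed (use assms y fin degG in \<open>auto simp: poly_pcompose degree_pcompose\<close>)
  then obtain s where "same_signs h k \<Psi> x (- s)" "poly G (- s) < 0" by (auto simp: poly_pcompose)
  then show ?thesis by blast
qed

text \<open>A class without cut points is open, which gives room on both sides of a zero of
  \<open>F\<close>.\<close>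

lemma near_not_cut_point:
  assumes x: "x \<notin> cut_points h \<Psi>"
  shows "\<exists>u. x < u \<and> same_signs h h \<Psi> x u" "\<exists>u. u < x \<and> same_signs h h \<Psi> x u"
proof -
  have "\<exists>u>x. \<forall>z\<in>cut_points h \<Psi>. x < z \<longrightarrow> u < z"
  proof (cases "\<exists>z\<in>cut_points h \<Psi>. x < z")
    case True
    define m where "m = Min {z\<in>cut_points h \<Psi>. x < z}"
    have "m \<in> {z\<in>cut_points h \<Psi>. x < z}" unfolding m_def using True fin by (intro Min_in) auto
    moreover have "m \<le> z" if "z \<in> cut_points h \<Psi>" "x < z" for z
      unfolding m_def using fin that by (intro Min_le) auto
    ultimately show ?thesis using dense[of x m] by fastforce
  qed (use gt_ex in auto)
  then obtain u where u: "x < u" "\<And>z. z \<in> cut_points h \<Psi> \<Longrightarrow> x < z \<Longrightarrow> u < z" by blast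
  have "same_signs h h \<Psi> x u"
    using cut_point_between[of h, OF h0 u(1)] u(2) x by (metis le_less not_less)
  then show "\<exists>u. x < u \<and> same_signs h h \<Psi> x u" using u by blast
  have "\<exists>u<x. \<forall>z\<in>cut_points h \<Psi>. z < x \<longrightarrow> z < u"
  proof (cases "\<exists>z\<in>cut_points h \<Psi>. z < x")
    case True
    define m where "m = Max {z\<in>cut_points h \<Psi>. z < x}"
    have "m \<in> {z\<in>cut_points h \<Psi>. z < x}" unfolding m_def using True fin by (intro Max_in) auto
    moreover have "z \<le> m" if "z \<in> cut_points h \<Psi>" "z < x" for z
      unfolding m_def using fin that by (intro Max_ge) auto
    ultimately show ?thesis using dense[of m x] by fastforce
  qed (use lt_ex in auto)
  then obtain u where u: "u < x" "\<And>z. z \<in> cut_points h \<Psi> \<Longrightarrow> z < x \<Longrightarrow> z < u" by blast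
  have "same_signs h h \<Psi> u x"
    using cut_point_between[of h, OF h0 u(1)] u(2) x by (metis le_less not_less)
  then show "\<exists>u. u < x \<and> same_signs h h \<Psi> x u" using u same_signs_sym by blast
qed

text \<open>\<open>F\<close> and \<open>G\<close> stand for the two images of the new polynomial,
  normalised to be increasing on the class. Positive and negative values transfer directly. If
  \<open>F\<close> vanishes at \<open>x\<close>, it is negative at some point of the class to the
  left and positive at one to the right; both signs transfer to \<open>G\<close>, the intermediate
  value property yields a root of \<open>G\<close>, and convexity keeps this root in the
  class.\<close>

lemma value_in_class:
  assumes x: "x \<notin> cut_points h \<Psi>"
    and dF: "\<And>t. same_signs h h \<Psi> x t \<Longrightarrow> 0 < poly (pderiv F) t"
    and dG: "\<And>t. same_signs h k \<Psi> x t \<Longrightarrow> 0 < poly (pderiv G) t"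
  shows "\<exists>s. same_signs h k \<Psi> x s \<and> sg (poly F x) = sg (poly G s)"
proof -
  obtain y where xy: "same_signs h k \<Psi> x y" using T unfolding same_diagram_def by blast
  consider "0 < poly F x" | "poly F x < 0" | "poly F x = 0" by fastforce
  then show ?thesis
  proof cases
    case 1
    then obtain s where "same_signs h k \<Psi> x s" "0 < poly G s"
      using positive_value_in_class[OF x xy dF dG] by blast
    then show ?thesis using 1 by (intro exI[of _ s]) (simp add: sg_def)
  next
    case 2
    then obtain s where "same_signs h k \<Psi> x s" "poly G s < 0"
      using negative_value_in_class[OF x xy dF dG] by blast
    then show ?thesis using 2 by (intro exI[of _ s]) (simp add: sg_def)
  next
    case 3
    have same: "same_signs h h \<Psi> x t" if "same_signs h h \<Psi> x u" "x < t \<and> t < u \<or> u < t \<and> t < x" for t u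
      using same_diagram_convex[OF T] that same_signs_sym same_signs_trans by meson
    obtain u where u: "x < u" "same_signs h h \<Psi> x u" using near_not_cut_point(1)[OF x] by blast
    have "poly F x < poly F u" using u same by (intro rcf_pderiv_pos_less dF) auto
    then have Fu: "0 < poly F u" using 3 by simp
    have *: "u \<notin> cut_points h \<Psi>" "same_signs h k \<Psi> u y"
      using cut_points_same_signs[OF u(2)] x xy same_signs_trans same_signs_sym u(2) by blast+
    obtain s where s: "same_signs h k \<Psi> u s" "0 < poly G s"
      using positive_value_in_class[OF * dF[OF same_signs_trans[OF u(2)]]
          dG[OF same_signs_trans[OF u(2)]] Fu] by blast
    obtain v where v: "v < x" "same_signs h h \<Psi> x v" using near_not_cut_point(2)[OF x] by blast
    have "poly F v < poly F x"
      using v same by (intro rcf_pderiv_pos_less dF) auto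
    then have Fv: "poly F v < 0" using 3 by simp
    have *: "v \<notin> cut_points h \<Psi>" "same_signs h k \<Psi> v y"
      using cut_points_same_signs[OF v(2)] x xy same_signs_trans same_signs_sym v(2) by blast+
    obtain r where r: "same_signs h k \<Psi> v r" "poly G r < 0"
      using negative_value_in_class[OF * dF[OF same_signs_trans[OF v(2)]]
          dG[OF same_signs_trans[OF v(2)]] Fv] by blast
    have xs: "same_signs h k \<Psi> x s" "same_signs h k \<Psi> x r"
      using s r u v same_signs_trans by blast+
    then have "same_signs k k \<Psi> s r" "same_signs k k \<Psi> r s" using same_signs_trans same_signs_sym by blast+
    note conv = same_diagram_convex[OF same_diagram_sym[OF T]]
    consider "s < r" | "r < s" using s(2) r(2) by fastforce
    then have "\<exists>c. same_signs h k \<Psi> x c \<and> poly G c = 0"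
    proof cases
      case 1
      then obtain c where "s < c" "c < r" "poly G c = 0"
        using rcf_IVT[of s r G] s(2) r(2) by (auto simp: mult_pos_neg)
      then show ?thesis using conv[of s r c] xs \<open>same_signs k k \<Psi> s r\<close> same_signs_trans by blast
    next
      case 2
      then obtain c where "r < c" "c < s" "poly G c = 0"
        using rcf_IVT[of r s G] s(2) r(2) by (auto simp: mult_neg_pos)
      then show ?thesis using conv[of r s c] xs \<open>same_signs k k \<Psi> r s\<close> same_signs_trans by blast
    qed
    then show ?thesis using 3 by auto
  qed
qed

end

lemma same_signs_insert:
  "same_signs h k (insert f \<Psi>) x y \<longleftrightarrow> sg (ev h f x) = sg (ev k f y) \<and> same_signs h k \<Psi> x y"
  by (auto simp: same_signs_def)

lemma ev_pderiv_nonzero: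
  fixes h :: "'a::idom \<Rightarrow> 'm::rcf"
  assumes "h 0 = 0" "x \<notin> cut_points h \<Psi>" "g \<in> \<Psi>" "h (lead_coeff g) \<noteq> 0"
  shows "ev h g x \<noteq> 0"
proof (cases "degree g = 0")
  case True
  then show ?thesis using ev_const[of h g x, OF assms(1)] assms(4) by simp
qed (use assms in \<open>auto simp: cut_points_def\<close>)

text \<open>A constant \<open>f\<close> has the sign of its leading coefficient, and at a cut point
  the remainders decide. On any other class the derivative belongs to \<Psi> and has one nonzero
  sign, so \<open>f\<close> is monotone there and \<open>value_in_class\<close> applies.\<close>

lemma realize_insert:
  fixes h :: "'a::idom \<Rightarrow> 'm::rcf" and k :: "'a \<Rightarrow> 'r::rcf"
  assumes hk: "cring_hom h" "cring_hom k" and fin: "finite \<Psi>" and T: "same_diagram h k \<Psi>"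
    and lead: "\<And>g. g \<in> insert f \<Psi> \<Longrightarrow>
      h (lead_coeff g) \<noteq> 0 \<and> sg (h (lead_coeff g)) = sg (k (lead_coeff g))"
    and deriv: "0 < degree f \<Longrightarrow> pderiv f \<in> \<Psi>"
    and rem: "\<And>g. g \<in> \<Psi> \<Longrightarrow> 0 < degree g \<Longrightarrow>
      \<exists>e q r. smult (lead_coeff g ^ e) f = g * q + r \<and> (r = 0 \<or> r \<in> \<Psi>)"
  shows "\<exists>y. same_signs h k (insert f \<Psi>) x y"
proof -
  interpret h: cring_hom h by fact
  interpret k: cring_hom k by fact
  have lead_k: "k (lead_coeff g) \<noteq> 0" if "g \<in> insert f \<Psi>" for g
    using lead[OF that] sg_simps(3) by metis
  have finc: "finite (cut_points h \<Psi>)" "finite (cut_points k \<Psi>)"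
    using lead lead_k by (intro finite_cut_points fin; simp)+
  obtain y where xy: "same_signs h k \<Psi> x y" using T unfolding same_diagram_def by blast
  consider "degree f = 0" | "x \<in> cut_points h \<Psi>" | "0 < degree f" "x \<notin> cut_points h \<Psi>" by blast
  then show ?thesis
  proof cases
    case 1
    then show ?thesis
      using lead[of f] xy ev_const[of h f x] ev_const[of k f y]
      by (intro exI[of _ y]) (simp add: same_signs_insert)
  next
    case 2
    have "sg (ev h f x) = sg (ev k f y)"
      by (rule sg_at_cut_point[OF hk _ rem xy 2]) (use lead in auto)
    then show ?thesis using xy by (auto simp: same_signs_insert)
  next
    case 3
    define e where "e = ev h (pderiv f) x"
    have D: "pderiv f \<in> \<Psi>" using deriv 3 by blast
    have "e \<noteq> 0" unfolding e_def using ev_pderiv_nonzero[OF h.hom_0 3(2) D] lead D by simp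
    have eh: "sg (ev h (pderiv f) t) = sg e" if "same_signs h h \<Psi> x t" for t
      using that D by (simp add: same_signs_def e_def)
    have ek: "sg (ev k (pderiv f) t) = sg e" if "same_signs h k \<Psi> x t" for t
      using that D by (simp add: same_signs_def e_def)
    \<comment> \<open>Both images are negated together when the derivative is negative, which leaves
      the increasing case.\<close>
    define F where "F = (if 0 < e then map_poly h f else - map_poly h f)"
    define G where "G = (if 0 < e then map_poly k f else - map_poly k f)"
    have pF: "pderiv F = (if 0 < e then map_poly h (pderiv f) else - map_poly h (pderiv f))"
      by (simp add: F_def map_poly_pderiv[OF hk(1)] pderiv_minus)
    have pG: "pderiv G = (if 0 < e then map_poly k (pderiv f) else - map_poly k (pderiv f))"
      by (simp add: G_def map_poly_pderiv[OF hk(2)] pderiv_minus)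
    have "\<exists>s. same_signs h k \<Psi> x s \<and> sg (poly F x) = sg (poly G s)"
    proof (rule value_in_class[OF T h.hom_0 k.hom_0 finc])
      show "sg (poly F z) = sg (poly G w)"
        if "same_signs h k \<Psi> z w" "z \<in> cut_points h \<Psi>" for z w
      proof -
        have "sg (ev h f z) = sg (ev k f w)"
          by (rule sg_at_cut_point[OF hk _ rem that]) (use lead in auto)
        then show ?thesis by (simp add: F_def G_def ev_def)
      qed
      show "0 < degree G"
        using degree_map_poly_lead[of k f] lead_k[of f] 3 by (simp add: G_def)
      show "0 < poly (pderiv F) t" if "same_signs h h \<Psi> x t" for t
        using sg_eq_iff[OF eh[OF that]] \<open>e \<noteq> 0\<close> by (auto simp: pF ev_def not_less le_less)
      show "0 < poly (pderiv G) t" if "same_signs h k \<Psi> x t" for t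
        using sg_eq_iff[OF ek[OF that]] \<open>e \<noteq> 0\<close> by (auto simp: pG ev_def not_less le_less)
    qed fact
    then obtain s where s: "same_signs h k \<Psi> x s" "sg (poly F x) = sg (poly G s)" by blast
    then have "sg (ev h f x) = sg (ev k f s)" by (simp add: F_def G_def ev_def split: if_splits)
    then show ?thesis using s(1) by (auto simp: same_signs_insert)
  qed
qed

text \<open>The new case is that of two points in one old class which only \<open>f\<close>
  separates. That class has no cut point, so \<open>f\<close> is strictly monotone on it and on its
  counterpart, and the order of the two signs fixes the order of the points.\<close>

lemma order_insert:
  fixes h :: "'a::idom \<Rightarrow> 'm::rcf" and k :: "'a \<Rightarrow> 'r::rcf"
  assumes hk: "cring_hom h" "cring_hom k" and T: "same_diagram h k \<Psi>"
    and lead: "\<And>g. g \<in> insert f \<Psi> \<Longrightarrow>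
      h (lead_coeff g) \<noteq> 0 \<and> sg (h (lead_coeff g)) = sg (k (lead_coeff g))"
    and deriv: "0 < degree f \<Longrightarrow> pderiv f \<in> \<Psi>"
    and rem: "\<And>g. g \<in> \<Psi> \<Longrightarrow> 0 < degree g \<Longrightarrow>
      \<exists>e q r. smult (lead_coeff g ^ e) f = g * q + r \<and> (r = 0 \<or> r \<in> \<Psi>)"
    and xy: "same_signs h k (insert f \<Psi>) x y" "same_signs h k (insert f \<Psi>) x' y'"
    and less: "x < x'" and ns: "\<not> same_signs h h (insert f \<Psi>) x x'"
  shows "y < y'"
proof (cases "same_signs h h \<Psi> x x'")
  case False
  then show ?thesis
    using same_diagram_less[OF T _ _ less] xy by (auto simp: same_signs_insert)
next
  case True
  interpret h: cring_hom h by fact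
  interpret k: cring_hom k by fact
  have sf: "sg (ev h f x) = sg (ev k f y)" "sg (ev h f x') = sg (ev k f y')"
    and sP: "same_signs h k \<Psi> x y" "same_signs h k \<Psi> x' y'"
    using xy by (auto simp: same_signs_insert)
  have nf: "sg (ev h f x) \<noteq> sg (ev h f x')" using ns True by (simp add: same_signs_insert)
  have x: "x \<notin> cut_points h \<Psi>"
  proof
    assume "x \<in> cut_points h \<Psi>"
    then have "sg (ev h f x) = sg (ev h f x')"
      by (intro sg_at_cut_point[OF hk(1) hk(1) _ rem True]) (use lead in auto)
    with nf show False by simp
  qed
  have "0 < degree f" using nf ev_const[of h f] by fastforce
  then have D: "pderiv f \<in> \<Psi>" by (rule deriv)
  define e where "e = ev h (pderiv f) x"
  have "e \<noteq> 0" unfolding e_def using ev_pderiv_nonzero[OF h.hom_0 x D] lead D by simp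
  have eh: "sg (ev h (pderiv f) t) = sg e" if "same_signs h h \<Psi> x t" for t
    using that D by (simp add: same_signs_def e_def)
  have ek: "sg (ev k (pderiv f) t) = sg e" if "same_signs h k \<Psi> x t" for t
    using that D by (simp add: same_signs_def e_def)
  define F where "F = (if 0 < e then map_poly h f else - map_poly h f)"
  define G where "G = (if 0 < e then map_poly k f else - map_poly k f)"
  have pF: "pderiv F = (if 0 < e then map_poly h (pderiv f) else - map_poly h (pderiv f))"
    by (simp add: F_def map_poly_pderiv[OF hk(1)] pderiv_minus)
  have pG: "pderiv G = (if 0 < e then map_poly k (pderiv f) else - map_poly k (pderiv f))"
    by (simp add: G_def map_poly_pderiv[OF hk(2)] pderiv_minus)
  have sFG: "sg (poly F x) = sg (poly G y)" "sg (poly F x') = sg (poly G y')"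
    "sg (poly F x) \<noteq> sg (poly F x')"
    using sf nf by (auto simp: F_def G_def ev_def)
  have "poly F x < poly F x'"
  proof (rule rcf_pderiv_pos_less[OF less])
    fix t assume "x < t" "t < x'"
    then have "same_signs h h \<Psi> x t" using same_diagram_convex[OF T True] by blast
    then show "0 < poly (pderiv F) t"
      using sg_eq_iff[OF eh] \<open>e \<noteq> 0\<close> by (auto simp: pF ev_def not_less le_less)
  qed
  then have lt: "sg (poly G y) < sg (poly G y')"
    using sg_mono[of "poly F x" "poly F x'"] sFG by simp
  show ?thesis
  proof (rule ccontr)
    assume "\<not> y < y'"
    then consider "y = y'" | "y' < y" by fastforce
    then show False
    proof cases
      case 1
      then show ?thesis using lt by simp
    next
      case 2
      have yy: "same_signs h k \<Psi> x y'" "same_signs k k \<Psi> y' y"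
        using sP True by (auto simp: same_signs_def)
      have "poly G y' < poly G y"
      proof (rule rcf_pderiv_pos_less[OF 2])
        fix t assume "y' < t" "t < y"
        then have "same_signs k k \<Psi> y' t"
          using same_diagram_convex[OF same_diagram_sym[OF T] yy(2)] by blast
        then have "same_signs h k \<Psi> x t" using yy(1) same_signs_trans by blast
        then show "0 < poly (pderiv G) t"
          using sg_eq_iff[OF ek] \<open>e \<noteq> 0\<close> by (auto simp: pG ev_def not_less le_less)
      qed
      then show ?thesis using lt sg_mono[of "poly G y'" "poly G y"] by simp
    qed
  qed
qed

lemma same_diagram_insert:
  fixes h :: "'a::idom \<Rightarrow> 'm::rcf" and k :: "'a \<Rightarrow> 'r::rcf"
  assumes hk: "cring_hom h" "cring_hom k" and fin: "finite \<Psi>" and T: "same_diagram h k \<Psi>"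
    and lead: "\<And>g. g \<in> insert f \<Psi> \<Longrightarrow>
      h (lead_coeff g) \<noteq> 0 \<and> sg (h (lead_coeff g)) = sg (k (lead_coeff g))"
    and deriv: "0 < degree f \<Longrightarrow> pderiv f \<in> \<Psi>"
    and rem: "\<And>g. g \<in> \<Psi> \<Longrightarrow> 0 < degree g \<Longrightarrow>
      \<exists>e q r. smult (lead_coeff g ^ e) f = g * q + r \<and> (r = 0 \<or> r \<in> \<Psi>)"
  shows "same_diagram h k (insert f \<Psi>)"
proof -
  have lead': "k (lead_coeff g) \<noteq> 0 \<and> sg (k (lead_coeff g)) = sg (h (lead_coeff g))"
    if "g \<in> insert f \<Psi>" for g
    using lead[OF that] sg_simps(3) by metis
  have "\<exists>y. same_signs h k (insert f \<Psi>) x y" for x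
    by (rule realize_insert[OF hk fin T lead deriv rem])
  moreover have "\<exists>x. same_signs h k (insert f \<Psi>) x y" for y
    using realize_insert[OF hk(2,1) fin same_diagram_sym[OF T] lead' deriv rem] same_signs_sym
    by blast
  ultimately show ?thesis
    unfolding same_diagram_def using order_insert[OF hk T lead deriv rem] by blast
qed

text \<open>The degree bound on remainders makes the property survive the removal of an element of
  maximal degree: no derivative or remainder that is asked for reaches that degree.\<close>

definition elim_closed :: "'a::idom poly set \<Rightarrow> bool" where
  "elim_closed \<Phi> \<longleftrightarrow> (\<forall>f\<in>\<Phi>. 0 < degree f \<longrightarrow> pderiv f \<in> \<Phi>) \<and>
    (\<forall>f\<in>\<Phi>. \<forall>g\<in>\<Phi>. 0 < degree g \<longrightarrow> (\<exists>e q r. smult (lead_coeff g ^ e) f = g * q + r \<and>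
       (r = 0 \<or> r \<in> \<Phi> \<and> degree r < degree g)))"

text \<open>Hoermander's induction: polynomials enter by nondecreasing degree, so the derivative and
  the remainders of the newcomer have been compared before. Nonzero leading coefficients keep the
  degrees under \<open>h\<close> and \<open>k\<close>, and their signs are all that is asked of the
  coefficients.\<close>

theorem same_diagram_elim_closed:
  fixes h :: "'a::{idom,ring_char_0} \<Rightarrow> 'm::rcf" and k :: "'a \<Rightarrow> 'r::rcf"
  assumes hk: "cring_hom h" "cring_hom k" and "finite \<Phi>" "elim_closed \<Phi>"
    and lead: "\<And>g. g \<in> \<Phi> \<Longrightarrow> h (lead_coeff g) \<noteq> 0 \<and> sg (h (lead_coeff g)) = sg (k (lead_coeff g))"
  shows "same_diagram h k \<Phi>"
  using assms(3-)
proof (induction \<Phi> rule: finite_psubset_induct)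
  case (psubset \<Phi>)
  show ?case
  proof (cases "\<Phi> = {}")
    case True
    then show ?thesis by (simp add: same_diagram_def same_signs_def)
  next
    case False
    have "\<exists>f\<in>\<Phi>. \<forall>g\<in>\<Phi>. degree g \<le> degree f"
    proof -
      have "Max (degree ` \<Phi>) \<in> degree ` \<Phi>" using False psubset by (intro Max_in) auto
      then obtain f where "f \<in> \<Phi>" "degree f = Max (degree ` \<Phi>)" by auto
      then show ?thesis using psubset by (intro bexI[of _ f]) auto
    qed
    then obtain f where f: "f \<in> \<Phi>" "\<And>g. g \<in> \<Phi> \<Longrightarrow> degree g \<le> degree f" by blast
    define \<Psi> where "\<Psi> = \<Phi> - {f}"
    have \<Phi>: "\<Phi> = insert f \<Psi>" using f by (auto simp: \<Psi>_def)
    have deriv: "pderiv g \<in> \<Psi>" if "g \<in> \<Phi>" "0 < degree g" for g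
    proof -
      have "pderiv g \<in> \<Phi>" using psubset.prems(1) that by (simp add: elim_closed_def)
      moreover have "degree (pderiv g) < degree f"
        using degree_pderiv[of g] that f(2)[of g] by auto
      ultimately show ?thesis by (auto simp: \<Psi>_def)
    qed
    have rem: "\<exists>e q r. smult (lead_coeff g ^ e) g' = g * q + r \<and> (r = 0 \<or> r \<in> \<Psi> \<and> degree r < degree g)"
      if "g' \<in> \<Phi>" "g \<in> \<Phi>" "0 < degree g" for g g'
    proof -
      have "\<exists>e q r. smult (lead_coeff g ^ e) g' = g * q + r \<and> (r = 0 \<or> r \<in> \<Phi> \<and> degree r < degree g)"
        using psubset.prems(1) that unfolding elim_closed_def by simp
      moreover have "r \<in> \<Psi>" if "r \<in> \<Phi>" "degree r < degree g" for r
        using that f(2)[OF \<open>g \<in> \<Phi>\<close>] by (auto simp: \<Psi>_def)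
      ultimately show ?thesis by blast
    qed
    have "\<Psi> \<subset> \<Phi>" "\<Psi> \<subseteq> \<Phi>" using f by (auto simp: \<Psi>_def)
    have "elim_closed \<Psi>"
      unfolding elim_closed_def using deriv rem \<open>\<Psi> \<subseteq> \<Phi>\<close> by (meson subsetD)
    then have T: "same_diagram h k \<Psi>"
      using psubset.IH[OF \<open>\<Psi> \<subset> \<Phi>\<close>] psubset.prems(2) \<open>\<Psi> \<subseteq> \<Phi>\<close> by blast
    show ?thesis
      unfolding \<Phi>
    proof (rule same_diagram_insert[OF hk _ T])
      show "finite \<Psi>" using psubset.hyps by (simp add: \<Psi>_def)
      show "\<exists>e q r. smult (lead_coeff g ^ e) f = g * q + r \<and> (r = 0 \<or> r \<in> \<Psi>)"
        if "g \<in> \<Psi>" "0 < degree g" for g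
        using rem[OF f(1) _ that(2)] that(1) \<open>\<Psi> \<subseteq> \<Phi>\<close> by blast
    qed (use psubset.prems(2) \<Phi> deriv f in auto)
  qed
qed

section \<open>Pseudo-division and finite elimination-closed sets\<close>

definition subring_set :: "'a::ring_1 set \<Rightarrow> bool" where
  "subring_set A \<longleftrightarrow> 1 \<in> A \<and> (\<forall>x\<in>A. \<forall>y\<in>A. x - y \<in> A \<and> x * y \<in> A)"

lemma subring_set_closed:
  assumes "subring_set A"
  shows "1 \<in> A" "0 \<in> A" "x \<in> A \<Longrightarrow> - x \<in> A" "x \<in> A \<Longrightarrow> y \<in> A \<Longrightarrow> x + y \<in> A"
    "x \<in> A \<Longrightarrow> y \<in> A \<Longrightarrow> x - y \<in> A" "x \<in> A \<Longrightarrow> y \<in> A \<Longrightarrow> x * y \<in> A" "of_nat n \<in> A"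
proof -
  show 1: "1 \<in> A" and d: "x \<in> A \<Longrightarrow> y \<in> A \<Longrightarrow> x - y \<in> A" and "x \<in> A \<Longrightarrow> y \<in> A \<Longrightarrow> x * y \<in> A" for x y
    using assms by (auto simp: subring_set_def)
  show 0: "0 \<in> A" using d[OF 1 1] by simp
  show m: "x \<in> A \<Longrightarrow> - x \<in> A" for x using d[OF 0] by force
  show add: "x \<in> A \<Longrightarrow> y \<in> A \<Longrightarrow> x + y \<in> A" for x y using d[OF _ m, of x y] by simp
  show "of_nat n \<in> A" by (induction n) (auto simp: 0 1 add)
qed

definition polys_over :: "'a::zero set \<Rightarrow> 'a poly set" where
  "polys_over A = {p. \<forall>i. coeff p i \<in> A}"

text \<open>Powers of the leading coefficient replace division, so remainders stay over
  \<open>A\<close>. In the application \<open>A\<close> consists of the polynomials in the remaining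
  variables, and the leading coefficients of remainders have to be such polynomials again.\<close>

lemma pseudo_remainder:
  fixes f g :: "'a::idom poly"
  assumes A: "subring_set A" and g: "g \<in> polys_over A" "g \<noteq> 0" and f: "f \<in> polys_over A"
  shows "\<exists>e q r. smult (lead_coeff g ^ e) f = g * q + r \<and> r \<in> polys_over A \<and>
    (r = 0 \<or> degree r < degree g)"
  using f
\<comment> \<open>As \<open>degree 0 = 0\<close>, nonzero degrees are shifted by one, so that a drop
  from a nonzero constant to zero counts as progress.\<close>
proof (induction "if f = 0 then 0 else Suc (degree f)" arbitrary: f rule: less_induct)
  case less
  show ?case
  proof (cases "f = 0 \<or> degree f < degree g")
    case True
    then show ?thesis using less.prems by (intro exI[of _ 0] exI[of _ f]) auto
  next
    case False
    define m where "m = monom (lead_coeff f) (degree f - degree g)"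
    define f1 where "f1 = smult (lead_coeff g) f - m * g"
    have m: "degree (m * g) = degree f" 
      using False g(2) by (auto simp: m_def degree_mult_eq degree_monom_eq)
    have "lead_coeff m = lead_coeff f" using False by (simp add: m_def degree_monom_eq)
    then have lm: "lead_coeff (m * g) = lead_coeff g * lead_coeff f"
      by (simp only: lead_coeff_mult mult.commute)
    have "coeff (m * g) i \<in> A" for i
      using g(1) less.prems subring_set_closed[OF A]
      by (simp add: m_def coeff_monom_mult polys_over_def)
    then have f1A: "f1 \<in> polys_over A"
      using g(1) less.prems subring_set_closed[OF A] by (simp add: f1_def polys_over_def)
    have "f1 = 0 \<or> degree f1 < degree f"
    proof (rule ccontr)
      assume n: "\<not> ?thesis"
      have "degree f1 \<le> degree f" unfolding f1_def
        by (rule degree_diff_le) (auto simp: m degree_smult_le)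
      with n have d: "degree f1 = degree f" by simp
      have "coeff f1 (degree f) = 0"
        using m lm by (simp add: f1_def)
      with d n show False by (metis leading_coeff_0_iff)
    qed
    then have "(if f1 = 0 then 0 else Suc (degree f1)) < (if f = 0 then 0 else Suc (degree f))"
      using False by auto
    then obtain e q r where r: "smult (lead_coeff g ^ e) f1 = g * q + r" "r \<in> polys_over A"
      "r = 0 \<or> degree r < degree g"
      using less.hyps f1A by blast
    have "smult (lead_coeff g ^ Suc e) f = smult (lead_coeff g ^ e) f1 + smult (lead_coeff g ^ e) (m * g)"
      by (simp add: f1_def smult_diff_right mult.commute)
    also have "\<dots> = g * (q + smult (lead_coeff g ^ e) m) + r"
      by (simp add: r(1) algebra_simps)
    finally show ?thesis using r by blast
  qed
qed

text \<open>Closing from the top degree downwards terminates: treating degree \<open>Suc n\<close>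
  adds only derivatives and remainders of degree at most \<open>n\<close>, which leaves the levels
  above closed.\<close>

lemma elim_closed_superset:
  fixes S :: "'a::{idom,ring_char_0} poly set"
  assumes A: "subring_set A" and S: "finite S" "S \<subseteq> polys_over A" "0 \<notin> S"
  obtains \<Phi> where "S \<subseteq> \<Phi>" "finite \<Phi>" "\<Phi> \<subseteq> polys_over A" "0 \<notin> \<Phi>" "elim_closed \<Phi>"
proof -
  define closed_above where "closed_above n \<Phi> \<longleftrightarrow> (\<forall>f\<in>\<Phi>. n < degree f \<longrightarrow> pderiv f \<in> \<Phi>) \<and>
    (\<forall>f\<in>\<Phi>. \<forall>g\<in>\<Phi>. n < degree g \<longrightarrow> (\<exists>e q r. smult (lead_coeff g ^ e) f = g * q + r \<and>
       (r = 0 \<or> r \<in> \<Phi> \<and> degree r < degree g)))" for n and \<Phi> :: "'a poly set"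
  define good where "good \<Phi> \<longleftrightarrow> S \<subseteq> \<Phi> \<and> finite \<Phi> \<and> \<Phi> \<subseteq> polys_over A \<and> 0 \<notin> \<Phi>" for \<Phi>
  define N where "N = Max (insert 0 (degree ` S))"
  have start: "closed_above N S"
  proof -
    have "degree f \<le> N" if "f \<in> S" for f using S that by (simp add: N_def)
    then show ?thesis by (auto simp: closed_above_def not_less[symmetric])
  qed
  have down: "\<exists>\<Phi>'. good \<Phi>' \<and> closed_above n \<Phi>'" if "good \<Phi>" "closed_above (Suc n) \<Phi>" for n \<Phi>
  proof -
    have "\<forall>f\<in>\<Phi>. \<forall>g\<in>\<Phi>. \<exists>r. (\<exists>e q. smult (lead_coeff g ^ e) f = g * q + r) \<and> r \<in> polys_over A \<and>
        (r = 0 \<or> degree r < degree g)"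
      (is "\<forall>f\<in>\<Phi>. \<forall>g\<in>\<Phi>. ?R f g")
    proof (intro ballI)
      fix f g assume "f \<in> \<Phi>" "g \<in> \<Phi>"
      then have "g \<in> polys_over A" "g \<noteq> 0" "f \<in> polys_over A" using that(1) by (auto simp: good_def)
      then show "?R f g" using pseudo_remainder[OF A] by blast
    qed
    then obtain R where R: "\<And>f g. f \<in> \<Phi> \<Longrightarrow> g \<in> \<Phi> \<Longrightarrow>
        (\<exists>e q. smult (lead_coeff g ^ e) f = g * q + R f g) \<and> R f g \<in> polys_over A \<and>
        (R f g = 0 \<or> degree (R f g) < degree g)"
      by metis
    define \<Phi>1 where "\<Phi>1 = pderiv ` {f\<in>\<Phi>. degree f = Suc n}"
    define \<Phi>2 where "\<Phi>2 = (\<lambda>(f, g). R f g) ` {(f, g). f \<in> \<Phi> \<and> g \<in> \<Phi> \<and> degree g = Suc n} - {0}"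
    define \<Phi>' where "\<Phi>' = \<Phi> \<union> \<Phi>1 \<union> \<Phi>2"
    have low: "degree f \<le> n" if "f \<in> \<Phi>1 \<union> \<Phi>2" for f
      using that R by (fastforce simp: \<Phi>1_def \<Phi>2_def degree_pderiv)
    have "\<Phi>1 \<subseteq> polys_over A"
      using that(1) subring_set_closed[OF A]
      by (auto simp: \<Phi>1_def good_def polys_over_def coeff_pderiv simp del: of_nat_Suc)
    moreover have "\<Phi>2 \<subseteq> polys_over A" using R by (auto simp: \<Phi>2_def)
    moreover have "finite \<Phi>2"
    proof -
      have "finite {(f, g). f \<in> \<Phi> \<and> g \<in> \<Phi> \<and> degree g = Suc n}"
        by (rule finite_subset[of _ "\<Phi> \<times> \<Phi>"]) (use that(1) in \<open>auto simp: good_def\<close>)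
      then show ?thesis by (simp add: \<Phi>2_def)
    qed
    \<comment> \<open>Characteristic zero enters here: a polynomial of positive degree has a nonzero
      derivative.\<close>
    moreover have "0 \<notin> \<Phi>1 \<union> \<Phi>2"
      by (auto simp: \<Phi>1_def \<Phi>2_def pderiv_eq_0_iff)
    ultimately have "good \<Phi>'"
      using that(1) by (auto simp: good_def \<Phi>'_def \<Phi>1_def)
    moreover have "closed_above n \<Phi>'"
      unfolding closed_above_def
    proof (intro conjI ballI impI)
      fix f assume f: "f \<in> \<Phi>'" "n < degree f"
      then have "f \<in> \<Phi>" using low by (fastforce simp: \<Phi>'_def)
      then show "pderiv f \<in> \<Phi>'"
        using f that(2) by (cases "degree f = Suc n") (auto simp: closed_above_def \<Phi>'_def \<Phi>1_def)
    next
      fix f g assume f: "f \<in> \<Phi>'" and g: "g \<in> \<Phi>'" "n < degree g"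
      then have g\<Phi>: "g \<in> \<Phi>" using low by (fastforce simp: \<Phi>'_def)
      show "\<exists>e q r. smult (lead_coeff g ^ e) f = g * q + r \<and> (r = 0 \<or> r \<in> \<Phi>' \<and> degree r < degree g)"
      proof (cases "f \<in> \<Phi>")
        case False
        \<comment> \<open>A newly added \<open>f\<close> has degree at most \<open>n\<close> and is
          therefore its own pseudo-remainder, with exponent 0.\<close>
        then have "degree f < degree g" using low f g by (fastforce simp: \<Phi>'_def)
        then show ?thesis using f by (intro exI[of _ 0] exI[of _ f]) auto
      next
        case True
        show ?thesis
        proof (cases "degree g = Suc n")
          case True
          then show ?thesis
            using R[OF \<open>f \<in> \<Phi>\<close> g\<Phi>] \<open>f \<in> \<Phi>\<close> g\<Phi> by (fastforce simp: \<Phi>'_def \<Phi>2_def)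
        next
          case False
          then have "Suc n < degree g" using g by simp
          then show ?thesis
            using that(2) \<open>f \<in> \<Phi>\<close> g\<Phi> unfolding closed_above_def \<Phi>'_def by (meson UnI1)
        qed
      qed
    qed
    ultimately show ?thesis by blast
  qed
  have "\<exists>\<Phi>. good \<Phi> \<and> closed_above (N - j) \<Phi>" for j
  proof (induction j)
    case 0
    then show ?case using start S by (auto simp: good_def)
  next
    case (Suc j)
    \<comment> \<open>For \<open>j \<ge> N\<close> both levels are 0 by truncated
      subtraction.\<close>
    then show ?case using down[of _ "N - Suc j"]
      by (cases "j < N") (auto simp: Suc_diff_Suc)
  qed
  from this[of N] obtain \<Phi> where "good \<Phi>" "closed_above 0 \<Phi>" by auto
  then show ?thesis using that[of \<Phi>] by (auto simp: good_def closed_above_def elim_closed_def)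
qed

section \<open>Orderings and real closures\<close>

text \<open>For a field, \<open>- 1 \<notin> T\<close> would express properness. In a domain the
  condition on \<open>- (c * c)\<close> says that - 1 stays outside the cone generated in the
  fraction field, so that no nonzero element gets sign zero in the orderings obtained.\<close>

definition pre_cone :: "'a::comm_ring_1 set \<Rightarrow> 'a set \<Rightarrow> bool" where
  "pre_cone R T \<longleftrightarrow> T \<subseteq> R \<and> (\<forall>x\<in>T. \<forall>y\<in>T. x + y \<in> T \<and> x * y \<in> T) \<and> (\<forall>x\<in>R. x * x \<in> T) \<and>
    (\<forall>c\<in>R. - (c * c) \<in> T \<longrightarrow> c = 0)"

lemma pre_cone_extend:
  fixes P R :: "'a::idom set"
  assumes R: "subring_set R" and P: "pre_cone R P" and x: "x \<in> R"
    and proper: "\<And>s t c. s \<in> P \<Longrightarrow> t \<in> P \<Longrightarrow> c \<in> R \<Longrightarrow> - (c * c) = s + x * t \<Longrightarrow> c = 0"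
  shows "pre_cone R {s + x * t | s t. s \<in> P \<and> t \<in> P}"
proof -
  note R' = subring_set_closed[OF R]
  have P': "P \<subseteq> R" "\<And>x y. x \<in> P \<Longrightarrow> y \<in> P \<Longrightarrow> x + y \<in> P" "\<And>x y. x \<in> P \<Longrightarrow> y \<in> P \<Longrightarrow> x * y \<in> P"
    "\<And>x. x \<in> R \<Longrightarrow> x * x \<in> P"
    using P unfolding pre_cone_def by auto
  have 0: "0 \<in> P" using P'(4)[of 0] R'(2) by simp
  let ?E = "{s + x * t | s t. s \<in> P \<and> t \<in> P}"
  have "a + b \<in> ?E \<and> a * b \<in> ?E" if ab: "a \<in> ?E" "b \<in> ?E" for a b
  proof -
    obtain s t s' t' where st: "s \<in> P" "t \<in> P" "s' \<in> P" "t' \<in> P" "a = s + x * t" "b = s' + x * t'"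
      using ab by auto
    have "a + b = (s + s') + x * (t + t')" "a * b = (s * s' + (x * x) * (t * t')) + x * (s * t' + t * s')"
      by (simp_all add: st algebra_simps)
    moreover have "s + s' \<in> P" "t + t' \<in> P" "s * s' + (x * x) * (t * t') \<in> P" "s * t' + t * s' \<in> P"
      using st P' x by auto
    ultimately show ?thesis by blast
  qed
  moreover have "y * y \<in> ?E" if "y \<in> R" for y
    using P'(4)[OF that] 0 by (intro CollectI exI[of _ "y * y"] exI[of _ 0]) auto
  moreover have "?E \<subseteq> R" using x P'(1) by (auto intro!: R'(4,6))
  ultimately show ?thesis using proper unfolding pre_cone_def by auto
qed

text \<open>Zorn's lemma. If a maximal \<open>P\<close> contained neither \<open>x\<close> nor
  \<open>- x\<close>, adjoining either one would break properness; the two resulting relations,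
  multiplied together, break properness of \<open>P\<close> itself.\<close>

lemma pre_cone_ordering:
  fixes T R :: "'a::idom set"
  assumes R: "subring_set R" and T: "pre_cone R T"
  obtains P where "pre_cone R P" "T \<subseteq> P" "\<And>x. x \<in> R \<Longrightarrow> x \<in> P \<or> - x \<in> P"
    "\<And>x. x \<in> P \<Longrightarrow> - x \<in> P \<Longrightarrow> x = 0"
proof -
  note R' = subring_set_closed[OF R]
  define \<C> where "\<C> = {P. pre_cone R P \<and> T \<subseteq> P}"
  have "\<exists>M\<in>\<C>. \<forall>X\<in>\<C>. M \<subseteq> X \<longrightarrow> X = M"
  proof (rule subset_Zorn_nonempty)
    show "\<C> \<noteq> {}" using T by (auto simp: \<C>_def)
  next
    fix \<D> assume D: "\<D> \<noteq> {}" "subset.chain \<C> \<D>"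
    have sub: "\<D> \<subseteq> \<C>" using D(2) by (simp add: subset.chain_def)
    have "x + y \<in> \<Union>\<D> \<and> x * y \<in> \<Union>\<D>" if xy: "x \<in> \<Union>\<D>" "y \<in> \<Union>\<D>" for x y
    proof -
      obtain X where X: "X \<in> \<D>" "x \<in> X" "y \<in> X" using D(2) xy unfolding subset_chain_def by blast
      then have "pre_cone R X" using sub by (auto simp: \<C>_def)
      then have "x + y \<in> X" "x * y \<in> X" using X by (simp_all add: pre_cone_def)
      then show ?thesis using X by blast
    qed
    moreover have "T \<subseteq> \<Union>\<D>" using D(1) sub unfolding \<C>_def by blast
    moreover have pre: "pre_cone R X" if "X \<in> \<D>" for X
      using that sub by (auto simp: \<C>_def)
    then have "\<Union>\<D> \<subseteq> R"
      unfolding pre_cone_def by (intro Union_least) simp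
    moreover have "\<forall>c\<in>R. - (c * c) \<in> \<Union>\<D> \<longrightarrow> c = 0"
    proof (intro ballI impI)
      fix c assume "c \<in> R" "- (c * c) \<in> \<Union>\<D>"
      then obtain X where "X \<in> \<D>" "- (c * c) \<in> X" by blast
      then show "c = 0" using pre[of X] \<open>c \<in> R\<close> by (simp add: pre_cone_def)
    qed
    moreover have "\<forall>x\<in>R. x * x \<in> \<Union>\<D>" using \<open>T \<subseteq> \<Union>\<D>\<close> T unfolding pre_cone_def by blast
    ultimately show "\<Union>\<D> \<in> \<C>" by (simp add: \<C>_def pre_cone_def)
  qed
  then obtain P where P: "P \<in> \<C>" "\<And>X. X \<in> \<C> \<Longrightarrow> P \<subseteq> X \<Longrightarrow> X = P" by blast
  then have PR: "pre_cone R P" and TP: "T \<subseteq> P" by (auto simp: \<C>_def)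
  then have P': "P \<subseteq> R" "\<And>x y. x \<in> P \<Longrightarrow> y \<in> P \<Longrightarrow> x + y \<in> P" "\<And>x y. x \<in> P \<Longrightarrow> y \<in> P \<Longrightarrow> x * y \<in> P"
    "\<And>x. x \<in> R \<Longrightarrow> x * x \<in> P" "\<And>c. c \<in> R \<Longrightarrow> - (c * c) \<in> P \<Longrightarrow> c = 0"
    unfolding pre_cone_def by auto
  have 01: "0 \<in> P" "1 \<in> P" using P'(4)[of 0] P'(4)[of 1] R'(1,2) by auto
  have ext: "\<exists>s t c. s \<in> P \<and> t \<in> P \<and> c \<in> R \<and> - (c * c) = s + x * t \<and> c \<noteq> 0" if x: "x \<in> R" "x \<notin> P" for x
  proof (rule ccontr)
    assume "\<not> ?thesis"
    then have pre: "pre_cone R {s + x * t | s t. s \<in> P \<and> t \<in> P}"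
      by (intro pre_cone_extend[OF R PR x(1)]) blast
    have "s \<in> {s + x * t | s t. s \<in> P \<and> t \<in> P}" if "s \<in> P" for s
      using that 01 by (intro CollectI exI[of _ s] exI[of _ 0]) auto
    moreover have "x \<in> {s + x * t | s t. s \<in> P \<and> t \<in> P}"
      using 01 by (intro CollectI exI[of _ 0] exI[of _ 1]) auto
    ultimately show False
      using P(2)[of "{s + x * t | s t. s \<in> P \<and> t \<in> P}"] pre TP x(2) by (auto simp: \<C>_def)
  qed
  have total: "x \<in> P \<or> - x \<in> P" if x: "x \<in> R" for x
  proof (rule ccontr)
    assume n: "\<not> ?thesis"
    obtain s t c where 1: "s \<in> P" "t \<in> P" "c \<in> R" "- (c * c) = s + x * t" "c \<noteq> 0"
      using ext[OF x] n by blast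
    obtain s' t' e where 2: "s' \<in> P" "t' \<in> P" "e \<in> R" "- (e * e) = s' + - x * t'" "e \<noteq> 0"
      using ext[of "- x"] x n R' by blast
    have "- ((c * e) * (c * e)) = (x * x) * (t * t') + (c * c) * s' + s * (e * e) + s * s'"
    proof -
      \<comment> \<open>The relations isolate \<open>x * t\<close> and \<open>x * t'\<close>; in
        their product \<open>x\<close> occurs only through the square \<open>x * x\<close>, which is
        in \<open>P\<close>.\<close>
      have "x * t = - (c * c) - s" "x * t' = e * e + s'" using 1(4) 2(4) by (simp_all add: algebra_simps)
      then have "(x * t) * (x * t') = (- (c * c) - s) * (e * e + s')" by simp
      moreover have "(x * x) * (t * t') = (x * t) * (x * t')" by (simp add: mult_ac)
      ultimately show ?thesis by (simp only:) (simp add: algebra_simps)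
    qed
    also have "\<dots> \<in> P" using P' 1 2 x by auto
    finally show False using P'(5)[of "c * e"] R' 1 2 by auto
  qed
  \<comment> \<open>The product \<open>x * - x\<close> is the negative of a square, so properness
    applies.\<close>
  have "x = 0" if "x \<in> P" "- x \<in> P" for x
    using P'(3)[OF that] P'(1) P'(5)[of x] that by auto
  then show ?thesis using that PR TP total by blast
qed

text \<open>The nonnegative cone of an ordered subfield. The subfield is not named: the clause on
  differences makes it the union of \<open>Q\<close> and its negatives.\<close>

definition field_cone :: "'c::field set \<Rightarrow> bool" where
  "field_cone Q \<longleftrightarrow> 1 \<in> Q \<and> (\<forall>x\<in>Q. \<forall>y\<in>Q. x + y \<in> Q \<and> x * y \<in> Q \<and> (x - y \<in> Q \<or> y - x \<in> Q)) \<and>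
    (\<forall>x\<in>Q. inverse x \<in> Q) \<and> (\<forall>x\<in>Q. - x \<in> Q \<longrightarrow> x = 0)"

lemma maximal_field_cone:
  "\<exists>Q :: 'a::linordered_field alg_closure set. field_cone Q \<and> to_ac ` {0..} \<subseteq> Q \<and>
    (\<forall>P. field_cone P \<longrightarrow> Q \<subseteq> P \<longrightarrow> P = Q)"
proof -
  define \<C> :: "'a alg_closure set set" where "\<C> = {Q. field_cone Q \<and> to_ac ` {0..} \<subseteq> Q}"
  have "\<exists>M\<in>\<C>. \<forall>X\<in>\<C>. M \<subseteq> X \<longrightarrow> X = M"
  proof (rule subset_Zorn_nonempty)
    have "field_cone (to_ac ` {0 :: 'a..})"
      unfolding field_cone_def
    proof (intro conjI ballI impI)
      fix x y :: "'a alg_closure" assume "x \<in> to_ac ` {0..}" "y \<in> to_ac ` {0..}"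
      then obtain a b where ab: "x = to_ac a" "y = to_ac b" "0 \<le> a" "0 \<le> b" by auto
      show "x + y \<in> to_ac ` {0..}" using ab by (intro image_eqI[of _ _ "a + b"]) auto
      show "x * y \<in> to_ac ` {0..}" using ab by (intro image_eqI[of _ _ "a * b"]) auto
      show "x - y \<in> to_ac ` {0..} \<or> y - x \<in> to_ac ` {0..}"
        using ab image_eqI[of "x - y" to_ac "a - b"] image_eqI[of "y - x" to_ac "b - a"]
        by (cases "a \<le> b") auto
    next
      fix x :: "'a alg_closure" assume "x \<in> to_ac ` {0..}"
      then obtain a where a: "x = to_ac a" "0 \<le> a" by auto
      then show "inverse x \<in> to_ac ` {0..}" by (intro image_eqI[of _ _ "inverse a"]) auto
      assume "- x \<in> to_ac ` {0..}"
      then obtain b where b: "- x = to_ac b" "0 \<le> b" by auto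
      then have "to_ac (a + b) = 0" using a by (metis to_ac_add add.right_inverse)
      then show "x = 0" using a b by (simp del: to_ac_add add: add_nonneg_eq_0_iff)
    qed (auto intro!: image_eqI[of _ _ 1])
    then show "\<C> \<noteq> {}" by (auto simp: \<C>_def)
  next
    fix \<D> assume D: "\<D> \<noteq> {}" "subset.chain \<C> \<D>"
    have sub: "\<D> \<subseteq> \<C>" using D(2) by (simp add: subset.chain_def)
    have two: "\<exists>X\<in>\<D>. x \<in> X \<and> y \<in> X" if "x \<in> \<Union>\<D>" "y \<in> \<Union>\<D>" for x y
      using D(2) that unfolding subset_chain_def by blast
    have "x + y \<in> \<Union>\<D> \<and> x * y \<in> \<Union>\<D> \<and> (x - y \<in> \<Union>\<D> \<or> y - x \<in> \<Union>\<D>)"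
      if xy: "x \<in> \<Union>\<D>" "y \<in> \<Union>\<D>" for x y
    proof -
      obtain X where X: "X \<in> \<D>" "x \<in> X" "y \<in> X" using two[OF xy] by blast
      then have "field_cone X" using sub by (auto simp: \<C>_def)
      then have "x + y \<in> X \<and> x * y \<in> X \<and> (x - y \<in> X \<or> y - x \<in> X)"
        using X by (simp add: field_cone_def)
      then show ?thesis using X by blast
    qed
    moreover have "x = 0" if x: "x \<in> \<Union>\<D>" "- x \<in> \<Union>\<D>" for x
    proof -
      obtain X where X: "X \<in> \<D>" "x \<in> X" "- x \<in> X" using two[OF x] by blast
      then have "field_cone X" using sub by (auto simp: \<C>_def)
      then show ?thesis using X by (simp add: field_cone_def)
    qed
    moreover have "inverse x \<in> \<Union>\<D>" if x: "x \<in> \<Union>\<D>" for x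
    proof -
      obtain X where X: "X \<in> \<D>" "x \<in> X" using x by blast
      then have "field_cone X" using sub by (auto simp: \<C>_def)
      then show ?thesis using X by (auto simp: field_cone_def)
    qed
    moreover have "to_ac ` {0..} \<subseteq> \<Union>\<D> \<and> 1 \<in> \<Union>\<D>"
    proof -
      obtain X where X: "X \<in> \<D>" using D(1) by blast
      then have "to_ac ` {0..} \<subseteq> X" "1 \<in> X" using sub by (auto simp: \<C>_def field_cone_def)
      then show ?thesis using X by blast
    qed
    ultimately show "\<Union>\<D> \<in> \<C>" unfolding \<C>_def field_cone_def by simp
  qed
  then obtain Q where Q: "Q \<in> \<C>" "\<And>Y. Y \<in> \<C> \<Longrightarrow> Q \<subseteq> Y \<Longrightarrow> Y = Q" by blast
  have "P = Q" if "field_cone P" "Q \<subseteq> P" for P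
  proof (rule Q(2))
    show "P \<in> \<C>" using that Q(1) by (auto simp: \<C>_def)
  qed (rule that)
  then show ?thesis using Q(1) by (auto simp: \<C>_def)
qed

text \<open>One maximal cone is chosen for each ordered field type, so that the real closure can be
  a type constructor.\<close>

definition rc_cone :: "'a::linordered_field alg_closure set" where
  "rc_cone = (SOME Q. field_cone Q \<and> to_ac ` {0..} \<subseteq> Q \<and> (\<forall>P. field_cone P \<longrightarrow> Q \<subseteq> P \<longrightarrow> P = Q))"

lemma rc_cone:
  fixes P :: "'a::linordered_field alg_closure set"
  shows "field_cone (rc_cone :: 'a alg_closure set)" "to_ac ` {0..} \<subseteq> (rc_cone :: 'a alg_closure set)"
    "field_cone P \<Longrightarrow> rc_cone \<subseteq> P \<Longrightarrow> P = rc_cone"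
proof -
  have "field_cone (rc_cone :: 'a alg_closure set) \<and> to_ac ` {0..} \<subseteq> (rc_cone :: 'a alg_closure set) \<and>
      (\<forall>P. field_cone P \<longrightarrow> (rc_cone :: 'a alg_closure set) \<subseteq> P \<longrightarrow> P = rc_cone)"
    unfolding rc_cone_def by (rule someI_ex[OF maximal_field_cone])
  then show "field_cone (rc_cone :: 'a alg_closure set)" "to_ac ` {0..} \<subseteq> (rc_cone :: 'a alg_closure set)"
    "field_cone P \<Longrightarrow> rc_cone \<subseteq> P \<Longrightarrow> P = rc_cone"
    by simp_all
qed

lemma rc_cone_closed:
  fixes x y :: "'a::linordered_field alg_closure"
  shows "1 \<in> (rc_cone :: 'a alg_closure set)" "0 \<in> (rc_cone :: 'a alg_closure set)"
  "x \<in> rc_cone \<Longrightarrow> y \<in> rc_cone \<Longrightarrow> x + y \<in> rc_cone"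
  "x \<in> rc_cone \<Longrightarrow> y \<in> rc_cone \<Longrightarrow> x * y \<in> rc_cone"
  "x \<in> rc_cone \<Longrightarrow> y \<in> rc_cone \<Longrightarrow> x - y \<in> rc_cone \<or> y - x \<in> rc_cone"
  "x \<in> rc_cone \<Longrightarrow> inverse x \<in> rc_cone" "x \<in> rc_cone \<Longrightarrow> - x \<in> rc_cone \<Longrightarrow> x = 0"
proof -
  note cone = rc_cone(1)[where 'a = 'a, unfolded field_cone_def]
  have "to_ac 0 \<in> (rc_cone :: 'a alg_closure set)" using rc_cone(2) by (rule subsetD) simp
  then show "0 \<in> (rc_cone :: 'a alg_closure set)" by simp
  show "1 \<in> (rc_cone :: 'a alg_closure set)" using cone by simp
  show "x \<in> rc_cone \<Longrightarrow> y \<in> rc_cone \<Longrightarrow> x + y \<in> rc_cone"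
    "x \<in> rc_cone \<Longrightarrow> y \<in> rc_cone \<Longrightarrow> x * y \<in> rc_cone"
    "x \<in> rc_cone \<Longrightarrow> y \<in> rc_cone \<Longrightarrow> x - y \<in> rc_cone \<or> y - x \<in> rc_cone"
    "x \<in> rc_cone \<Longrightarrow> inverse x \<in> rc_cone"
    using cone by simp_all
  show "x \<in> rc_cone \<Longrightarrow> - x \<in> rc_cone \<Longrightarrow> x = 0"
    using cone by simp
qed

text \<open>
  A real closure: a maximal ordered subfield of the algebraic closure, among those whose order
  extends the given one.
\<close>

typedef (overloaded) 'a rclosure = "{x :: 'a::linordered_field alg_closure. x \<in> rc_cone \<or> - x \<in> rc_cone}"
  by (rule exI[of _ 1]) (simp add: rc_cone_closed(1))

setup_lifting type_definition_rclosure

lemma rc_add: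
  assumes "x \<in> rc_cone \<or> - x \<in> rc_cone" "y \<in> rc_cone \<or> - y \<in> rc_cone"
  shows "x + y \<in> rc_cone \<or> - (x + y) \<in> rc_cone"
  using assms
proof (elim disjE)
  assume "x \<in> rc_cone" "- y \<in> rc_cone"
  moreover have "x - - y = x + y" "- y - x = - (x + y)" by simp_all
  ultimately show ?thesis using rc_cone_closed(5)[of x "- y"] by metis
next
  assume "- x \<in> rc_cone" "y \<in> rc_cone"
  moreover have "y - - x = x + y" "- x - y = - (x + y)" by simp_all
  ultimately show ?thesis using rc_cone_closed(5)[of y "- x"] by metis
next
  assume "- x \<in> rc_cone" "- y \<in> rc_cone"
  then show ?thesis using rc_cone_closed(3)[of "- x" "- y"] by simp
qed (use rc_cone_closed(3) in blast)

lemma rc_mult: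
  assumes "x \<in> rc_cone \<or> - x \<in> rc_cone" "y \<in> rc_cone \<or> - y \<in> rc_cone"
  shows "x * y \<in> rc_cone \<or> - (x * y) \<in> rc_cone"
  using assms rc_cone_closed(4)[of x y] rc_cone_closed(4)[of "- x" "- y"]
    rc_cone_closed(4)[of x "- y"] rc_cone_closed(4)[of "- x" y]
  by auto

lemma rc_inverse:
  assumes "x \<in> rc_cone \<or> - x \<in> rc_cone"
  shows "inverse x \<in> rc_cone \<or> - inverse x \<in> rc_cone"
  using assms rc_cone_closed(6)[of x] rc_cone_closed(6)[of "- x"] by auto

instantiation rclosure :: (linordered_field) field
begin

lift_definition zero_rclosure :: "'a rclosure" is 0 by (simp add: rc_cone_closed(2))
lift_definition one_rclosure :: "'a rclosure" is 1 by (simp add: rc_cone_closed(1))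
lift_definition plus_rclosure :: "'a rclosure \<Rightarrow> 'a rclosure \<Rightarrow> 'a rclosure" is "(+)" by (rule rc_add)
lift_definition times_rclosure :: "'a rclosure \<Rightarrow> 'a rclosure \<Rightarrow> 'a rclosure" is "(*)" by (rule rc_mult)
lift_definition uminus_rclosure :: "'a rclosure \<Rightarrow> 'a rclosure" is uminus by auto
lift_definition inverse_rclosure :: "'a rclosure \<Rightarrow> 'a rclosure" is inverse by (rule rc_inverse)
definition minus_rclosure :: "'a rclosure \<Rightarrow> 'a rclosure \<Rightarrow> 'a rclosure" where
  "minus_rclosure x y = x + - y"
definition divide_rclosure :: "'a rclosure \<Rightarrow> 'a rclosure \<Rightarrow> 'a rclosure" where
  "divide_rclosure x y = x * inverse y"
instance
proof
  fix a b c :: "'a rclosure"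
  show "a + b + c = a + (b + c)" by transfer (simp add: algebra_simps)
  show "a + b = b + a" by transfer (simp add: algebra_simps)
  show "0 + a = a" by transfer simp
  show "- a + a = 0" by transfer simp
  show "a - b = a + - b" by (rule minus_rclosure_def)
  show "a * b * c = a * (b * c)" by transfer (simp add: algebra_simps)
  show "a * b = b * a" by transfer (simp add: algebra_simps)
  show "1 * a = a" by transfer simp
  show "(a + b) * c = a * c + b * c" by transfer (simp add: algebra_simps)
  show "(0 :: 'a rclosure) \<noteq> 1" by transfer simp
  show "a \<noteq> 0 \<Longrightarrow> inverse a * a = 1" by transfer simp
  show "a div b = a * inverse b" by (rule divide_rclosure_def)
  show "inverse (0 :: 'a rclosure) = 0" by transfer simp
qed

end

instantiation rclosure :: (linordered_field) linordered_field
begin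

lift_definition less_eq_rclosure :: "'a rclosure \<Rightarrow> 'a rclosure \<Rightarrow> bool" is "\<lambda>x y. y - x \<in> rc_cone" .
definition less_rclosure :: "'a rclosure \<Rightarrow> 'a rclosure \<Rightarrow> bool" where
  "less_rclosure x y \<longleftrightarrow> x \<le> y \<and> \<not> y \<le> x"
definition abs_rclosure :: "'a rclosure \<Rightarrow> 'a rclosure" where
  "abs_rclosure x = (if x < 0 then - x else x)"
definition sgn_rclosure :: "'a rclosure \<Rightarrow> 'a rclosure" where
  "sgn_rclosure x = (if x = 0 then 0 else if 0 < x then 1 else - 1)"

instance
proof
  fix a b c :: "'a rclosure"
  show "a < b \<longleftrightarrow> a \<le> b \<and> \<not> b \<le> a" by (rule less_rclosure_def)
  show refl: "a \<le> a" by transfer (simp add: rc_cone_closed(2))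
  show "a \<le> b \<Longrightarrow> b \<le> c \<Longrightarrow> a \<le> c"
    by transfer (metis rc_cone_closed(3) diff_add_cancel add_diff_eq)
  have antisym: "x = y" if "x \<le> y" "y \<le> x" for x y :: "'a rclosure"
    using that by transfer (metis rc_cone_closed(7) minus_diff_eq eq_iff_diff_eq_0)
  then show "a \<le> b \<Longrightarrow> b \<le> a \<Longrightarrow> a = b" by blast
  show add: "a \<le> b \<Longrightarrow> c + a \<le> c + b" by transfer simp
  show total: "a \<le> b \<or> b \<le> a"
  proof transfer
    fix a b :: "'a alg_closure"
    assume "a \<in> rc_cone \<or> - a \<in> rc_cone" "b \<in> rc_cone \<or> - b \<in> rc_cone"
    then show "b - a \<in> rc_cone \<or> a - b \<in> rc_cone" using rc_add[of b "- a"] by auto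
  qed
  have mult: "0 \<le> a \<Longrightarrow> 0 \<le> b \<Longrightarrow> 0 \<le> a * b" for a b :: "'a rclosure"
    by transfer (simp add: rc_cone_closed(4))
  have nz: "a * b \<noteq> 0" if "a \<noteq> 0" "b \<noteq> 0" for a b :: "'a rclosure" using that by transfer simp
  show "a < b \<Longrightarrow> 0 < c \<Longrightarrow> c * a < c * b"
  proof -
    assume ab: "a < b" and c: "0 < c"
    have "0 \<le> c" "c \<noteq> 0" using c refl by (auto simp: less_rclosure_def)
    have "a \<le> b" using ab by (simp add: less_rclosure_def)
    then have "0 \<le> b - a" unfolding minus_rclosure_def by transfer simp
    have ne: "a \<noteq> b" using ab refl by (auto simp: less_rclosure_def)
    have "0 \<le> c * (b - a)" using mult \<open>0 \<le> c\<close> \<open>0 \<le> b - a\<close> by blast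
    then have le: "c * a \<le> c * b" unfolding minus_rclosure_def by transfer (simp add: algebra_simps)
    have "c * a \<noteq> c * b" using \<open>c \<noteq> 0\<close> ne by transfer simp
    then show ?thesis using le \<open>c * a \<noteq> c * b\<close> antisym unfolding less_rclosure_def by blast
  qed
  show "\<bar>a\<bar> = (if a < 0 then - a else a)" by (rule abs_rclosure_def)
  show "sgn a = (if a = 0 then 0 else if 0 < a then 1 else - 1)" by (rule sgn_rclosure_def)
qed

end

lemma cring_hom_Rep_rclosure: "cring_hom Rep_rclosure"
  by (simp add: cring_hom_def plus_rclosure.rep_eq times_rclosure.rep_eq one_rclosure.rep_eq)

lemma Rep_rclosure_nonneg: "0 \<le> x \<longleftrightarrow> Rep_rclosure x \<in> rc_cone"
  by (simp add: less_eq_rclosure.rep_eq zero_rclosure.rep_eq)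

lift_definition to_rc :: "'a::linordered_field \<Rightarrow> 'a rclosure" is to_ac
proof -
  fix x :: 'a
  have *: "to_ac y \<in> rc_cone" if "0 \<le> y" for y :: 'a using rc_cone(2) that by blast
  show "to_ac x \<in> rc_cone \<or> - to_ac x \<in> rc_cone"
    using *[of x] *[of "- x"] by (cases "0 \<le> x") auto
qed

lemma cring_hom_to_rc: "cring_hom to_rc"
  unfolding cring_hom_def by (intro conjI allI; transfer) simp_all

lemma to_rc_nonneg: "0 \<le> x \<Longrightarrow> 0 \<le> to_rc x"
  using rc_cone(2) by (auto simp: Rep_rclosure_nonneg to_rc.rep_eq)

lemma ev_hom:
  assumes "cring_hom h"
  shows "ev h (p + q) x = ev h p x + ev h q x" "ev h (p * q) x = ev h p x * ev h q x"
    "ev h 0 x = 0" "ev h 1 x = 1" "ev h [:c:] x = h c" "ev h [:c, d:] x = h c + x * h d"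
    "h (poly p y) = ev h p (h y)"
proof -
  interpret cring_hom h by fact
  show "ev h (p + q) x = ev h p x + ev h q x" "ev h (p * q) x = ev h p x * ev h q x"
    "ev h 0 x = 0" "ev h 1 x = 1" "ev h [:c:] x = h c" "ev h [:c, d:] x = h c + x * h d"
    by (simp_all add: ev_def map_poly_add map_poly_mult map_poly_pCons hom_1)
  show "h (poly p y) = ev h p (h y)"
    by (induction p) (simp_all add: ev_def map_poly_pCons hom_add hom_mult)
qed

text \<open>The weights are arbitrary nonnegative scalars, since over an ordered field these need
  not be squares. The parameter \<open>G\<close> is \<open>UNIV\<close> where products are formed
  and a degree bound where degrees are counted.\<close>

inductive_set sos_of :: "'m::linordered_field poly set \<Rightarrow> 'm poly set" for G where
  zero: "0 \<in> sos_of G"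
| add: "s \<in> sos_of G \<Longrightarrow> 0 \<le> q \<Longrightarrow> g \<in> G \<Longrightarrow> s + smult q (g * g) \<in> sos_of G"

lemma sos_of_nonneg: "s \<in> sos_of G \<Longrightarrow> 0 \<le> poly s x"
  by (induction rule: sos_of.induct) auto

lemma sos_of_degree:
  "s \<in> sos_of {g. degree g < n} \<Longrightarrow> degree s \<le> 2 * (n - 1)"
proof (induction rule: sos_of.induct)
  case (add s q g)
  have "degree (g * g) \<le> degree g + degree g" by (rule degree_mult_le)
  also have "\<dots> \<le> 2 * (n - 1)" using add by simp
  finally have "degree (smult q (g * g)) \<le> 2 * (n - 1)"
    using degree_smult_le[of q "g * g"] by simp
  then show ?case using add.IH by (rule degree_add_le[rotated])
qed simp

text \<open>A sum of nonnegative terms vanishes only termwise, so every polynomial squared with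
  nonzero weight is divisible by the linear factor; dividing keeps the degree bound.\<close>

lemma sos_of_root:
  assumes "s \<in> sos_of {g. degree g < n}" "poly s r = 0"
  shows "\<exists>s'\<in>sos_of {g. degree g < n}. s = [:- r, 1:] * [:- r, 1:] * s'"
  using assms
proof (induction rule: sos_of.induct)
  case zero
  then show ?case using sos_of.zero by force
next
  case (add s q g)
  have "0 \<le> poly s r" "0 \<le> poly (smult q (g * g)) r" using sos_of_nonneg[OF add(1)] add(2) by auto
  then have 0: "poly s r = 0" "poly (smult q (g * g)) r = 0"
    using add.prems by (auto simp: add_nonneg_eq_0_iff)
  obtain s' where s': "s' \<in> sos_of {g. degree g < n}" "s = [:- r, 1:] * [:- r, 1:] * s'"
    using add.IH[OF 0(1)] by blast
  show ?case
  proof (cases "q = 0")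
    case True
    then show ?thesis using s' by auto
  next
    case False
    then have "poly g r = 0" using 0(2) by simp
    then obtain g' where g': "g = [:- r, 1:] * g'" by (auto simp: poly_eq_0_iff_dvd dvd_def)
    have "degree g' < n"
    proof (cases "g' = 0")
      case False
      then have "degree g = Suc (degree g')" unfolding g' by (subst degree_mult_eq) auto
      then show ?thesis using add(3) by simp
    qed (use add(3) in auto)
    then have "s' + smult q (g' * g') \<in> sos_of {g. degree g < n}"
      using s'(1) add(2) by (intro sos_of.add) auto
    moreover have "l * l * s' + smult q ((l * g') * (l * g')) = l * l * (s' + smult q (g' * g'))" for l
      by (simp add: algebra_simps)
    then have "s + smult q (g * g) = [:- r, 1:] * [:- r, 1:] * (s' + smult q (g' * g'))"
      unfolding s'(2) g' .
    ultimately show ?thesis by blast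
  qed
qed

lemma sos_of_add:
  assumes s: "s \<in> sos_of G" and t: "t \<in> sos_of G"
  shows "s + t \<in> sos_of G"
  using t
proof (induction rule: sos_of.induct)
  case (add t q g)
  then show ?case unfolding add.assoc[symmetric] by (intro sos_of.add)
qed (simp add: s)

lemma sos_of_mult_square: "s \<in> sos_of UNIV \<Longrightarrow> 0 \<le> q \<Longrightarrow> s * smult q (g * g) \<in> sos_of UNIV"
proof (induction rule: sos_of.induct)
  case zero
  then show ?case using sos_of.zero by simp
next
  case (add s q' g')
  have "s * smult q (g * g) + smult (q' * q) ((g' * g) * (g' * g)) \<in> sos_of UNIV"
    using add by (intro sos_of.add) auto
  moreover have "(s + smult q' (g' * g')) * smult q (g * g) =
      s * smult q (g * g) + smult (q' * q) ((g' * g) * (g' * g))"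
    by (simp add: distrib_left distrib_right smult_add_right mult_ac)
  ultimately show ?case by simp
qed

lemma sos_of_mult:
  assumes s: "s \<in> sos_of UNIV" and t: "t \<in> sos_of UNIV"
  shows "s * t \<in> sos_of UNIV"
  using t
proof (induction rule: sos_of.induct)
  case zero
  then show ?case using sos_of.zero by simp
next
  case (add t q g)
  then show ?case
    using sos_of_mult_square[OF s] by (simp only: distrib_left sos_of_add)
qed

lemma sos_of_square: "g * g \<in> sos_of UNIV"
  using sos_of.add[OF sos_of.zero, of 1 g UNIV] by simp

lemma ev_mod:
  fixes f :: "'m::field poly"
  assumes h: "cring_hom h" and "ev h f x = 0"
  shows "ev h (g mod f) x = ev h g x"
proof -
  have "ev h g x = ev h (g div f * f + g mod f) x" by (simp only: div_mult_mod_eq)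
  then show ?thesis by (simp only: ev_hom(1,2)[OF h] assms(2) mult_zero_right add_0_left)
qed

text \<open>Replacing each \<open>g\<close> by \<open>g mod f\<close> changes no value at the root
  \<alpha> and makes the degree count in the descent possible.\<close>

lemma sos_of_reduce:
  fixes f :: "'m::linordered_field poly"
  assumes h: "cring_hom h" and f: "f \<noteq> 0" "0 < degree f" "ev h f \<alpha> = 0" and s: "s \<in> sos_of UNIV"
  shows "\<exists>s'\<in>sos_of {g. degree g < degree f}. ev h s' \<alpha> = ev h s \<alpha>"
  using s
proof (induction rule: sos_of.induct)
  case zero
  then show ?case using sos_of.zero by blast
next
  case (add s q g)
  then obtain s' where s': "s' \<in> sos_of {g. degree g < degree f}" "ev h s' \<alpha> = ev h s \<alpha>" by blast
  have m: "ev h (g mod f) \<alpha> = ev h g \<alpha>" by (rule ev_mod[OF h f(3)])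
  have "degree (g mod f) < degree f"
    using degree_mod_less'[OF f(1), of g] f(2) by (cases "g mod f = 0") auto
  then have "s' + smult q ((g mod f) * (g mod f)) \<in> sos_of {g. degree g < degree f}"
    using s' add by (intro sos_of.add) auto
  moreover have "ev h (smult q ((g mod f) * (g mod f))) \<alpha> = ev h (smult q (g * g)) \<alpha>"
  proof -
    have sm: "ev h (smult q (p * p)) \<alpha> = h q * (ev h p \<alpha> * ev h p \<alpha>)" for p
      using ev_hom(2)[OF h, of "[:q:]" "p * p"] by (simp add: ev_hom[OF h])
    show ?thesis by (simp only: sm m)
  qed
  ultimately show ?case using s' by (metis ev_hom(1)[OF h])
qed

text \<open>
  Artin and Schreier: an ordering extends to the root field of an irreducible polynomial that
  changes sign. A counterexample to the intermediate value property of least degree is such a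
  polynomial, and an extension would contradict maximality.
\<close>

lemma rclosure_IVT:
  fixes f :: "'a::linordered_field rclosure poly"
  assumes "a < b" "poly f a < 0" "0 < poly f b"
  shows "\<exists>x. a < x \<and> x < b \<and> poly f x = 0"
proof (rule ccontr)
  assume no_root: "\<not> ?thesis"
  define bad where "bad f \<longleftrightarrow> (\<exists>a b. a < b \<and> poly f a < 0 \<and> 0 < poly f b \<and>
    (\<forall>x. a < x \<and> x < b \<longrightarrow> poly f x \<noteq> 0))" for f :: "'a rclosure poly"
  have "bad f" unfolding bad_def using assms no_root by blast
  then obtain f where "bad f" and min: "\<And>g. bad g \<Longrightarrow> degree f \<le> degree g"
    using ex_has_least_nat[of bad f degree] by blast
  from \<open>bad f\<close> obtain a b where ab: "a < b" "poly f a < 0" "0 < poly f b"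
    and nr: "\<And>x. a < x \<Longrightarrow> x < b \<Longrightarrow> poly f x \<noteq> 0"
    unfolding bad_def by blast
  \<comment> \<open>By minimality of the degree, polynomials of smaller degree do have the
    intermediate value property, in particular between these \<open>a\<close> and
    \<open>b\<close>.\<close>
  have chg: "\<exists>x. a < x \<and> x < b \<and> poly g x = 0"
    if g: "degree g < degree f" "poly g a * poly g b < 0" for g
  proof (rule ccontr)
    assume n: "\<not> ?thesis"
    consider "poly g a < 0" "0 < poly g b" | "poly (- g) a < 0" "0 < poly (- g) b"
      using g(2) by (auto simp: mult_less_0_iff)
    then have "bad g \<or> bad (- g)"
    proof cases
      case 1
      then have "bad g" using n ab(1) unfolding bad_def by blast
      then show ?thesis ..
    next
      case 2
      have "poly (- g) x \<noteq> 0" if "a < x \<and> x < b" for x using n that by auto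
      then have "bad (- g)" using 2 ab(1) unfolding bad_def by blast
      then show ?thesis ..
    qed
    then show False using min[of g] min[of "- g"] g(1) by auto
  qed
  \<comment> \<open>In a factorisation one factor would change sign, and its root in the interval
    would be a root of \<open>f\<close>.\<close>
  have irred: False if uv: "f = u * v" "degree u < degree f" "degree v < degree f" for u v
  proof -
    have "(poly u a * poly u b) * (poly v a * poly v b) = poly f a * poly f b"
      by (simp add: uv(1) mult_ac)
    also have "\<dots> < 0" using ab by (simp add: mult_neg_pos)
    finally have "poly u a * poly u b < 0 \<or> poly v a * poly v b < 0"
      by (auto simp: mult_less_0_iff zero_less_mult_iff)
    then obtain x where "a < x" "x < b" "poly u x = 0 \<or> poly v x = 0"
      using chg[OF uv(2)] chg[OF uv(3)] by blast
    then show False using nr[of x] uv(1) by auto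
  qed
  have "degree f \<noteq> 0"
  proof
    assume "degree f = 0"
    then obtain c where "f = [:c:]" by (rule degree_eq_zeroE)
    then show False using ab by simp
  qed
  then have degf: "0 < degree f" and f0: "f \<noteq> 0" by auto
  note hom = cring_hom_Rep_rclosure
  interpret rep: cring_hom "Rep_rclosure :: 'a rclosure \<Rightarrow> _" by (rule hom)
  have rep0: "Rep_rclosure x = 0 \<longleftrightarrow> x = 0" for x :: "'a rclosure"
    using Rep_rclosure_inject[of x 0] by simp
  have "degree (map_poly Rep_rclosure f) = degree f"
    by (rule degree_map_poly_lead) (use f0 rep0 in auto)
  then obtain \<alpha> where \<alpha>: "ev Rep_rclosure f \<alpha> = 0"
    using alg_closed_imp_poly_has_root[of "map_poly Rep_rclosure f"] degf unfolding ev_def by auto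
  define E where "E g = ev Rep_rclosure g \<alpha>" for g :: "'a rclosure poly"
  have E: "E (p + q) = E p + E q" "E (p * q) = E p * E q" "E 0 = 0" "E 1 = 1"
    "E [:c:] = Rep_rclosure c" "E [:c, d:] = Rep_rclosure c + \<alpha> * Rep_rclosure d" for p q c d
    by (simp_all add: E_def ev_hom[OF hom])
  have Ef: "E f = 0" using \<alpha> by (simp add: E_def)
  \<comment> \<open>An annihilator of \<alpha> of least degree divides \<open>f\<close>; were its
    degree smaller, \<open>f\<close> would be reducible.\<close>
  have minimal: "g = 0" if g: "E g = 0" "degree g < degree f" for g
  proof (rule ccontr)
    assume "g \<noteq> 0"
    then obtain m where m: "m \<noteq> 0" "E m = 0" and least: "\<And>k. k \<noteq> 0 \<Longrightarrow> E k = 0 \<Longrightarrow> degree m \<le> degree k"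
      using ex_has_least_nat[of "\<lambda>m. m \<noteq> 0 \<and> E m = 0" g degree] g by blast
    have "degree m < degree f" using least[of g] g \<open>g \<noteq> 0\<close> by simp
    have "degree m \<noteq> 0"
    proof
      assume "degree m = 0"
      then obtain c where "m = [:c:]" by (rule degree_eq_zeroE)
      then show False using m by (simp add: E rep0)
    qed
    have "E (f mod m) = 0"
      using ev_mod[OF hom, of m \<alpha> f] m(2) Ef by (simp add: E_def)
    then have "f mod m = 0"
      using least[of "f mod m"] degree_mod_less'[OF m(1), of f] by fastforce
    then have fm: "f = m * (f div m)" by (metis dvd_mult_div_cancel mod_0_imp_dvd)
    have "degree f = degree m + degree (f div m)"
      using f0 fm by (metis degree_mult_eq mult_zero_left mult_zero_right)
    then have "degree (f div m) < degree f" using \<open>degree m \<noteq> 0\<close> by simp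
    then show False using irred[OF fm] \<open>degree m < degree f\<close> by blast
  qed
  have divides: "\<exists>w. g = f * w" if "E g = 0" for g
  proof -
    have "E (g mod f) = 0"
      using ev_mod[OF hom, of f \<alpha> g] Ef that by (simp add: E_def)
    then have "g mod f = 0"
      using minimal[of "g mod f"] degree_mod_less'[OF f0, of g] by fastforce
    then show ?thesis by (metis dvd_mult_div_cancel mod_0_imp_dvd)
  qed
  \<comment> \<open>Otherwise \<open>f\<close> would be linear, and a linear polynomial that changes
    sign has its root in between.\<close>
  have \<alpha>_new: "\<alpha> \<noteq> Rep_rclosure t" for t
  proof
    assume t: "\<alpha> = Rep_rclosure t"
    have "E [:- t, 1:] = 0" by (simp add: E t rep.hom_uminus rep.hom_1)
    then obtain w where w: "[:- t, 1:] = f * w" using divides by blast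
    then have "w \<noteq> 0" by auto
    have "degree f + degree w = 1" using arg_cong[OF w, of degree] degree_mult_eq[OF f0 \<open>w \<noteq> 0\<close>] by simp
    then have "degree f = 1" using degf by simp
    moreover obtain c q where "f = pCons c q" by (cases f)
    moreover have "degree q = 0" using calculation by (cases "q = 0") auto
    moreover obtain d where "q = [:d:]" using \<open>degree q = 0\<close> by (rule degree_eq_zeroE)
    ultimately have f: "f = [:c, d:]" by simp
    have "Rep_rclosure (poly f t) = 0" using Ef by (simp add: E_def t ev_hom(7)[OF hom])
    then have "c = - (d * t)" using f by (simp add: rep0 eq_neg_iff_add_eq_0 mult.commute)
    then have fx: "poly f x = d * (x - t)" for x by (simp add: f algebra_simps)
    have "a < t \<and> t < b"
      using ab unfolding fx by (auto simp: mult_less_0_iff zero_less_mult_iff)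
    then show False using nr[of t] fx[of t] by simp
  qed
  \<comment> \<open>The descent of Artin and Schreier. If \<open>s + u * u = f * w\<close>, counting
    degrees gives \<open>degree w < degree f\<close>. The left side is nonnegative and
    \<open>f\<close> changes sign, so \<open>w a \<le> 0 \<le> w b\<close> for the values of
    \<open>w\<close>, and \<open>w\<close> has a root. There \<open>s\<close> and \<open>u\<close>
    vanish as well, and dividing by the squared linear factor lowers
    \<open>degree u\<close>.\<close>
  have claim: "E (s + u * u) \<noteq> 0"
    if "u \<noteq> 0" "degree u < degree f" "s \<in> sos_of {g. degree g < degree f}" for s u
    using that
  proof (induction "degree u" arbitrary: u s rule: less_induct)
    case less
    show ?case
    proof
      assume 0: "E (s + u * u) = 0"
      then obtain w where w: "s + u * u = f * w" using divides by blast
      have nonneg: "0 \<le> poly s x + poly u x * poly u x" for x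
        using sos_of_nonneg[OF less.prems(3), of x] by simp
      have fw: "poly f x * poly w x = poly s x + poly u x * poly u x" for x
        using arg_cong[OF w, of "\<lambda>p. poly p x"] by simp
      have "w \<noteq> 0"
      proof
        assume "w = 0"
        have "poly u x = 0" for x
        proof -
          have "poly s x + poly u x * poly u x = 0" using fw[of x] \<open>w = 0\<close> by simp
          then have "poly u x * poly u x \<le> 0"
            using sos_of_nonneg[OF less.prems(3), of x] by simp
          then show ?thesis by (auto simp: mult_le_0_iff)
        qed
        then show False using less.prems(1) poly_all_0_iff_0 by blast
      qed
      have "degree (s + u * u) \<le> 2 * (degree f - 1)"
      proof (rule degree_add_le)
        show "degree s \<le> 2 * (degree f - 1)" using sos_of_degree less.prems(3) by blast
        show "degree (u * u) \<le> 2 * (degree f - 1)"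
          using degree_mult_le[of u u] less.prems(2) by simp
      qed
      then have "degree f + degree w \<le> 2 * (degree f - 1)"
        using w degree_mult_eq[OF f0 \<open>w \<noteq> 0\<close>] by simp
      then have degw: "degree w < degree f" using degf by simp
      have "poly w a \<le> 0" using nonneg[of a] ab(2) unfolding fw[symmetric] by (simp add: zero_le_mult_iff)
      moreover have "0 \<le> poly w b"
        using nonneg[of b] ab(3) unfolding fw[symmetric] by (simp add: zero_le_mult_iff)
      ultimately have "\<exists>r. poly w r = 0"
        using chg[OF degw] by (cases "poly w a = 0 \<or> poly w b = 0") (auto simp: mult_less_0_iff le_less)
      then obtain r where "poly w r = 0" by blast
      then have "poly s r + poly u r * poly u r = 0" using fw[of r] by simp
      then have "poly s r = 0" "poly u r = 0"
        using sos_of_nonneg[OF less.prems(3), of r] by (auto simp: add_nonneg_eq_0_iff)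
      obtain s' where s': "s' \<in> sos_of {g. degree g < degree f}" "s = [:- r, 1:] * [:- r, 1:] * s'"
        using sos_of_root[OF less.prems(3) \<open>poly s r = 0\<close>] by blast
      obtain u' where u': "u = [:- r, 1:] * u'"
        using \<open>poly u r = 0\<close> by (auto simp: poly_eq_0_iff_dvd dvd_def)
      have "u' \<noteq> 0" using less.prems(1) u' by auto
      then have du: "degree u = Suc (degree u')" unfolding u' by (subst degree_mult_eq) auto
      have "E (s + u * u) = E [:- r, 1:] * E [:- r, 1:] * E (s' + u' * u')"
        unfolding s'(2) u' E(1,2) by (simp only: distrib_left mult_ac)
      moreover have "E [:- r, 1:] \<noteq> 0"
        using \<alpha>_new[of r] by (simp add: E rep.hom_uminus rep.hom_1)
      ultimately have "E (s' + u' * u') = 0" using 0 by simp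
      then show False
        using less.hyps[of u' s'] du \<open>u' \<noteq> 0\<close> s'(1) less.prems(2) by simp
    qed
  qed
  \<comment> \<open>\<open>L\<close> is the field generated by \<alpha> over the closure and
    \<open>T\<close> consists of its weighted sums of squares. Fractions of values make inverses
    immediate.\<close>
  define L where "L = {E g / E h | g h. E h \<noteq> 0}"
  define T where "T = {E s / (E h * E h) | s h. s \<in> sos_of UNIV \<and> E h \<noteq> 0}"
  have Em: "E (- g) = - E g" for g using E(1)[of g "- g"] E(3) by (simp add: eq_neg_iff_add_eq_0 add.commute)
  have Ed: "E (g - g') = E g - E g'" for g g' using E(1)[of g "- g'"] by (simp add: Em)
  have L: "subring_set L"
    unfolding subring_set_def
  proof (intro conjI ballI)
    show "1 \<in> L" unfolding L_def by (intro CollectI exI[of _ 1]) (simp add: E)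
  next
    fix x y assume "x \<in> L" "y \<in> L"
    then obtain g h g' h' where *: "x = E g / E h" "E h \<noteq> 0" "y = E g' / E h'" "E h' \<noteq> 0"
      unfolding L_def by blast
    have "x - y = E (g * h' - g' * h) / E (h * h')" "x * y = E (g * g') / E (h * h')" "E (h * h') \<noteq> 0"
      unfolding *(1,3) using *(2,4) by (simp_all add: E Ed field_simps)
    then show "x - y \<in> L" "x * y \<in> L" unfolding L_def by blast+
  qed
  have TL: "T \<subseteq> L"
  proof
    fix x assume "x \<in> T"
    then obtain s h where *: "x = E s / (E h * E h)" "E h \<noteq> 0" unfolding T_def by blast
    then have "x = E s / E (h * h)" "E (h * h) \<noteq> 0" by (simp_all add: E)
    then show "x \<in> L" unfolding L_def by blast
  qed
  have "pre_cone L T"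
    unfolding pre_cone_def
  proof (intro conjI ballI impI TL)
    fix x y assume "x \<in> T" "y \<in> T"
    then obtain s h s' h' where *: "x = E s / (E h * E h)" "E h \<noteq> 0" "y = E s' / (E h' * E h')"
      "E h' \<noteq> 0" "s \<in> sos_of UNIV" "s' \<in> sos_of UNIV"
      unfolding T_def by blast
    have eq: "x + y = E (s * (h' * h') + s' * (h * h)) / (E (h * h') * E (h * h'))"
      "x * y = E (s * s') / (E (h * h') * E (h * h'))" and "E (h * h') \<noteq> 0"
      unfolding *(1,3) using *(2,4) by (simp_all add: E field_simps)
    moreover have "s * (h' * h') + s' * (h * h) \<in> sos_of UNIV" "s * s' \<in> sos_of UNIV"
      using * by (auto intro!: sos_of_add sos_of_mult sos_of_square)
    ultimately show "x + y \<in> T" "x * y \<in> T" unfolding T_def by blast+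
  next
    fix x assume "x \<in> L"
    then obtain g h where *: "x = E g / E h" "E h \<noteq> 0" unfolding L_def by blast
    then have "x * x = E (g * g) / (E h * E h)" by (simp add: E)
    then show "x * x \<in> T" using sos_of_square * unfolding T_def by blast
  next
    fix c assume c: "c \<in> L" "- (c * c) \<in> T"
    obtain g h0 where g: "c = E g / E h0" "E h0 \<noteq> 0" using c(1) unfolding L_def by blast
    obtain s h where s: "- (c * c) = E s / (E h * E h)" "E h \<noteq> 0" "s \<in> sos_of UNIV"
      using c(2) unfolding T_def by blast
    show "c = 0"
    proof (rule ccontr)
      assume "c \<noteq> 0"
      then have "E g \<noteq> 0" using g by auto
      \<comment> \<open>Clearing denominators gives a relation that \<open>claim\<close> excludes,
        once the degrees are reduced modulo \<open>f\<close>.\<close>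
      have "E s * (E h0 * E h0) = - ((E g * E h) * (E g * E h))"
        using s(1) unfolding g(1) using g(2) s(2) by (simp add: field_simps)
      then have "E s * (E h0 * E h0) + (E g * E h) * (E g * E h) = 0" by simp
      moreover obtain s' where s': "s' \<in> sos_of {g. degree g < degree f}"
        "E s' = E (s * (h0 * h0))"
        using sos_of_reduce[OF hom f0 degf \<alpha>, of "s * (h0 * h0)"] s(3)
        unfolding E_def by (auto intro!: sos_of_mult sos_of_square)
      moreover define u where "u = (g * h) mod f"
      moreover have Eu: "E u = E g * E h"
        using ev_mod[OF hom, of f \<alpha> "g * h"] Ef by (simp add: E_def u_def ev_hom[OF hom])
      ultimately have "E (s' + u * u) = 0" by (simp add: E)
      moreover have "u \<noteq> 0" using Eu \<open>E g \<noteq> 0\<close> s(2) by (auto simp: E)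
      moreover have "degree u < degree f"
        using degree_mod_less'[OF f0, of "g * h"] \<open>u \<noteq> 0\<close> by (simp add: u_def)
      ultimately show False using claim s'(1) by blast
    qed
  qed
  from pre_cone_ordering[OF L this] obtain P where P: "pre_cone L P" "T \<subseteq> P"
    "\<And>x. x \<in> L \<Longrightarrow> x \<in> P \<or> - x \<in> P" "\<And>x. x \<in> P \<Longrightarrow> - x \<in> P \<Longrightarrow> x = 0"
    by blast
  note L' = subring_set_closed[OF L]
  have P': "P \<subseteq> L" "\<And>x y. x \<in> P \<Longrightarrow> y \<in> P \<Longrightarrow> x + y \<in> P" "\<And>x y. x \<in> P \<Longrightarrow> y \<in> P \<Longrightarrow> x * y \<in> P"
    "\<And>x. x \<in> L \<Longrightarrow> x * x \<in> P"
    using P(1) unfolding pre_cone_def by auto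
  have "field_cone P"
    unfolding field_cone_def
  proof (intro conjI ballI impI)
    show "1 \<in> P" using P'(4)[OF L'(1)] by simp
    fix x assume x: "x \<in> P"
    show "inverse x \<in> P"
    proof (cases "x = 0")
      case False
      obtain g h where *: "x = E g / E h" "E h \<noteq> 0" using x P'(1) unfolding L_def by blast
      then have "inverse x = E h / E g" "E g \<noteq> 0" using False by auto
      then have "inverse x \<in> L" unfolding L_def by blast
      then have "x * (inverse x * inverse x) \<in> P" using P'(3,4) x by blast
      moreover have "x * (inverse x * inverse x) = inverse x"
        by (metis False right_inverse mult.assoc mult_1_left)
      ultimately show ?thesis by (simp only:)
    qed (use x in simp)
    show "x = 0" if "- x \<in> P" using P(4) x that by blast
    fix y assume y: "y \<in> P"
    have "x - y \<in> P \<or> - (x - y) \<in> P" using P(3) L'(5) P'(1) x y by blast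
    then show "x - y \<in> P \<or> y - x \<in> P" by simp
  qed (use P' in auto)
  moreover have "rc_cone \<subseteq> P"
  proof
    fix x :: "'a alg_closure" assume x: "x \<in> rc_cone"
    then have rx: "Rep_rclosure (Abs_rclosure x) = x" by (simp add: Abs_rclosure_inverse)
    then have "0 \<le> Abs_rclosure x" using x by (simp add: Rep_rclosure_nonneg)
    then have "0 + smult (Abs_rclosure x) (1 * 1) \<in> sos_of UNIV" by (intro sos_of.intros) auto
    moreover have "x = E (0 + smult (Abs_rclosure x) (1 * 1)) / (E 1 * E 1)"
      using rx by (simp add: E smult_one)
    moreover have "E 1 \<noteq> 0" by (simp add: E)
    ultimately have "x \<in> T" unfolding T_def by blast
    then show "x \<in> P" using P(2) by blast
  qed
  \<comment> \<open>By maximality the ordering of \<open>L\<close> adds nothing to the cone; yet it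
    decides the sign of \<alpha>, which puts \<alpha> into the closure.\<close>
  ultimately have PQ: "P = rc_cone" by (rule rc_cone(3))
  have "\<alpha> = E [:0, 1:] / E 1" "E 1 \<noteq> 0" by (simp_all add: E rep.hom_1)
  then have "\<alpha> \<in> L" unfolding L_def by blast
  then have "\<alpha> \<in> rc_cone \<or> - \<alpha> \<in> rc_cone" using P(3) PQ by blast
  then show False using \<alpha>_new[of "Abs_rclosure \<alpha>"] by (simp add: Abs_rclosure_inverse)
qed

instance rclosure :: (linordered_field) rcf
proof
  fix a b :: "'a rclosure" and f :: "nat \<Rightarrow> 'a rclosure" and n
  define p where "p = (\<Sum>k\<le>n. monom (f k) k)"
  have p: "poly p x = (\<Sum>k\<le>n. f k * x ^ k)" for x by (simp add: p_def poly_sum poly_monom)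
  show "\<exists>x>a. x < b \<and> (\<Sum>k\<le>n. f k * x ^ k) = 0"
    if "a < b" "(\<Sum>k\<le>n. f k * a ^ k) < 0" "0 < (\<Sum>k\<le>n. f k * b ^ k)"
    using rclosure_IVT[of a b p] that unfolding p by blast
qed

instance real :: rcf
proof
  fix a b :: real and f :: "nat \<Rightarrow> real" and n
  assume *: "a < b" "(\<Sum>k\<le>n. f k * a ^ k) < 0" "0 < (\<Sum>k\<le>n. f k * b ^ k)"
  have "\<exists>x\<ge>a. x \<le> b \<and> (\<Sum>k\<le>n. f k * x ^ k) = 0"
    by (rule IVT') (use * in \<open>auto intro!: continuous_intros\<close>)
  then obtain x where x: "a \<le> x" "x \<le> b" "(\<Sum>k\<le>n. f k * x ^ k) = 0" by blast
  then have "x \<noteq> a" "x \<noteq> b" using * by auto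
  then show "\<exists>x>a. x < b \<and> (\<Sum>k\<le>n. f k * x ^ k) = 0" using x by force
qed

section \<open>Orderings of the polynomial ring\<close>

lemma subring_set_sum:
  assumes "subring_set A" "\<And>i. i \<in> I \<Longrightarrow> f i \<in> A"
  shows "sum f I \<in> A"
  using assms(2)
  by (induction I rule: infinite_finite_induct) (auto intro: subring_set_closed[OF assms(1)])

lemma subring_set_prod:
  fixes f :: "'i \<Rightarrow> 'a::comm_ring_1"
  assumes "subring_set A" "\<And>i. i \<in> I \<Longrightarrow> f i \<in> A"
  shows "prod f I \<in> A"
  using assms(2)
  by (induction I rule: infinite_finite_induct) (auto intro: subring_set_closed[OF assms(1)])

lemma subring_set_power:
  fixes x :: "'a::comm_ring_1"
  assumes "subring_set A" "x \<in> A"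
  shows "x ^ n \<in> A"
  by (induction n) (auto intro: subring_set_closed[OF assms(1)] assms(2))

lemma polys_over_mult:
  fixes p q :: "'a::comm_ring_1 poly"
  assumes "subring_set A" "p \<in> polys_over A" "q \<in> polys_over A"
  shows "p * q \<in> polys_over A"
  using assms(2,3) unfolding polys_over_def
  by (auto simp: coeff_mult intro!: subring_set_sum[OF assms(1)] subring_set_closed(6)[OF assms(1)])

lemma poly_mapping_sum_single: "(\<Sum>m\<in>Poly_Mapping.keys p. Poly_Mapping.single m (Poly_Mapping.lookup p m)) = p"
  by (rule poly_mapping_eqI)
    (auto simp: lookup_sum lookup_single when_def in_keys_iff)

lemma poly_eval_superset:
  assumes "finite S" "Poly_Mapping.keys p \<subseteq> S"
  shows "poly_eval p x =
    (\<Sum>m\<in>S. Poly_Mapping.lookup p m * (\<Prod>i\<in>UNIV. (x $ i) ^ Poly_Mapping.lookup m i))"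
  unfolding poly_eval_def using assms
  by (intro sum.mono_neutral_left) (auto simp: in_keys_iff)

lemma poly_eval_add: "poly_eval (p + q) x = poly_eval p x + poly_eval q x"
proof -
  let ?S = "Poly_Mapping.keys p \<union> Poly_Mapping.keys q"
  have "Poly_Mapping.keys (p + q) \<subseteq> ?S" by (rule Poly_Mapping.keys_add)
  then show ?thesis
    by (simp add: poly_eval_superset[of ?S] lookup_add distrib_right sum.distrib)
qed

lemma poly_eval_single:
  "poly_eval (Poly_Mapping.single m c) x = c * (\<Prod>i\<in>UNIV. (x $ i) ^ Poly_Mapping.lookup m i)"
  by (subst poly_eval_superset[of "{m}"]) auto

lemma poly_eval_0: "poly_eval 0 x = 0"
  by (simp add: poly_eval_def)

lemma poly_eval_sum: "poly_eval (sum f S) x = (\<Sum>i\<in>S. poly_eval (f i) x)"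
  by (induction S rule: infinite_finite_induct) (auto simp: poly_eval_add poly_eval_0)

lemma poly_eval_mult: "poly_eval (p * q) x = poly_eval p x * poly_eval q x"
proof -
  let ?s = "\<lambda>p. \<Sum>m\<in>Poly_Mapping.keys p. Poly_Mapping.single m (Poly_Mapping.lookup p m)"
  have "poly_eval (?s p * ?s q) x = poly_eval (?s p) x * poly_eval (?s q) x"
    by (simp add: sum_product poly_eval_sum mult_single poly_eval_single lookup_add power_add
        prod.distrib mult_ac)
  then show ?thesis by (simp only: poly_mapping_sum_single)
qed

lemma cring_hom_poly_eval: "cring_hom (\<lambda>p. poly_eval p x)"
proof
  have "poly_eval (Poly_Mapping.single 0 1) x = 1" by (subst poly_eval_single) simp
  then show "poly_eval 1 x = 1" by simp
qed (rule poly_eval_add poly_eval_mult)+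

text \<open>
  A copy of the polynomial ring, which can carry the integral domain and order structures: the
  library instances for polynomials would require a linear order on the type of variables.
\<close>

typedef 'd mp = "UNIV :: 'd::finite rpoly set" morphisms of_mp to_mp ..

setup_lifting type_definition_mp

instantiation mp :: (finite) comm_ring_1
begin

lift_definition zero_mp :: "'a mp" is 0 .
lift_definition one_mp :: "'a mp" is 1 .
lift_definition plus_mp :: "'a mp \<Rightarrow> 'a mp \<Rightarrow> 'a mp" is "(+)" .
lift_definition minus_mp :: "'a mp \<Rightarrow> 'a mp \<Rightarrow> 'a mp" is "(-)" .
lift_definition uminus_mp :: "'a mp \<Rightarrow> 'a mp" is uminus .
lift_definition times_mp :: "'a mp \<Rightarrow> 'a mp \<Rightarrow> 'a mp" is "(*)" .

instance by standard (transfer; simp add: algebra_simps)+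

end

lift_definition meval :: "'d::finite mp \<Rightarrow> real ^ 'd \<Rightarrow> real" is poly_eval .

lift_definition mconst :: "real \<Rightarrow> 'd::finite mp" is const_poly .

lift_definition mvar :: "'d::finite \<Rightarrow> 'd mp" is
  "\<lambda>i. Poly_Mapping.single (Poly_Mapping.single i 1) 1" .

lemma cring_hom_meval: "cring_hom (\<lambda>p. meval p x)"
proof
  show "meval (p + q) x = meval p x + meval q x" "meval (p * q) x = meval p x * meval q x" for p q
    by (transfer; rule poly_eval_add poly_eval_mult)+
  show "meval 1 x = 1" by transfer (rule cring_hom.hom_1[OF cring_hom_poly_eval])
qed

lemma meval_simps [simp]:
  "meval (p + q) x = meval p x + meval q x" "meval (p * q) x = meval p x * meval q x"
  "meval 0 x = 0" "meval 1 x = 1" "meval (- p) x = - meval p x" "meval (p - q) x = meval p x - meval q x"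
  using cring_hom.hom_add[OF cring_hom_meval] cring_hom.hom_mult[OF cring_hom_meval]
    cring_hom.hom_0[OF cring_hom_meval] cring_hom.hom_1[OF cring_hom_meval]
    cring_hom.hom_uminus[OF cring_hom_meval] cring_hom.hom_diff[OF cring_hom_meval] by blast+

lemma meval_mconst [simp]: "meval (mconst c) x = c"
  by transfer (simp add: const_poly_def poly_eval_single)

lemma meval_mvar [simp]: "meval (mvar i) x = x $ i"
proof -
  have "(\<Prod>j\<in>UNIV. x $ j ^ Poly_Mapping.lookup (Poly_Mapping.single i 1) j) = (\<Prod>j\<in>UNIV. if j = i then x $ j else 1)"
    by (intro prod.cong) (auto simp: lookup_single when_def)
  also have "\<dots> = x $ i" by (subst prod.delta) auto
  finally show ?thesis by transfer (simp add: poly_eval_single)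
qed

lemma mconst_hom: "mconst 1 = 1" "mconst 0 = 0" "mconst (a * b) = mconst a * mconst b"
  by (transfer; simp add: const_poly_def mult_single)+

section \<open>Polynomials in a subset of the variables\<close>

inductive_set var_ring :: "'d::finite set \<Rightarrow> 'd mp set" for V where
  const: "mconst c \<in> var_ring V"
| var: "i \<in> V \<Longrightarrow> mvar i \<in> var_ring V"
| diff: "p \<in> var_ring V \<Longrightarrow> q \<in> var_ring V \<Longrightarrow> p - q \<in> var_ring V"
| mult: "p \<in> var_ring V \<Longrightarrow> q \<in> var_ring V \<Longrightarrow> p * q \<in> var_ring V"

lemma subring_set_var_ring: "subring_set (var_ring V)"
  using var_ring.const[of 1] by (auto simp: subring_set_def mconst_hom intro: var_ring.diff var_ring.mult)

lemma var_ring_empty: "p \<in> var_ring {} \<Longrightarrow> \<exists>c. p = mconst c"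
proof (induction rule: var_ring.induct)
  case (diff p q)
  have "mconst a - mconst b = mconst (a - b)" for a b
    by transfer (simp add: const_poly_def single_diff)
  then show ?case using diff by blast
next
  case (mult p q)
  then show ?case by (metis mconst_hom(3))
qed auto

text \<open>Splits off one variable, so that the remaining ones act as parameters in the
  coefficients.\<close>

lemma var_ring_insert:
  assumes "p \<in> var_ring (insert v V)"
  shows "\<exists>P\<in>polys_over (var_ring V). poly P (mvar v) = p"
  using assms
proof (induction rule: var_ring.induct)
  case (const c)
  have "[:mconst c:] \<in> polys_over (var_ring V)"
    using subring_set_closed(2)[OF subring_set_var_ring] var_ring.const
    by (auto simp: polys_over_def coeff_pCons split: nat.split)
  then show ?case by force
next
  case (var i)
  note A = subring_set_closed(1,2)[OF subring_set_var_ring]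
  show ?case
  proof (cases "i = v")
    case True
    have "[:0, 1:] \<in> polys_over (var_ring V)"
      using A by (auto simp: polys_over_def coeff_pCons split: nat.split)
    then show ?thesis using True by force
  next
    case False
    then have "mvar i \<in> var_ring V" using var by (auto intro: var_ring.var)
    then have "[:mvar i:] \<in> polys_over (var_ring V)"
      using A by (auto simp: polys_over_def coeff_pCons split: nat.split)
    then show ?thesis by force
  qed
next
  case (diff p q)
  then obtain P Q where *: "P \<in> polys_over (var_ring V)" "Q \<in> polys_over (var_ring V)"
    "poly P (mvar v) = p" "poly Q (mvar v) = q" by blast
  then have "P - Q \<in> polys_over (var_ring V)" "poly (P - Q) (mvar v) = p - q"
    by (auto simp: polys_over_def intro: var_ring.diff)
  then show ?case by blast
next
  case (mult p q)
  then obtain P Q where *: "P \<in> polys_over (var_ring V)" "Q \<in> polys_over (var_ring V)"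
    "poly P (mvar v) = p" "poly Q (mvar v) = q" by blast
  then have "P * Q \<in> polys_over (var_ring V)" "poly (P * Q) (mvar v) = p * q"
    using polys_over_mult[OF subring_set_var_ring] by auto
  then show ?case by blast
qed

lemma mvar_power: "mvar i ^ k = to_mp (Poly_Mapping.single (Poly_Mapping.single i k) 1)"
proof (induction k)
  case 0
  then show ?case by (simp add: one_mp.abs_eq)
next
  case (Suc k)
  have "mvar i ^ Suc k = mvar i * to_mp (Poly_Mapping.single (Poly_Mapping.single i k) 1)"
    by (simp only: power_Suc Suc)
  then show ?case
    unfolding mvar.abs_eq times_mp.abs_eq mult_single by (simp add: single_add[symmetric])
qed

lemma var_ring_UNIV: "p \<in> var_ring UNIV"
proof -
  note sr = subring_set_var_ring[of "UNIV :: 'a set"]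
  have prod: "(\<Prod>i\<in>I. to_mp (Poly_Mapping.single (f i) 1)) = to_mp (Poly_Mapping.single (\<Sum>i\<in>I. f i) 1)"
    for f and I :: "'a set"
    by (induction I rule: infinite_finite_induct) (simp_all add: one_mp.abs_eq times_mp.abs_eq mult_single)
  have *: "to_mp (Poly_Mapping.single m c) \<in> var_ring UNIV" for m :: "'a \<Rightarrow>\<^sub>0 nat" and c
  proof -
    have "(\<Sum>i\<in>UNIV. Poly_Mapping.single i (Poly_Mapping.lookup m i)) = m"
      by (rule poly_mapping_eqI) (simp add: lookup_sum lookup_single when_def)
    then have "(\<Prod>i\<in>UNIV. mvar i ^ Poly_Mapping.lookup m i) = to_mp (Poly_Mapping.single m 1)"
      by (simp only: mvar_power prod)
    then have "to_mp (Poly_Mapping.single m c) = mconst c * (\<Prod>i\<in>UNIV. mvar i ^ Poly_Mapping.lookup m i)"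
      by (simp add: mconst.abs_eq times_mp.abs_eq const_poly_def mult_single)
    also have "\<dots> \<in> var_ring UNIV"
      by (intro var_ring.mult var_ring.const subring_set_prod[OF sr] subring_set_power[OF sr] var_ring.var) auto
    finally show ?thesis .
  qed
  have add: "to_mp (sum f S) = (\<Sum>i\<in>S. to_mp (f i))" for f :: "('a \<Rightarrow>\<^sub>0 nat) \<Rightarrow> 'a rpoly" and S
    by (induction S rule: infinite_finite_induct) (simp_all add: zero_mp.abs_eq plus_mp.abs_eq[symmetric])
  have "p = to_mp (of_mp p)" by (simp add: of_mp_inverse)
  also have "of_mp p = (\<Sum>m\<in>Poly_Mapping.keys (of_mp p).
      Poly_Mapping.single m (Poly_Mapping.lookup (of_mp p) m))"
    by (rule poly_mapping_sum_single[symmetric])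
  also have "to_mp \<dots> \<in> var_ring UNIV"
    unfolding add by (intro subring_set_sum[OF sr] *)
  finally show ?thesis .
qed

lemma meval_var_ring_cong:
  assumes "p \<in> var_ring V" "\<And>i. i \<in> V \<Longrightarrow> x $ i = y $ i"
  shows "meval p x = meval p y"
  using assms by (induction rule: var_ring.induct) auto

definition upd :: "real ^ 'd \<Rightarrow> 'd \<Rightarrow> real \<Rightarrow> real ^ 'd" where
  "upd x v t = (\<chi> i. if i = v then t else x $ i)"

text \<open>The coefficients do not involve \<open>v\<close>, so moving only this coordinate
  evaluates one fixed univariate real polynomial.\<close>

lemma meval_upd:
  assumes "P \<in> polys_over (var_ring V)" "v \<notin> V"
  shows "meval (poly P (mvar v)) (upd x v t) = ev (\<lambda>p. meval p x) P t"
proof -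
  have "map_poly (\<lambda>p. meval p (upd x v t)) P = map_poly (\<lambda>p. meval p x) P"
  proof (rule poly_eqI)
    fix n
    have "coeff P n \<in> var_ring V" using assms(1) by (simp add: polys_over_def)
    then have "meval (coeff P n) (upd x v t) = meval (coeff P n) x"
      by (rule meval_var_ring_cong) (use assms(2) in \<open>auto simp: upd_def\<close>)
    then show "coeff (map_poly (\<lambda>p. meval p (upd x v t)) P) n = coeff (map_poly (\<lambda>p. meval p x) P) n"
      by (simp add: coeff_map_poly)
  qed
  then show ?thesis
    using ev_hom(7)[OF cring_hom_meval[of "upd x v t"], of P "mvar v"] by (simp add: ev_def upd_def)
qed

text \<open>The coordinates are fixed one at a time: induction keeps the leading coefficients
  nonzero, and then only finitely many values of the new coordinate are excluded. Evaluation at such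
  points yields the integral domain property.\<close>

lemma nonvanishing_point:
  assumes "finite S" "0 \<notin> S"
  shows "\<exists>x. \<forall>p\<in>S. meval p x \<noteq> 0"
proof -
  have "\<exists>x. \<forall>p\<in>S. meval p x \<noteq> 0" if "finite S" "0 \<notin> S" "S \<subseteq> var_ring V" for S V
    using finite[of V] that
  proof (induction V arbitrary: S rule: finite_induct)
    case empty
    have "meval p 0 \<noteq> 0" if p: "p \<in> S" for p
    proof -
      obtain c where "p = mconst c" using var_ring_empty[of p] empty p by blast
      then show ?thesis using empty p by (cases "c = 0") (auto simp: mconst_hom)
    qed
    then show ?case by blast
  next
    case (insert v V)
    have "\<forall>p\<in>S. \<exists>Q. Q \<in> polys_over (var_ring V) \<and> poly Q (mvar v) = p"
      using var_ring_insert insert.prems(3) by blast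
    then obtain P where P: "\<And>p. p \<in> S \<Longrightarrow> P p \<in> polys_over (var_ring V) \<and> poly (P p) (mvar v) = p"
      by (auto dest!: bchoice)
    have P0: "P p \<noteq> 0" if "p \<in> S" for p using P[OF that] insert.prems(2) that by auto
    have "\<exists>x. \<forall>c\<in>(\<lambda>p. lead_coeff (P p)) ` S. meval c x \<noteq> 0"
      by (rule insert.IH) (use insert.prems P P0 in \<open>auto simp: polys_over_def\<close>)
    then obtain x where x: "\<And>p. p \<in> S \<Longrightarrow> meval (lead_coeff (P p)) x \<noteq> 0" by auto
    have "finite (\<Union>p\<in>S. {t. poly (map_poly (\<lambda>p. meval p x) (P p)) t = 0})"
    proof (intro finite_UN_I insert.prems poly_roots_finite notI)
      fix p assume p: "p \<in> S" "map_poly (\<lambda>p. meval p x) (P p) = 0"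
      then have "coeff (map_poly (\<lambda>p. meval p x) (P p)) (degree (P p)) = 0" by simp
      then show False using x[OF p(1)] by (simp add: coeff_map_poly)
    qed
    then obtain t where t: "t \<notin> (\<Union>p\<in>S. {t. poly (map_poly (\<lambda>p. meval p x) (P p)) t = 0})"
      using ex_new_if_finite[OF infinite_UNIV_char_0] by blast
    have "meval p (upd x v t) \<noteq> 0" if "p \<in> S" for p
      using meval_upd[of "P p" V v x t] P[OF that] insert.hyps(2) t that by (auto simp: ev_def)
    then show ?case by blast
  qed
  from this[of S UNIV] show ?thesis using assms var_ring_UNIV by blast
qed

instance mp :: (finite) idom
proof
  fix p q :: "'a mp" assume "p \<noteq> 0" "q \<noteq> 0"
  then obtain x where "meval p x \<noteq> 0" "meval q x \<noteq> 0" using nonvanishing_point[of "{p, q}"] by auto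
  then have "meval (p * q) x \<noteq> meval 0 x" by simp
  then show "p * q \<noteq> 0" by (rule contrapos_nn) (rule arg_cong)
qed

definition mp_ordering :: "'d::finite mp set \<Rightarrow> bool" where
  "mp_ordering P \<longleftrightarrow> pre_cone UNIV P \<and> (\<forall>x. x \<in> P \<or> - x \<in> P) \<and> (\<forall>x\<in>P. - x \<in> P \<longrightarrow> x = 0)"

definition mp_bad :: "'d::finite mp set \<Rightarrow> bool" where
  "mp_bad P \<longleftrightarrow> (\<exists>S. finite S \<and> S \<subseteq> P - {0} \<and> (\<forall>x. \<exists>g\<in>S. meval g x \<le> 0))"

lemma subring_set_UNIV: "subring_set UNIV"
  by (simp add: subring_set_def)

text \<open>The polynomials that are nonnegative everywhere form a cone to start from; it is proper
  because a nonzero polynomial does not vanish at every point.\<close>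

lemma mp_ordering_exists: "\<exists>P :: 'd::finite mp set. mp_ordering P"
proof -
  have "pre_cone UNIV {p :: 'd mp. \<forall>x. 0 \<le> meval p x}"
    unfolding pre_cone_def
  proof (intro conjI ballI impI)
    fix c :: "'d mp" assume "- (c * c) \<in> {p. \<forall>x. 0 \<le> meval p x}"
    then have c: "meval c x = 0" for x by (auto simp: mult_le_0_iff intro: antisym)
    show "c = 0" using nonvanishing_point[of "{c}"] c by auto
  qed auto
  then show ?thesis
  proof (rule pre_cone_ordering[OF subring_set_UNIV])
    fix P :: "'d mp set"
    assume "pre_cone UNIV P" "\<And>x. x \<in> UNIV \<Longrightarrow> x \<in> P \<or> - x \<in> P" "\<And>x. x \<in> P \<Longrightarrow> - x \<in> P \<Longrightarrow> x = 0"
    then have "mp_ordering P" by (simp add: mp_ordering_def)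
    then show ?thesis ..
  qed
qed

text \<open>
  The order of the type is chosen to be a counterexample to the Artin-Lang theorem, if there is
  one. This turns a statement about all orderings into one about a type class instance.
\<close>

definition mp_cone :: "'d::finite mp set" where
  "mp_cone = (SOME P. mp_ordering P \<and> ((\<exists>P' :: 'd mp set. mp_ordering P' \<and> mp_bad P') \<longrightarrow> mp_bad P))"

lemma mp_cone: "mp_ordering (mp_cone :: 'd::finite mp set)"
  "mp_ordering (P' :: 'd mp set) \<Longrightarrow> mp_bad P' \<Longrightarrow> mp_bad (mp_cone :: 'd mp set)"
proof -
  have "\<exists>P :: 'd mp set. mp_ordering P \<and> ((\<exists>P' :: 'd mp set. mp_ordering P' \<and> mp_bad P') \<longrightarrow> mp_bad P)"
    using mp_ordering_exists by blast
  then have *: "mp_ordering (mp_cone :: 'd mp set) \<and>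
      ((\<exists>P' :: 'd mp set. mp_ordering P' \<and> mp_bad P') \<longrightarrow> mp_bad (mp_cone :: 'd mp set))"
    unfolding mp_cone_def by (rule someI_ex)
  then show "mp_ordering (mp_cone :: 'd mp set)" by blast
  show "mp_ordering (P' :: 'd mp set) \<Longrightarrow> mp_bad P' \<Longrightarrow> mp_bad (mp_cone :: 'd mp set)"
    using * by blast
qed

lemma mp_cone_closed:
  fixes x y :: "'d::finite mp"
  shows "x \<in> mp_cone \<Longrightarrow> y \<in> mp_cone \<Longrightarrow> x + y \<in> mp_cone"
    "x \<in> mp_cone \<Longrightarrow> y \<in> mp_cone \<Longrightarrow> x * y \<in> mp_cone"
    "x * x \<in> mp_cone" "x \<in> mp_cone \<or> - x \<in> mp_cone" "x \<in> mp_cone \<Longrightarrow> - x \<in> mp_cone \<Longrightarrow> x = 0"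
proof -
  have *: "pre_cone UNIV (mp_cone :: 'd mp set)" "\<forall>x. x \<in> mp_cone \<or> - x \<in> (mp_cone :: 'd mp set)"
    "\<forall>x\<in>mp_cone. - x \<in> (mp_cone :: 'd mp set) \<longrightarrow> x = 0"
    using mp_cone(1)[where 'd = 'd] by (simp_all add: mp_ordering_def)
  show "x \<in> mp_cone \<Longrightarrow> y \<in> mp_cone \<Longrightarrow> x + y \<in> mp_cone"
    "x \<in> mp_cone \<Longrightarrow> y \<in> mp_cone \<Longrightarrow> x * y \<in> mp_cone" "x * x \<in> mp_cone"
    using *(1) by (simp_all add: pre_cone_def)
  show "x \<in> mp_cone \<or> - x \<in> mp_cone" using *(2) by (rule spec)
  show "x \<in> mp_cone \<Longrightarrow> - x \<in> mp_cone \<Longrightarrow> x = 0" using *(3) by simp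
qed

instantiation mp :: (finite) linordered_idom
begin

definition less_eq_mp :: "'a mp \<Rightarrow> 'a mp \<Rightarrow> bool" where "less_eq_mp x y \<longleftrightarrow> y - x \<in> mp_cone"
definition less_mp :: "'a mp \<Rightarrow> 'a mp \<Rightarrow> bool" where "less_mp x y \<longleftrightarrow> x \<le> y \<and> \<not> y \<le> x"
definition abs_mp :: "'a mp \<Rightarrow> 'a mp" where "abs_mp x = (if x < 0 then - x else x)"
definition sgn_mp :: "'a mp \<Rightarrow> 'a mp" where "sgn_mp x = (if x = 0 then 0 else if 0 < x then 1 else - 1)"

instance
proof
  fix a b c :: "'a mp"
  show "a < b \<longleftrightarrow> a \<le> b \<and> \<not> b \<le> a" by (rule less_mp_def)
  have "0 * 0 \<in> (mp_cone :: 'a mp set)" by (rule mp_cone_closed(3))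
  then show refl: "a \<le> a" by (simp add: less_eq_mp_def)
  show "a \<le> b \<Longrightarrow> b \<le> c \<Longrightarrow> a \<le> c"
    unfolding less_eq_mp_def using mp_cone_closed(1)[of "b - a" "c - b"] by simp
  have antisym: "x = y" if "x \<le> y" "y \<le> x" for x y :: "'a mp"
    using mp_cone_closed(5)[of "x - y"] that by (simp add: less_eq_mp_def)
  then show "a \<le> b \<Longrightarrow> b \<le> a \<Longrightarrow> a = b" by blast
  show "a \<le> b \<Longrightarrow> c + a \<le> c + b" by (simp add: less_eq_mp_def)
  show "a \<le> b \<or> b \<le> a" using mp_cone_closed(4)[of "b - a"] by (simp add: less_eq_mp_def)
  show "a < b \<Longrightarrow> 0 < c \<Longrightarrow> c * a < c * b"
  proof -
    assume ab: "a < b" and c: "0 < c"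
    have "c \<noteq> 0" "a \<noteq> b" using ab c refl by (auto simp: less_mp_def)
    have "c * (b - a) \<in> mp_cone"
      by (rule mp_cone_closed(2)) (use ab c in \<open>auto simp: less_mp_def less_eq_mp_def\<close>)
    then have "c * a \<le> c * b" by (simp add: less_eq_mp_def right_diff_distrib)
    moreover have "c * a \<noteq> c * b" using \<open>c \<noteq> 0\<close> \<open>a \<noteq> b\<close> by simp
    ultimately show ?thesis using antisym unfolding less_mp_def by blast
  qed
  show "\<bar>a\<bar> = (if a < 0 then - a else a)" by (rule abs_mp_def)
  show "sgn a = (if a = 0 then 0 else if 0 < a then 1 else - 1)" by (rule sgn_mp_def)
qed

end

section \<open>Transfer of signs from an ordering to a real point\<close>

definition mp_embed :: "'d::finite mp \<Rightarrow> 'd mp fract rclosure" where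
  "mp_embed p = to_rc (Fract p 1)"

lemma cring_hom_Fract: "cring_hom (\<lambda>p. Fract p (1 :: 'a::idom))"
proof
  show "Fract (x + y) 1 = Fract x 1 + Fract y 1" "Fract (x * y) 1 = Fract x 1 * Fract y 1" for x y :: 'a
    by simp_all
  show "Fract 1 1 = (1 :: 'a fract)" by (simp only: One_fract_def)
qed

lemma cring_hom_mp_embed: "cring_hom mp_embed"
  unfolding mp_embed_def[abs_def] by (rule cring_hom_comp[OF cring_hom_Fract cring_hom_to_rc])

lemma sg_mp_embed: "sg (mp_embed p) = sg p"
proof -
  interpret cring_hom mp_embed by (rule cring_hom_mp_embed)
  have nonneg: "0 \<le> mp_embed q" if "0 \<le> q" for q :: "'a mp"
    unfolding mp_embed_def by (rule to_rc_nonneg) (use that in \<open>simp add: zero_le_Fract_iff\<close>)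
  have "mp_embed q \<noteq> 0" if "q \<noteq> 0" for q :: "'a mp"
  proof
    assume 0: "mp_embed q = 0"
    have "Fract q 1 * Fract 1 q = Fract 1 1" using that by (simp add: eq_fract)
    then have "Fract q 1 * Fract 1 q = 1" by (simp only: One_fract_def)
    then have "to_rc (Fract q 1) * to_rc (Fract 1 q) = 1"
      by (metis cring_hom.hom_mult cring_hom.hom_1 cring_hom_to_rc)
    then show False using 0 by (simp add: mp_embed_def)
  qed
  then have pos: "0 < mp_embed q" if "0 < q" for q :: "'a mp"
    using nonneg[of q] that by (simp add: le_less)
  show ?thesis
    using pos[of p] pos[of "- p"] by (cases p "0 :: 'a mp" rule: linorder_cases) (auto simp: sg_def hom_uminus)
qed

text \<open>Positive real constants are squares, so the ordering has no choice on constants; this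
  starts the induction over the variables.\<close>

lemma sg_mconst: "sg (mconst c :: 'd::finite mp) = sg c"
proof -
  have pos: "0 < (mconst c :: 'd mp)" if "0 < c" for c
  proof -
    have "mconst c = mconst (sqrt c) * (mconst (sqrt c) :: 'd mp)"
      using that by (simp add: mconst_hom(3)[symmetric])
    then have "0 \<le> (mconst c :: 'd mp)" by (simp only: zero_le_square)
    moreover have "mconst c \<noteq> (0 :: 'd mp)"
    proof
      assume "mconst c = (0 :: 'd mp)"
      then have "meval (mconst c :: 'd mp) 0 = 0" by simp
      then show False using that by simp
    qed
    ultimately show ?thesis by simp
  qed
  have "mconst (- 1) = (- 1 :: 'd mp)"
    by transfer (simp add: const_poly_def single_uminus)
  then have "mconst (- c) = - (mconst c :: 'd mp)" using mconst_hom(3)[of "- 1" c] by (metis mult_minus1)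
  then show ?thesis
    using pos[of c] pos[of "- c"] by (cases c "0 :: real" rule: linorder_cases) (auto simp: sg_def mconst_hom)
qed

text \<open>Each polynomial is written as a univariate one, evaluated at \<open>mvar v\<close>. By
  induction some real point \<open>x\<close> gives the leading coefficients of an elimination-closed
  family their signs under the ordering. The lines over the real closure and over the reals then
  have the same diagram, and a real partner \<open>t\<close> of the image of \<open>mvar v\<close>
  completes \<open>x\<close> to the desired point.\<close>

lemma sign_realization:
  assumes "finite S" "S \<subseteq> var_ring V"
  shows "\<exists>x. \<forall>p\<in>S. sg (meval p x) = sg p"
  using finite[of V] assms
proof (induction V arbitrary: S rule: finite_induct)
  case empty
  have "sg (meval p 0) = sg p" if p: "p \<in> S" for p
  proof -
    obtain c where "p = mconst c" using var_ring_empty[of p] empty p by blast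
    then show ?thesis by (simp add: sg_mconst)
  qed
  then show ?case by blast
next
  case (insert v V)
  let ?h = "mp_embed :: 'a mp \<Rightarrow> _"
  have "\<forall>p\<in>S. \<exists>Q. Q \<in> polys_over (var_ring V) \<and> poly Q (mvar v) = p"
    using var_ring_insert insert.prems(2) by blast
  then obtain P where P: "\<And>p. p \<in> S \<Longrightarrow> P p \<in> polys_over (var_ring V) \<and> poly (P p) (mvar v) = p"
    by (auto dest!: bchoice)
  define S' where "S' = P ` S - {0}"
  have "finite S'" "S' \<subseteq> polys_over (var_ring V)" "0 \<notin> S'"
    using insert.prems P by (auto simp: S'_def)
  then obtain \<Phi> where \<Phi>: "S' \<subseteq> \<Phi>" "finite \<Phi>" "\<Phi> \<subseteq> polys_over (var_ring V)" "0 \<notin> \<Phi>" "elim_closed \<Phi>"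
    using elim_closed_superset[OF subring_set_var_ring] by metis
  have "lead_coeff ` \<Phi> \<subseteq> var_ring V" using \<Phi>(3) by (auto simp: polys_over_def)
  then obtain x where x: "\<And>g. g \<in> \<Phi> \<Longrightarrow> sg (meval (lead_coeff g) x) = sg (lead_coeff g)"
    using insert.IH[of "lead_coeff ` \<Phi>"] \<Phi>(2) by auto
  let ?k = "\<lambda>p. meval p x"
  have "same_diagram ?h ?k \<Phi>"
  proof (rule same_diagram_elim_closed[OF cring_hom_mp_embed cring_hom_meval \<Phi>(2,5)])
    fix g assume g: "g \<in> \<Phi>"
    then have "sg (lead_coeff g) \<noteq> 0" using \<Phi>(4) by auto
    then have "?h (lead_coeff g) \<noteq> 0" using sg_mp_embed[of "lead_coeff g"] by (metis sg_simps(1))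
    then show "?h (lead_coeff g) \<noteq> 0 \<and> sg (?h (lead_coeff g)) = sg (?k (lead_coeff g))"
      using x[OF g] by (simp add: sg_mp_embed)
  qed
  then obtain t where t: "same_signs ?h ?k \<Phi> (?h (mvar v)) t"
    unfolding same_diagram_def by blast
  have "sg (meval p (upd x v t)) = sg p" if p: "p \<in> S" for p
  proof (cases "P p = 0")
    case True
    then show ?thesis using P[OF p] by auto
  next
    case False
    then have "P p \<in> \<Phi>" using p \<Phi>(1) by (auto simp: S'_def)
    then have "sg (ev ?k (P p) t) = sg (ev ?h (P p) (?h (mvar v)))"
      using t by (simp add: same_signs_def)
    also have "ev ?h (P p) (?h (mvar v)) = ?h p"
      using ev_hom(7)[OF cring_hom_mp_embed, of "P p" "mvar v"] P[OF p] by simp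
    finally show ?thesis
      using meval_upd[of "P p" V v x t] P[OF p] insert.hyps(2) by (simp add: sg_mp_embed)
  qed
  then show ?case by blast
qed

text \<open>\<open>sign_realization\<close> concerns the order of the type alone. By the choice of
  \<open>mp_cone\<close>, an ordering that violated the claim would make this order violate it
  too.\<close>

theorem artin_lang:
  fixes P :: "'d::finite mp set"
  assumes "mp_ordering P" "finite S" "S \<subseteq> P - {0}"
  shows "\<exists>x. \<forall>g\<in>S. 0 < meval g x"
proof (rule ccontr)
  assume n: "\<not> ?thesis"
  then have "mp_bad P" using assms(2,3) unfolding mp_bad_def by (meson not_less)
  then have "mp_bad (mp_cone :: 'd mp set)" using mp_cone(2) assms(1) by blast
  then obtain S where S: "finite S" "S \<subseteq> (mp_cone :: 'd mp set) - {0}" "\<And>x. \<exists>g\<in>S. meval g x \<le> 0"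
    unfolding mp_bad_def by blast
  have pos: "0 < g" if "g \<in> S" for g
  proof -
    have "0 \<le> g" "g \<noteq> 0" using S(2) that by (auto simp: less_eq_mp_def)
    then show ?thesis by simp
  qed
  obtain x where x: "\<And>g. g \<in> S \<Longrightarrow> sg (meval g x) = sg g"
    using sign_realization[OF S(1), of UNIV] var_ring_UNIV by blast
  obtain g where g: "g \<in> S" "meval g x \<le> 0" using S(3) by blast
  then show False using x[OF g(1)] pos[OF g(1)] sg_eq_iff(1) by fastforce
qed

section \<open>Symmetric matrices\<close>

text \<open>Forms and vectors are plain functions because the reduction builds them by entrywise
  formulas, and ring homomorphisms are later applied to them entrywise.\<close>

definition bil :: "('n::finite \<Rightarrow> 'n \<Rightarrow> 'a::comm_ring_1) \<Rightarrow> ('n \<Rightarrow> 'a) \<Rightarrow> ('n \<Rightarrow> 'a) \<Rightarrow> 'a" where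
  "bil F u v = (\<Sum>i\<in>UNIV. \<Sum>j\<in>UNIV. u i * F i j * v j)"

lemma bil_simps:
  "bil F (\<lambda>k. u k + u' k) v = bil F u v + bil F u' v"
  "bil F (\<lambda>k. u k - u' k) v = bil F u v - bil F u' v"
  "bil F (\<lambda>k. a * u k) v = a * bil F u v"
  "bil F u (\<lambda>k. v k + v' k) = bil F u v + bil F u v'"
  "bil F u (\<lambda>k. v k - v' k) = bil F u v - bil F u v'"
  "bil F u (\<lambda>k. a * v k) = a * bil F u v"
  by (simp_all add: bil_def algebra_simps sum.distrib sum_subtractf sum_distrib_left)

lemma bil_forms:
  "bil (\<lambda>k l. F k l - G k l) u v = bil F u v - bil G u v"
  "bil (\<lambda>k l. F k l + G k l) u v = bil F u v + bil G u v"
  "bil (\<lambda>k l. a * F k l) u v = a * bil F u v"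
  by (simp_all add: bil_def algebra_simps sum.distrib sum_subtractf sum_distrib_left)

lemma bil_rank_one: "bil (\<lambda>k l. p k * q l) u v = (\<Sum>k\<in>UNIV. p k * u k) * (\<Sum>k\<in>UNIV. q k * v k)"
  by (simp add: bil_def sum_product mult_ac)

definition unitv :: "'n \<Rightarrow> 'n \<Rightarrow> 'a::zero_neq_one" where
  "unitv i k = (if k = i then 1 else 0)"

lemma bil_unitv:
  "bil F (unitv i) v = (\<Sum>j\<in>UNIV. F i j * v j)" "bil F u (unitv j) = (\<Sum>i\<in>UNIV. F i j * u i)"
proof -
  have "(\<Sum>l\<in>UNIV. unitv i k * F k l * v l) = (if k = i then \<Sum>l\<in>UNIV. F k l * v l else 0)" for k
    by (simp add: unitv_def)
  then show "bil F (unitv i) v = (\<Sum>j\<in>UNIV. F i j * v j)" by (simp add: bil_def)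
  have "(\<Sum>l\<in>UNIV. u k * F k l * unitv j l) = u k * F k j" for k
    by (simp add: unitv_def if_distrib[of "\<lambda>x. _ * x"] cong: if_cong)
  then show "bil F u (unitv j) = (\<Sum>i\<in>UNIV. F i j * u i)" by (simp add: bil_def mult.commute)
qed

lemma sum_unitv: "(\<Sum>k\<in>UNIV. F k * unitv i k) = (F i :: 'a::comm_ring_1)" for i :: "'n::finite"
  by (simp add: unitv_def if_distrib[of "\<lambda>x. _ * x"] cong: if_cong)

text \<open>
  Lagrange's reduction without division. The vectors \<open>u\<close> express the diagonal entries as values
  of the form itself, the vectors \<open>w\<close> express the form through these entries.
\<close>

lemma lagrange_reduction:
  fixes F :: "'n::finite \<Rightarrow> 'n \<Rightarrow> 'a::{idom,ring_char_0}"
  assumes "finite I" "\<And>i j. F i j = F j i" "\<And>i j. i \<notin> I \<Longrightarrow> F i j = 0"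
  shows "\<exists>b xs. b \<noteq> 0 \<and> (\<forall>k l. b\<^sup>2 * F k l = (\<Sum>(u, w)\<leftarrow>xs. bil F u u * w k * w l))"
  using assms
proof (induction I arbitrary: F rule: finite_psubset_induct)
  case (psubset I)
  note symF = psubset.prems(1)
  consider "\<And>i j. F i j = 0" | i where "F i i \<noteq> 0" |
    i j where "F i i = 0" "F j j = 0" "F i j \<noteq> 0" by metis
  then show ?case
  proof cases
    case 1
    then show ?thesis by (intro exI[of _ 1] exI[of _ "[]"]) simp
  next
    case (2 i)
    define a where "a = F i i"
    \<comment> \<open>\<open>F2\<close> is \<open>a\<close> times what remains of
      \<open>a * F\<close> after the product of column \<open>i\<close> with its transpose is
      subtracted. The extra factor \<open>a\<close> makes it the pullback of \<open>F\<close> along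
      \<open>S\<close>, so its values are values of \<open>F\<close>; row and column
      \<open>i\<close> vanish.\<close>
    define F2 where "F2 k l = a * (a * F k l) - a * (F k i * F l i)" for k l
    define S where "S u k = a * u k - (\<Sum>l\<in>UNIV. F l i * u l) * unitv i k" for u k
    have iI: "i \<in> I" using 2 psubset.prems(2) by blast
    have "\<exists>b xs. b \<noteq> 0 \<and> (\<forall>k l. b\<^sup>2 * F2 k l = (\<Sum>(u, w)\<leftarrow>xs. bil F2 u u * w k * w l))"
    proof (rule psubset.IH[of "I - {i}"])
      show "F2 k l = F2 l k" for k l using symF[of k l] by (simp add: F2_def mult.commute)
      show "F2 k l = 0" if "k \<notin> I - {i}" for k l
      proof (cases "k = i")
        case True
        then show ?thesis using symF[of i l] by (simp add: F2_def a_def)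
      next
        case False
        then show ?thesis using that psubset.prems(2) by (simp add: F2_def)
      qed
    qed (use iI in auto)
    then obtain b xs where b: "b \<noteq> 0"
      "\<And>k l. b\<^sup>2 * F2 k l = (\<Sum>(u, w)\<leftarrow>xs. bil F2 u u * w k * w l)" by blast
    have bS: "bil F2 u u = bil F (S u) (S u)" for u
    proof -
      define c where "c = (\<Sum>l\<in>UNIV. F l i * u l)"
      have "bil F (unitv i) u = c" unfolding bil_unitv c_def by (intro sum.cong refl) (metis symF)
      moreover have "bil F u (unitv i) = c" "bil F (unitv i) (unitv i) = a"
        by (simp_all add: bil_unitv sum_unitv c_def a_def)
      ultimately have c: "bil F (unitv i) u = c" "bil F u (unitv i) = c" "bil F (unitv i) (unitv i) = a"
        by simp_all
      have "bil F2 u u = a * (a * bil F u u) - a * (c * c)"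
        unfolding F2_def[abs_def] bil_forms bil_rank_one c_def ..
      moreover have "bil F (S u) (S u) = a * (a * bil F u u) - a * (c * c)"
        unfolding S_def[abs_def] c_def[symmetric] bil_simps c by (simp add: algebra_simps)
      ultimately show ?thesis by simp
    qed
    define ys where "ys = (unitv i, \<lambda>k. b * F k i) # map (\<lambda>(u, w). (S u, w)) xs"
    have ys: "(b * a)\<^sup>2 * F k l = (\<Sum>(u, w)\<leftarrow>ys. bil F u u * w k * w l)" for k l
    proof -
      have "(\<Sum>(u, w)\<leftarrow>ys. bil F u u * w k * w l) =
          a * (b * F k i) * (b * F l i) + (\<Sum>(u, w)\<leftarrow>xs. bil F2 u u * w k * w l)"
        by (simp add: ys_def bil_unitv sum_unitv a_def bS comp_def case_prod_unfold)
      also have "\<dots> = (b * a)\<^sup>2 * F k l"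
        unfolding b(2)[symmetric] by (simp add: F2_def algebra_simps power2_eq_square)
      finally show ?thesis by (rule sym)
    qed
    have nz: "b * a \<noteq> 0" using b(1) 2 by (simp add: a_def)
    show ?thesis by (intro exI conjI allI, rule nz, rule ys)
  next
    case (3 i j)
    define c where "c = F i j"
    \<comment> \<open>With zero diagonal entries at \<open>i\<close> and \<open>j\<close>, the
      weights are the values \<open>2 * c\<close> and \<open>- 2 * c\<close> of the form at the sum
      and the difference of the two unit vectors. \<open>S\<close> is \<open>2 * c\<close> times the
      projection onto the orthogonal complement of their plane, and the factor 4 is what the
      difference of the two weighted squares produces.\<close>
    define F2 where "F2 k l = 4 * (c * (c * F k l)) - 4 * (c * (F k i * F l j + F k j * F l i))" for k l
    define S where "S u k = 2 * c * u k - (2 * (\<Sum>l\<in>UNIV. F l j * u l) * unitv i k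
      + 2 * (\<Sum>l\<in>UNIV. F l i * u l) * unitv j k)" for u k
    have iI: "i \<in> I" using 3 psubset.prems(2) by blast
    have "\<exists>b xs. b \<noteq> 0 \<and> (\<forall>k l. b\<^sup>2 * F2 k l = (\<Sum>(u, w)\<leftarrow>xs. bil F2 u u * w k * w l))"
    proof (rule psubset.IH[of "I - {i}"])
      show "F2 k l = F2 l k" for k l using symF[of k l] by (simp add: F2_def algebra_simps)
      show "F2 k l = 0" if "k \<notin> I - {i}" for k l
      proof (cases "k = i")
        case True
        then show ?thesis using symF[of i l] 3 by (simp add: F2_def c_def)
      next
        case False
        then show ?thesis using that psubset.prems(2) by (simp add: F2_def)
      qed
    qed (use iI in auto)
    then obtain b xs where b: "b \<noteq> 0"
      "\<And>k l. b\<^sup>2 * F2 k l = (\<Sum>(u, w)\<leftarrow>xs. bil F2 u u * w k * w l)" by blast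
    have cc: "F i i = 0" "F j j = 0" "F i j = c" "F j i = c"
      using 3 symF[of j i] by (auto simp: c_def)
    have e: "bil F (unitv i) (unitv i) = 0" "bil F (unitv j) (unitv j) = 0"
      "bil F (unitv i) (unitv j) = c" "bil F (unitv j) (unitv i) = c"
      unfolding bil_unitv sum_unitv cc by simp_all
    have bS: "bil F2 u u = bil F (S u) (S u)" for u
    proof -
      define \<alpha> where "\<alpha> = (\<Sum>l\<in>UNIV. F l i * u l)"
      define \<beta> where "\<beta> = (\<Sum>l\<in>UNIV. F l j * u l)"
      have "bil F (unitv i) u = \<alpha>" "bil F (unitv j) u = \<beta>"
        unfolding bil_unitv \<alpha>_def \<beta>_def by (intro sum.cong refl; metis symF)+
      moreover have "bil F u (unitv i) = \<alpha>" "bil F u (unitv j) = \<beta>"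
        by (simp_all add: bil_unitv \<alpha>_def \<beta>_def)
      ultimately have c: "bil F (unitv i) u = \<alpha>" "bil F u (unitv i) = \<alpha>"
        "bil F (unitv j) u = \<beta>" "bil F u (unitv j) = \<beta>" by simp_all
      have "bil F2 u u = 4 * (c * (c * bil F u u)) - 4 * (c * (\<alpha> * \<beta> + \<beta> * \<alpha>))"
        unfolding F2_def[abs_def] bil_forms bil_rank_one \<alpha>_def \<beta>_def ..
      moreover have "bil F (S u) (S u) = 4 * (c * (c * bil F u u)) - 4 * (c * (\<alpha> * \<beta> + \<beta> * \<alpha>))"
        unfolding S_def[abs_def] \<alpha>_def[symmetric] \<beta>_def[symmetric] bil_simps c e
        by (simp add: algebra_simps)
      ultimately show ?thesis by simp
    qed
    define ys where "ys = (\<lambda>k. unitv i k + unitv j k, \<lambda>k. b * (F k i + F k j)) #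
      (\<lambda>k. unitv i k - unitv j k, \<lambda>k. b * (F k i - F k j)) # map (\<lambda>(u, w). (S u, w)) xs"
    have ys: "(b * (2 * c))\<^sup>2 * F k l = (\<Sum>(u, w)\<leftarrow>ys. bil F u u * w k * w l)" for k l
    proof -
      have "(\<Sum>(u, w)\<leftarrow>ys. bil F u u * w k * w l) =
          (2 * c) * (b * (F k i + F k j)) * (b * (F l i + F l j)) -
          (2 * c) * (b * (F k i - F k j)) * (b * (F l i - F l j)) +
          (\<Sum>(u, w)\<leftarrow>xs. bil F2 u u * w k * w l)"
        by (simp add: ys_def bil_simps e bS comp_def case_prod_unfold)
      also have "\<dots> = (b * (2 * c))\<^sup>2 * F k l"
        unfolding b(2)[symmetric] by (simp add: F2_def algebra_simps power2_eq_square)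
      finally show ?thesis by (rule sym)
    qed
    have nz: "b * (2 * c) \<noteq> 0" using b(1) 3 by (simp add: c_def)
    show ?thesis by (intro exI conjI allI, rule nz, rule ys)
  qed
qed

section \<open>Scalar matrices in a matrix preordering\<close>

lemma preordering_closed:
  fixes T :: "'a::comm_ring_1 set"
  assumes "preordering T"
  shows "a \<in> T \<Longrightarrow> b \<in> T \<Longrightarrow> a + b \<in> T" "a \<in> T \<Longrightarrow> b \<in> T \<Longrightarrow> a * b \<in> T" "a ^ 2 \<in> T"
  using assms by (simp_all add: preordering_def)

lemma mat_add: "mat (a + b) = mat a + (mat b :: 'a::comm_ring_1 ^ 'n ^ 'n)"
  by (simp add: mat_def vec_eq_iff)

lemma mat_mult_left_nth: "(mat a ** B) $ i $ j = a * B $ i $ j" for B :: "'a::comm_ring_1 ^ 'n ^ 'n"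
  by (simp add: matrix_matrix_mult_def mat_def if_distrib[of "\<lambda>x. x * _"] cong: if_cong)

lemma mat_mult_right_nth: "(B ** mat a) $ i $ j = B $ i $ j * a" for B :: "'a::comm_ring_1 ^ 'n ^ 'n"
  by (simp add: matrix_matrix_mult_def mat_def if_distrib[of "\<lambda>x. _ * x"] cong: if_cong)

lemma mat_commute: "mat a ** B = B ** mat a" for B :: "'a::comm_ring_1 ^ 'n ^ 'n"
  by (simp add: vec_eq_iff mat_mult_left_nth mat_mult_right_nth mult.commute)

context
  fixes M :: "('a::comm_ring_1 ^ 'n ^ 'n) set"
  assumes M: "mat_preordering M"
begin

lemma mat_preordering_add: "B \<in> M \<Longrightarrow> C \<in> M \<Longrightarrow> B + C \<in> M"
  using M by (simp add: mat_preordering_def mat_quadratic_module_def)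

lemma mat_preordering_congruence: "B \<in> M \<Longrightarrow> transpose A ** B ** A \<in> M"
  using M by (simp add: mat_preordering_def mat_quadratic_module_def)

lemma mat_preordering_0: "0 \<in> M"
proof -
  have "mat 1 \<in> M" using M by (simp add: mat_preordering_def mat_quadratic_module_def)
  from mat_preordering_congruence[OF this, of 0] show ?thesis by (simp add: matrix_matrix_mult_def zero_vec_def)
qed

lemma mat_preordering_sum: "(\<And>i. i \<in> I \<Longrightarrow> f i \<in> M) \<Longrightarrow> sum f I \<in> M"
  by (induction I rule: infinite_finite_induct) (auto simp: mat_preordering_0 mat_preordering_add)

text \<open>Makes the minimality of the generated scalar preordering applicable. Products come from
  the clause on scalar matrices, squares from congruences of the identity.\<close>

lemma preordering_scalars: "preordering {p. mat p \<in> M}"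
  unfolding preordering_def
proof (intro conjI ballI allI)
  fix a b assume ab: "a \<in> {p. mat p \<in> M}" "b \<in> {p. mat p \<in> M}"
  then show "a + b \<in> {p. mat p \<in> M}" by (simp add: mat_add mat_preordering_add)
  have "mat a ** mat b \<in> M" using M ab by (auto simp: mat_preordering_def)
  then show "a * b \<in> {p. mat p \<in> M}" by (simp add: mat_mult_mat)
next
  fix a :: 'a
  have "mat 1 \<in> M" using M by (simp add: mat_preordering_def mat_quadratic_module_def)
  from mat_preordering_congruence[OF this, of "mat a"] show "a\<^sup>2 \<in> {p. mat p \<in> M}"
    by (simp add: mat_mult_mat transpose_mat power2_eq_square)
qed

text \<open>With \<open>u\<close> as column \<open>i\<close> of the otherwise zero matrix
  \<open>E i\<close>, the congruence by \<open>E i\<close> leaves just the value of the form, at the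
  diagonal position \<open>i\<close>; summing over \<open>i\<close> fills the diagonal.\<close>

lemma value_in_scalars:
  assumes "A \<in> M"
  shows "mat (bil (\<lambda>i j. A $ i $ j) u u) \<in> M"
proof -
  define E where "E i = (\<chi> k l. if l = i then u k else 0)" for i :: 'n
  have "(transpose (E i) ** A ** E i) $ k $ l =
      (if k = i \<and> l = i then bil (\<lambda>i j. A $ i $ j) u u else 0)" for i k l
  proof (cases "k = i \<and> l = i")
    case True
    have "(transpose (E i) ** A ** E i) $ i $ i = (\<Sum>j\<in>UNIV. (\<Sum>k\<in>UNIV. u k * A $ k $ j) * u j)"
      by (simp add: matrix_matrix_mult_def transpose_def E_def)
    also have "\<dots> = (\<Sum>j\<in>UNIV. \<Sum>k\<in>UNIV. u k * A $ k $ j * u j)" by (simp add: sum_distrib_right)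
    also have "\<dots> = bil (\<lambda>i j. A $ i $ j) u u" unfolding bil_def by (rule sum.swap)
    finally show ?thesis using True by simp
  qed (auto simp: matrix_matrix_mult_def transpose_def E_def)
  then have "mat (bil (\<lambda>i j. A $ i $ j) u u) = (\<Sum>i\<in>UNIV. transpose (E i) ** A ** E i)"
    by (simp add: vec_eq_iff mat_def if_distrib[of "\<lambda>x. _"] sum.delta conj_commute cong: if_cong)
      (auto simp: sum.neutral)
  also have "\<dots> \<in> M" using assms by (intro mat_preordering_sum mat_preordering_congruence)
  finally show ?thesis .
qed

text \<open>Scalar matrices commute with all others, so each weighted square is a congruence of the
  scalar matrix of its weight.\<close>

lemma weighted_squares_subset:
  assumes "\<And>p. p \<in> T \<Longrightarrow> mat p \<in> M"
  shows "weighted_squares T \<subseteq> M"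
proof
  fix B assume "B \<in> (weighted_squares T :: ('a ^ 'n ^ 'n) set)"
  then obtain k m and A :: "nat \<Rightarrow> 'a ^ 'n ^ 'n"
    where B: "B = (\<Sum>i<k. mat (m i) ** (transpose (A i) ** A i))" "\<forall>i<k. m i \<in> T"
    unfolding weighted_squares_def by blast
  have "mat (m i) ** (transpose (A i) ** A i) = transpose (A i) ** mat (m i) ** A i" for i
    by (simp only: matrix_mul_assoc mat_commute)
  then show "B \<in> M"
    unfolding B(1) using B(2) assms by (auto intro!: mat_preordering_sum mat_preordering_congruence)
qed

end

section \<open>Certificates\<close>

text \<open>The failure of all multiples \<open>c\<^sup>2 * f\<close> is what allows
  \<open>- f\<close> to be adjoined to \<open>T\<close> and the result to be extended to an ordering
  for Artin-Lang. The squares of \<open>D\<close> join the sign conditions to keep the point off the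
  zeros of \<open>D\<close>.\<close>

lemma generic_positivstellensatz_mp:
  fixes T :: "'d::finite mp set"
  assumes T: "preordering T" and f: "\<And>c. c \<noteq> 0 \<Longrightarrow> c\<^sup>2 * f \<notin> T"
    and G: "finite G" "G \<subseteq> T" and D: "finite D" "0 \<notin> D"
  shows "\<exists>x. (\<forall>g\<in>G. 0 \<le> meval g x) \<and> meval f x < 0 \<and> (\<forall>d\<in>D. meval d x \<noteq> 0)"
proof -
  note T' = preordering_closed[OF T]
  have 01: "0 \<in> T" "1 \<in> T" using T'(3)[of 0] T'(3)[of 1] by simp_all
  have "pre_cone UNIV T"
    unfolding pre_cone_def
  proof (intro conjI ballI impI)
    fix c :: "'d mp" assume c: "- (c * c) \<in> T"
    show "c = 0"
    proof (rule ccontr)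
      assume "c \<noteq> 0"
      \<comment> \<open>Since \<open>4 * f\<close> is a difference of two squares, the negative of a
        nonzero square in \<open>T\<close> would yield a forbidden multiple of
        \<open>f\<close>.\<close>
      have "(2 * c)\<^sup>2 * f = c\<^sup>2 * (f + 1)\<^sup>2 + - (c * c) * (f - 1)\<^sup>2"
        by (simp add: power2_eq_square algebra_simps)
      also have "\<dots> \<in> T" using c by (intro T')
      finally show False using f[of "2 * c"] \<open>c \<noteq> 0\<close> by simp
    qed
  qed (use T' in \<open>auto simp: power2_eq_square[symmetric]\<close>)
  then have pre: "pre_cone UNIV {s + (- f) * t | s t. s \<in> T \<and> t \<in> T}"
  proof (rule pre_cone_extend[OF subring_set_UNIV])
    fix s t c assume st: "s \<in> T" "t \<in> T" "- (c * c) = s + - f * t"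
    show "c = 0"
    proof (cases "t = 0")
      case True
      then show ?thesis using st \<open>pre_cone UNIV T\<close> by (simp add: pre_cone_def)
    next
      case False
      \<comment> \<open>The relation puts \<open>f * t\<close> into \<open>T\<close>; one more
        factor \<open>t\<close> turns it into a square multiple of \<open>f\<close>.\<close>
      have "f * t = c\<^sup>2 + s" using st(3) by (simp add: power2_eq_square algebra_simps)
      then have "t\<^sup>2 * f = t * (c\<^sup>2 + s)" by (simp add: power2_eq_square mult_ac)
      also have "\<dots> \<in> T" using st by (intro T')
      finally show ?thesis using f[OF False] by blast
    qed
  qed simp
  obtain P where P: "pre_cone UNIV P" "{s + (- f) * t | s t. s \<in> T \<and> t \<in> T} \<subseteq> P"
    "\<And>x. x \<in> P \<or> - x \<in> P" "\<And>x. x \<in> P \<Longrightarrow> - x \<in> P \<Longrightarrow> x = 0"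
    by (rule pre_cone_ordering[OF subring_set_UNIV pre]) auto
  have ord: "mp_ordering P" using P(1,3,4) by (simp add: mp_ordering_def)
  have TP: "s \<in> P" if "s \<in> T" for s
  proof (rule subsetD[OF P(2)])
    show "s \<in> {s + (- f) * t | s t. s \<in> T \<and> t \<in> T}"
      using that 01 by (intro CollectI exI[of _ s] exI[of _ 0]) auto
  qed
  have "- f \<in> P"
  proof (rule subsetD[OF P(2)])
    show "- f \<in> {s + (- f) * t | s t. s \<in> T \<and> t \<in> T}"
      using 01 by (intro CollectI exI[of _ 0] exI[of _ 1]) auto
  qed
  have "f \<noteq> 0" using f[of 1] 01 by auto
  \<comment> \<open>Zero generators are dropped because the signs realised are strict.\<close>
  define S where "S = insert (- f) (G - {0} \<union> (\<lambda>d. d\<^sup>2) ` D)"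
  have "finite S" using G D by (simp add: S_def)
  moreover have "S \<subseteq> P - {0}"
    using G(2) D(2) TP \<open>- f \<in> P\<close> \<open>f \<noteq> 0\<close> T'(3) by (auto simp: S_def)
  ultimately have "\<exists>x. \<forall>g\<in>S. 0 < meval g x" by (rule artin_lang[OF ord])
  then obtain x where x: "\<And>g. g \<in> S \<Longrightarrow> 0 < meval g x" by blast
  have "0 \<le> meval g x" if "g \<in> G" for g
    using x[of g] that by (cases "g = 0") (auto simp: S_def)
  moreover have "meval f x < 0" using x[of "- f"] by (simp add: S_def)
  moreover have "meval d x \<noteq> 0" if "d \<in> D" for d
    using x[of "d\<^sup>2"] that by (auto simp: S_def power2_eq_square)
  ultimately show ?thesis by blast
qed

lemma cring_hom_of_mp: "cring_hom of_mp"
  by standard (simp_all add: plus_mp.rep_eq times_mp.rep_eq one_mp.rep_eq)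

lemma cring_hom_to_mp: "cring_hom to_mp"
  by standard (simp_all add: plus_mp.abs_eq times_mp.abs_eq one_mp.abs_eq)

lemma to_mp_simps [simp]: "to_mp p = 0 \<longleftrightarrow> p = 0" "of_mp q = 0 \<longleftrightarrow> q = 0"
  "of_mp (to_mp p) = p" "to_mp (of_mp q) = q"
  by (simp_all add: zero_mp.abs_eq to_mp_inject to_mp_inverse of_mp_inverse)
    (metis of_mp_inject zero_mp.rep_eq zero_mp.abs_eq)

lemma rpoly_mult_nonzero:
  fixes p q :: "'d::finite rpoly"
  assumes "p \<noteq> 0" "q \<noteq> 0"
  shows "p * q \<noteq> 0"
proof -
  have "to_mp p * to_mp q \<noteq> 0" using assms by simp
  then show ?thesis using cring_hom.hom_mult[OF cring_hom_to_mp, of p q] by (metis to_mp_simps(1))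
qed

lemma generic_positivstellensatz:
  fixes T :: "'d::finite rpoly set"
  assumes T: "preordering T" and f: "\<And>c. c \<noteq> 0 \<Longrightarrow> c\<^sup>2 * f \<notin> T"
    and G: "finite G" "G \<subseteq> T" and D: "finite D" "0 \<notin> D"
  shows "\<exists>x. (\<forall>g\<in>G. 0 \<le> poly_eval g x) \<and> poly_eval f x < 0 \<and> (\<forall>d\<in>D. poly_eval d x \<noteq> 0)"
proof -
  interpret to_mp: cring_hom "to_mp :: 'd rpoly \<Rightarrow> _" by (rule cring_hom_to_mp)
  have "\<exists>x. (\<forall>g\<in>to_mp ` G. 0 \<le> meval g x) \<and> meval (to_mp f) x < 0 \<and> (\<forall>d\<in>to_mp ` D. meval d x \<noteq> 0)"
  proof (rule generic_positivstellensatz_mp[where T = "to_mp ` T"])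
    show "preordering (to_mp ` T)"
      unfolding preordering_def
    proof (intro conjI ballI allI)
      fix a b assume "a \<in> to_mp ` T" "b \<in> to_mp ` T"
      then obtain p q where "a = to_mp p" "b = to_mp q" "p \<in> T" "q \<in> T" by blast
      then show "a + b \<in> to_mp ` T" "a * b \<in> to_mp ` T"
        using preordering_closed(1,2)[OF T] by (simp_all flip: to_mp.hom_add to_mp.hom_mult)
    next
      fix a :: "'d mp"
      have "a\<^sup>2 = to_mp ((of_mp a)\<^sup>2)" by (simp add: to_mp.hom_power)
      then show "a\<^sup>2 \<in> to_mp ` T" using preordering_closed(3)[OF T] by blast
    qed
    show "c\<^sup>2 * to_mp f \<notin> to_mp ` T" if "c \<noteq> 0" for c
    proof
      assume "c\<^sup>2 * to_mp f \<in> to_mp ` T"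
      moreover have "c\<^sup>2 * to_mp f = to_mp ((of_mp c)\<^sup>2 * f)" by (simp add: to_mp.hom_mult to_mp.hom_power)
      ultimately have "(of_mp c)\<^sup>2 * f \<in> T" by (auto simp: to_mp_inject)
      then show False using f[of "of_mp c"] that by simp
    qed
  qed (use G D in auto)
  then show ?thesis by (simp add: meval.abs_eq)
qed

lemma (in cring_hom) hom_bil: "h (bil F u v) = bil (\<lambda>i j. h (F i j)) (\<lambda>i. h (u i)) (\<lambda>i. h (v i))"
  by (simp add: bil_def hom_sum hom_mult)

lemma (in cring_hom) hom_sum_list: "h (sum_list xs) = (\<Sum>x\<leftarrow>xs. h x)"
  by (induction xs) (auto simp: hom_add)

lemma sym_mats_nth: "A \<in> sym_mats \<longleftrightarrow> (\<forall>i j. A $ i $ j = A $ j $ i)"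
  by (auto simp: sym_mats_def transpose_def vec_eq_iff)

lemma lagrange_reduction_rpoly:
  fixes A :: "'d::finite rpoly ^ 'n ^ 'n"
  assumes "A \<in> sym_mats"
  shows "\<exists>b xs. b \<noteq> 0 \<and> (\<forall>k l. b\<^sup>2 * A $ k $ l = (\<Sum>(u, w)\<leftarrow>xs. bil (\<lambda>i j. A $ i $ j) u u * w k * w l))"
proof -
  interpret of_mp: cring_hom "of_mp :: 'd mp \<Rightarrow> _" by (rule cring_hom_of_mp)
  have "\<exists>b xs. b \<noteq> 0 \<and> (\<forall>k l. b\<^sup>2 * to_mp (A $ k $ l) =
      (\<Sum>(u, w)\<leftarrow>xs. bil (\<lambda>i j. to_mp (A $ i $ j)) u u * w k * w l))"
  proof (rule lagrange_reduction[of UNIV])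
    show "to_mp (A $ i $ j) = to_mp (A $ j $ i)" for i j using assms by (simp add: sym_mats_nth)
  qed auto
  then obtain b xs where b: "b \<noteq> 0" "\<And>k l. b\<^sup>2 * to_mp (A $ k $ l) =
      (\<Sum>(u, w)\<leftarrow>xs. bil (\<lambda>i j. to_mp (A $ i $ j)) u u * w k * w l)" by blast
  define ys where "ys = map (\<lambda>(u, w). (\<lambda>i. of_mp (u i), \<lambda>i. of_mp (w i))) xs"
  have "(of_mp b)\<^sup>2 * A $ k $ l = (\<Sum>(u, w)\<leftarrow>ys. bil (\<lambda>i j. A $ i $ j) u u * w k * w l)" for k l
    using arg_cong[OF b(2), of of_mp k l]
    by (simp add: ys_def of_mp.hom_mult of_mp.hom_power of_mp.hom_sum_list of_mp.hom_bil comp_def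
        case_prod_unfold)
  moreover have "of_mp b \<noteq> 0" using b(1) by simp
  ultimately show ?thesis by blast
qed

lemma quadratic_form_bil: "v \<bullet> (A *v v) = bil (\<lambda>i j. A $ i $ j) (($) v) (($) v)"
  for A :: "real ^ 'n ^ 'n"
  by (simp add: inner_vec_def matrix_vector_mult_def bil_def sum_distrib_left mult.assoc)

lemma mat_eval_nth: "mat_eval A x $ i $ j = poly_eval (A $ i $ j) x"
  by (simp add: mat_eval_def map_matrix_def)

text \<open>Where \<open>b\<close> does not vanish, a positive multiple of the form is a sum of
  squares of linear forms with the given weights. This is why the multipliers have to be nonzero at
  the point chosen.\<close>

lemma pos_semidef_mat_eval:
  fixes A :: "'d::finite rpoly ^ 'n ^ 'n"
  assumes A: "A \<in> sym_mats"
    and red: "\<And>k l. b\<^sup>2 * A $ k $ l = (\<Sum>(u, w)\<leftarrow>xs. bil (\<lambda>i j. A $ i $ j) u u * w k * w l)"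
    and b: "poly_eval b x \<noteq> 0"
    and nonneg: "\<And>u w. (u, w) \<in> set xs \<Longrightarrow> 0 \<le> poly_eval (bil (\<lambda>i j. A $ i $ j) u u) x"
  shows "pos_semidef (mat_eval A x)"
  unfolding pos_semidef_def
proof (intro conjI allI)
  interpret e: cring_hom "\<lambda>p. poly_eval p x" by (rule cring_hom_poly_eval)
  show "mat_eval A x \<in> sym_mats" using A by (simp add: sym_mats_nth mat_eval_nth)
  fix v :: "real ^ 'n"
  define e where "e p = poly_eval p x" for p :: "'d rpoly"
  have red': "(e b)\<^sup>2 * e (A $ k $ l) = (\<Sum>(u, w)\<leftarrow>xs. e (bil (\<lambda>i j. A $ i $ j) u u) * e (w k) * e (w l))" for k l
    using arg_cong[OF red, of "\<lambda>p. poly_eval p x" k l]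
    by (simp add: e_def e.hom_mult e.hom_power e.hom_sum_list comp_def case_prod_unfold)
  have "(e b)\<^sup>2 * (v \<bullet> (mat_eval A x *v v)) = bil (\<lambda>k l. (e b)\<^sup>2 * e (A $ k $ l)) (($) v) (($) v)"
    by (simp only: quadratic_form_bil mat_eval_nth bil_forms e_def)
  also have "\<dots> = (\<Sum>(u, w)\<leftarrow>xs. e (bil (\<lambda>i j. A $ i $ j) u u) * (\<Sum>k\<in>UNIV. e (w k) * v $ k)\<^sup>2)"
    unfolding red'
  proof (induction xs)
    case (Cons a xs)
    obtain u w where "a = (u, w)" by (cases a)
    then show ?case
      using Cons bil_rank_one[of "\<lambda>k. e (w k)" "\<lambda>k. e (w k)" "($) v" "($) v"]
      by (simp add: bil_forms mult.assoc power2_eq_square)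
  qed (simp add: bil_def)
  also have "0 \<le> \<dots>"
    using nonneg by (intro sum_list_nonneg) (auto simp: e_def)
  finally show "0 \<le> v \<bullet> (mat_eval A x *v v)"
    using b by (simp add: e_def zero_le_mult_iff)
qed

lemma weighted_squares_reduction:
  fixes F :: "'a::comm_ring_1 ^ 'n ^ 'n"
  assumes red: "\<And>k l. b\<^sup>2 * F $ k $ l = (\<Sum>(u, w)\<leftarrow>xs. p u * w k * w l)"
    and c: "\<And>u w. (u, w) \<in> set xs \<Longrightarrow> c\<^sup>2 * p u \<in> T"
  shows "mat ((c * b)\<^sup>2) ** F \<in> weighted_squares T"
proof -
  \<comment> \<open>Any row index serves: a matrix whose only nonzero row is \<open>w\<close> has
    the rank one matrix of \<open>w\<close> as its Gram matrix.\<close>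
  define r :: 'n where "r = undefined"
  define m where "m i = c\<^sup>2 * p (fst (xs ! i))" for i
  define A :: "nat \<Rightarrow> 'a ^ 'n ^ 'n" where "A i = (\<chi> k l. if k = r then snd (xs ! i) l else 0)" for i
  have A: "(transpose (A i) ** A i) $ k $ l = snd (xs ! i) k * snd (xs ! i) l" for i k l
    by (simp add: matrix_matrix_mult_def transpose_def A_def if_distrib[of "\<lambda>x. _ * x"] cong: if_cong)
  have "mat ((c * b)\<^sup>2) ** F = (\<Sum>i<length xs. mat (m i) ** (transpose (A i) ** A i))"
  proof -
    have "(c * b)\<^sup>2 * F $ k $ l = (\<Sum>i<length xs. m i * (snd (xs ! i) k * snd (xs ! i) l))" for k l
    proof -
      have "(c * b)\<^sup>2 * F $ k $ l = c\<^sup>2 * (b\<^sup>2 * F $ k $ l)"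
        by (simp only: power_mult_distrib mult.assoc)
      also have "\<dots> = c\<^sup>2 * (\<Sum>(u, w)\<leftarrow>xs. p u * w k * w l)" by (simp only: red)
      also have "\<dots> = (\<Sum>i<length xs. m i * (snd (xs ! i) k * snd (xs ! i) l))"
        by (simp add: sum_list_sum_nth case_prod_unfold sum_distrib_left m_def mult.assoc atLeast0LessThan)
      finally show ?thesis .
    qed
    then show ?thesis by (simp add: vec_eq_iff mat_mult_left_nth A)
  qed
  moreover have "\<forall>i<length xs. m i \<in> T"
    using c unfolding m_def by (metis nth_mem prod.collapse)
  ultimately show ?thesis unfolding weighted_squares_def by (intro CollectI exI conjI)
qed

text \<open>The individual multipliers are multiplied together; surplus squares do not lead out of a
  preordering.\<close>

lemma common_multiplier:
  fixes T :: "'d::finite rpoly set"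
  assumes T: "preordering T" and "finite P" "\<And>p. p \<in> P \<Longrightarrow> \<exists>c. c \<noteq> 0 \<and> c\<^sup>2 * p \<in> T"
  shows "\<exists>c. c \<noteq> 0 \<and> (\<forall>p\<in>P. c\<^sup>2 * p \<in> T)"
  using assms(2,3)
proof (induction P rule: finite_induct)
  case empty
  then show ?case by (intro exI[of _ 1]) simp
next
  case (insert q P)
  have "\<exists>c. c \<noteq> 0 \<and> (\<forall>p\<in>P. c\<^sup>2 * p \<in> T)" by (rule insert.IH) (simp add: insert.prems)
  then obtain c where c: "c \<noteq> 0" "\<And>p. p \<in> P \<Longrightarrow> c\<^sup>2 * p \<in> T" by blast
  obtain d where d: "d \<noteq> 0" "d\<^sup>2 * q \<in> T" using insert.prems[of q] by auto
  have "(c * d)\<^sup>2 * p \<in> T" if p: "p \<in> insert q P" for p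
  proof -
    have eq: "(c * d)\<^sup>2 * p = d\<^sup>2 * (c\<^sup>2 * p)" "(c * d)\<^sup>2 * p = c\<^sup>2 * (d\<^sup>2 * p)"
      by (simp_all add: power_mult_distrib mult_ac)
    show ?thesis
    proof (cases "p = q")
      case True
      then have "d\<^sup>2 * p \<in> T" using d(2) by simp
      then show ?thesis unfolding eq(2) by (rule preordering_closed(2)[OF T preordering_closed(3)[OF T]])
    next
      case False
      then have "p \<in> P" using p by simp
      then show ?thesis unfolding eq(1) by (intro preordering_closed(2,3)[OF T] c(2))
    qed
  qed
  then show ?case using rpoly_mult_nonzero[OF c(1) d(1)] by blast
qed

lemma generated_preordering_superset: "G \<subseteq> generated_preordering G"
  unfolding generated_preordering_def by (rule hull_subset)

lemma generated_preordering_minimal: "G \<subseteq> T \<Longrightarrow> preordering T \<Longrightarrow> generated_preordering G \<subseteq> T"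
  unfolding generated_preordering_def by (rule hull_minimal)

theorem theorem4p3:
  fixes \<G> :: "('d::finite rpoly ^ 'n ^ 'n) set"
    and F :: "'d rpoly ^ 'n ^ 'n"
  assumes "finite \<G>" and "\<G> \<subseteq> sym_mats" and "F \<in> sym_mats"
    and pos: "\<forall>x\<in>nonneg_set \<G>. pos_def (mat_eval F x)"
    and bdd: "\<exists>N>0. \<forall>x\<in>nonneg_set \<G>.
      pos_semidef (mat N + mat_eval F x) \<and> pos_semidef (mat N - mat_eval F x)"
    and asymp: "\<forall>v :: real ^ 'n. v \<noteq> 0 \<longrightarrow>
      finite (asymptotic_values (quadratic_form F v) (nonneg_set \<G>)) \<and>
      asymptotic_values (quadratic_form F v) (nonneg_set \<G>) \<subseteq> {0<..}"
  shows "\<exists>G :: 'd rpoly set. finite G \<and>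
    (weighted_squares (generated_preordering G) :: ('d rpoly ^ 'n ^ 'n) set)
      \<subseteq> generated_mat_preordering \<G> \<and>
    (\<exists>X :: 'd rpoly ^ 'n ^ 'n.
      X ** F ** transpose X \<in> weighted_squares (generated_preordering G)) \<and>
    (\<exists>b :: 'd rpoly. b \<noteq> 0 \<and>
      mat (b ^ 2) ** F \<in> weighted_squares (generated_preordering G))"
proof -
  let ?q = "\<lambda>(A :: 'd rpoly ^ 'n ^ 'n) u. bil (\<lambda>i j. A $ i $ j) u u"
  have "\<forall>A\<in>\<G>. \<exists>r. fst r \<noteq> 0 \<and>
      (\<forall>k l. (fst r)\<^sup>2 * A $ k $ l = (\<Sum>(u, w)\<leftarrow>snd r. ?q A u * w k * w l))"
  proof
    fix A assume "A \<in> \<G>"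
    then have "A \<in> sym_mats" using assms(2) by blast
    from lagrange_reduction_rpoly[OF this] show "\<exists>r. fst r \<noteq> 0 \<and>
      (\<forall>k l. (fst r)\<^sup>2 * A $ k $ l = (\<Sum>(u, w)\<leftarrow>snd r. ?q A u * w k * w l))"
      by simp
  qed
  from bchoice[OF this] obtain r where r: "\<forall>A\<in>\<G>. fst (r A) \<noteq> 0 \<and>
      (\<forall>k l. (fst (r A))\<^sup>2 * A $ k $ l = (\<Sum>(u, w)\<leftarrow>snd (r A). ?q A u * w k * w l))"
    by blast
  define b where "b A = fst (r A)" for A
  define xs where "xs A = snd (r A)" for A
  have b: "b A \<noteq> 0" if "A \<in> \<G>" for A using r that by (simp add: b_def)
  have xs: "(b A)\<^sup>2 * A $ k $ l = (\<Sum>(u, w)\<leftarrow>xs A. ?q A u * w k * w l)" if "A \<in> \<G>" for A k l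
    using r that by (simp add: b_def xs_def)
  obtain bF ys where bF: "bF \<noteq> 0"
    and ys: "\<And>k l. bF\<^sup>2 * F $ k $ l = (\<Sum>(u, w)\<leftarrow>ys. ?q F u * w k * w l)"
    using lagrange_reduction_rpoly[OF assms(3)] by blast
  define G where "G = (\<Union>A\<in>\<G>. (\<lambda>(u, w). ?q A u) ` set (xs A))"
  define T where "T = generated_preordering G"
  have finG: "finite G" using assms(1) by (simp add: G_def)
  have T: "preordering T" unfolding T_def by (rule preordering_generated)
  note M = mat_preordering_generated[OF assms(2)]
  have "\<G> \<subseteq> generated_mat_preordering \<G>" unfolding generated_mat_preordering_def by (rule hull_subset)
  then have "G \<subseteq> {p. mat p \<in> generated_mat_preordering \<G>}"
    using value_in_scalars[OF M] by (auto simp: G_def)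
  then have "T \<subseteq> {p. mat p \<in> generated_mat_preordering \<G>}"
    unfolding T_def using preordering_scalars[OF M] by (rule generated_preordering_minimal)
  then have sub: "(weighted_squares T :: ('d rpoly ^ 'n ^ 'n) set) \<subseteq> generated_mat_preordering \<G>"
    using weighted_squares_subset[OF M] by blast
  have mult: "\<exists>c. c \<noteq> 0 \<and> c\<^sup>2 * ?q F u \<in> T" for u
  proof (rule ccontr)
    assume n: "\<not> ?thesis"
    \<comment> \<open>Taking the multipliers of \<G> as the polynomials that must not vanish is what
      places the point in \<open>nonneg_set \<G>\<close>.\<close>
    have "\<exists>x. (\<forall>g\<in>G. 0 \<le> poly_eval g x) \<and> poly_eval (?q F u) x < 0 \<and> (\<forall>d\<in>b ` \<G>. poly_eval d x \<noteq> 0)"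
    proof (rule generic_positivstellensatz[OF T _ finG])
      show "G \<subseteq> T" unfolding T_def by (rule generated_preordering_superset)
    qed (use n b assms(1) in auto)
    then obtain x where x: "\<And>g. g \<in> G \<Longrightarrow> 0 \<le> poly_eval g x" "poly_eval (?q F u) x < 0"
      "\<And>A. A \<in> \<G> \<Longrightarrow> poly_eval (b A) x \<noteq> 0" by blast
    have "pos_semidef (mat_eval A x)" if A: "A \<in> \<G>" for A
    proof (rule pos_semidef_mat_eval[OF _ xs[OF A] x(3)[OF A]])
      show "A \<in> sym_mats" using A assms(2) by blast
      show "0 \<le> poly_eval (?q A u) x" if "(u, w) \<in> set (xs A)" for u w
        using that A by (intro x(1)) (force simp: G_def)
    qed
    then have "pos_def (mat_eval F x)" using pos by (simp add: nonneg_set_def)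
    \<comment> \<open>\<open>u\<close> may vanish at \<open>x\<close>, so positive definiteness
      gives only a nonnegative value; this already contradicts the strict sign.\<close>
    moreover define v where "v = (\<chi> i. poly_eval (u i) x)"
    ultimately have "0 \<le> v \<bullet> (mat_eval F x *v v)"
      unfolding pos_def_def by (cases "v = 0") (auto intro: less_imp_le)
    moreover have "($) v = (\<lambda>i. poly_eval (u i) x)" by (simp add: v_def fun_eq_iff)
    then have "v \<bullet> (mat_eval F x *v v) = poly_eval (?q F u) x"
      unfolding quadratic_form_bil mat_eval_nth
      by (simp add: cring_hom.hom_bil[OF cring_hom_poly_eval])
    ultimately show False using x(2) by simp
  qed
  have "\<exists>c. c \<noteq> 0 \<and> (\<forall>p\<in>(\<lambda>(u, w). ?q F u) ` set ys. c\<^sup>2 * p \<in> T)"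
    by (rule common_multiplier[OF T]) (use mult in auto)
  then obtain c where c: "c \<noteq> 0" "\<And>u w. (u, w) \<in> set ys \<Longrightarrow> c\<^sup>2 * ?q F u \<in> T" by force
  have "mat ((c * bF)\<^sup>2) ** F \<in> weighted_squares T"
    by (rule weighted_squares_reduction[OF ys c(2)])
  moreover have "c * bF \<noteq> 0" using rpoly_mult_nonzero[OF c(1) bF] .
  moreover have "\<exists>X :: 'd rpoly ^ 'n ^ 'n. X ** F ** transpose X \<in> weighted_squares T"
  proof -
    have "(0 :: 'd rpoly ^ 'n ^ 'n) \<in> weighted_squares T"
      unfolding weighted_squares_def by (intro CollectI exI[of _ 0]) simp
    moreover have "(0 :: 'd rpoly ^ 'n ^ 'n) ** F ** transpose 0 = 0"
      by (simp add: matrix_matrix_mult_def zero_vec_def)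
    ultimately show ?thesis by metis
  qed
  ultimately show ?thesis using finG sub unfolding T_def by blast
qed

end
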